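(* Suppose that $\theta$ is in the interior of $\Theta$, that $\hat\theta_n$ satisfies $\sqrt n\,|\hat\theta_n-\theta|=O_P(1)$, and that $\lim_{x\to 0}x^{-\zeta}P\{|\varepsilon_0|\le x\}=0$ for some $\zeta>0$. If $E|\varepsilon_0|^k<\infty$ for an integer $k\ge 1$, then, as $n\to\infty$, $$\left|\frac{1}{\sqrt n}\sum_{t=1}^n\bigl|\hat\varepsilon_t^k-\varepsilon_t^k\bigr|-\frac k2\,\psi_k\bigl(\sqrt n(\hat\theta_n-\theta)\bigr)\right|=o_P(1),$$ where $$\psi_k(\mathbf u)=E\bigl|\langle\varepsilon_0^k\,\partial\log\sigma_0^2(\theta),\mathbf u\rangle\bigr|,\qquad \mathbf u\in\mathbb R^{p+q+1}.$$
   Context: Model. Let $p,q\ge 1$ be integers and $\theta=(\alpha_0,\alpha_1,\dots,\alpha_p,\beta_1,\dots,\beta_q)$ with $\alpha_0>0$, $\alpha_i\ge 0$, $\beta_j\ge 0$. Let $\{\varepsilon_t\}_{t\in\mathbb Z}$ be i.i.d. random variables with mean $0$ and variance $1$. $\{X_t\}_{t\in\mathbb Z}$ is a GARCH$(p,q)$ sequence: $X_t=\sigma_t\varepsilon_t$, $\sigma_t^2=\alpha_0+\sum_{i=1}^p\alpha_iX_{t-i}^2+\sum_{j=1}^q\beta_j\sigma_{t-j}^2$. Standing assumption: the Bougerol–Picard conditions hold, under which these equations have a unique strictly stationary solution, with $\sigma_t$ a function of $\varepsilon_{t-1},\varepsilon_{t-2},\dots$; $\{X_t\}$ is this solution. Notation.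 $|\cdot|$ is the maximum norm of vectors (absolute value for scalars) and $\langle\cdot,\cdot\rangle$ the inner product. For $\mathbf u=(s_0,\dots,s_p,t_1,\dots,t_q)\in\mathbb R^{p+q+1}$ put $c_0(\mathbf u)=s_0/(1-(t_1+\cdots+t_q))$ and, recursively for $i\ge 1$, $c_i(\mathbf u)=s_i+\sum_{j=1}^{\min(i-1,q)}t_jc_{i-j}(\mathbf u)$ if $i\le p$, and $c_i(\mathbf u)=\sum_{j=1}^{\min(i-1,q)}t_jc_{i-j}(\mathbf u)$ if $i>p$. Fix $0<\underline u<\bar u$, $0<\rho_0<1$ with $q\underline u<\rho_0$, and let $\Theta$ be the set of $\mathbf u$ with $t_1+\cdots+t_q\le\rho_0$ and all coordinates of $\mathbf u$ in $[\underline u,\bar u]$. For $\mathbf u\in\Theta$ let $\sigma_t^2(\mathbf u)=c_0(\mathbf u)+\sum_{i=1}^\infty c_i(\mathbf u)X_{t-i}^2$ (a.s. finite); then $\sigma_t^2=\sigma_t^2(\theta)$. Write $\partial$ for the gradient with respect to $\mathbf u$ and $\partial\log\sigma_t^2(\mathbf u)=\dfrac{\partial c_0(\mathbf u)+\sum_{i\ge1}\partial c_i(\mathbf u)X_{t-i}^2}{c_0(\mathbf u)+\sum_{i\ge1}c_i(\mathbf u)X_{t-i}^2}\in\mathbb R^{p+q+1}$. Residuals. $\hat\theta_n$ is an estimator of $\theta$ based on $X_0,\dots,X_n$. For $1\le t\le n$, $\hat\sigma_t^2=c_0(\hat\theta_n)+\sum_{i=1}^tc_i(\hat\theta_n)X_{t-i}^2$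 and $\hat\varepsilon_t=X_t/\hat\sigma_t$. *)

theory Defs
  imports "HOL-Probability.Probability" "Jordan_Normal_Form.Matrix"
begin

text \<open>
  A parameter vector \<open>u = (s\<^sub>0, \<dots>, s\<^sub>p, t\<^sub>1, \<dots>, t\<^sub>q)\<close> of \<open>\<real>\<^bsup>p+q+1\<^esup>\<close> is an element of
  \<^term>\<open>topspace (Euclidean_space (p + q + 1))\<close>, a function on \<^typ>\<open>nat\<close> that is zero from
  \<open>p + q + 1\<close> on, with \<open>s\<^sub>i = u i\<close> for \<open>0 \<le> i \<le> p\<close> and \<open>t\<^sub>j = u (p + j)\<close> for \<open>1 \<le> j \<le> q\<close>.
\<close>

definition max_norm :: "nat \<Rightarrow> (nat \<Rightarrow> real) \<Rightarrow> real" where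
  "max_norm d v = Max ((\<lambda>i. \<bar>v i\<bar>) ` {..<d})"

definition inner_prod :: "nat \<Rightarrow> (nat \<Rightarrow> real) \<Rightarrow> (nat \<Rightarrow> real) \<Rightarrow> real" where
  "inner_prod d v w = (\<Sum>i<d. v i * w i)"

definition bounded_in_prob :: "'a measure \<Rightarrow> (nat \<Rightarrow> 'a \<Rightarrow> real) \<Rightarrow> bool" where
  "bounded_in_prob M Y \<longleftrightarrow>
     (\<forall>\<eta>>0. \<exists>C. \<forall>\<^sub>F n in sequentially. measure M {\<omega> \<in> space M. \<bar>Y n \<omega>\<bar> > C} \<le> \<eta>)"

definition null_in_prob :: "'a measure \<Rightarrow> (nat \<Rightarrow> 'a \<Rightarrow> real) \<Rightarrow> bool" where
  "null_in_prob M Y \<longleftrightarrow>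
     (\<forall>\<delta>>0. (\<lambda>n. measure M {\<omega> \<in> space M. \<bar>Y n \<omega>\<bar> > \<delta>}) \<longlonglongrightarrow> 0)"

definition strictly_stationary :: "'a measure \<Rightarrow> (int \<Rightarrow> 'a \<Rightarrow> real) \<Rightarrow> bool" where
  "strictly_stationary M Y \<longleftrightarrow>
     (\<forall>h. distr M (Pi\<^sub>M UNIV (\<lambda>_. borel)) (\<lambda>\<omega> t. Y (t + h) \<omega>) =
          distr M (Pi\<^sub>M UNIV (\<lambda>_. borel)) (\<lambda>\<omega> t. Y t \<omega>))"

subsection \<open>The Bougerol--Picard conditions\<close>

text \<open>
  The matrix \<open>A\<^sub>t\<close>, for \<open>\<epsilon>\<^sub>t = e\<close>, of the Markovian representation
  \<open>Z\<^sub>t = A\<^sub>t Z\<^bsub>t-1\<^esub> + (\<alpha>\<^sub>0, 0, \<dots>, 0)\<close> of the GARCH equations, where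
  \<open>Z\<^sub>t = (\<sigma>\<^sup>2\<^bsub>t+1\<^esub>, \<dots>, \<sigma>\<^sup>2\<^bsub>t-q+2\<^esub>, X\<^sup>2\<^bsub>t\<^esub>, \<dots>, X\<^sup>2\<^bsub>t-p+2\<^esub>)\<close> has dimension \<open>p + q - 1\<close>.
  For \<open>p, q \<ge> 2\<close> this is Bougerol and Picard's matrix; for \<open>p = 1\<close> there is no \<open>X\<close> block and
  row \<open>q\<close> and the columns from \<open>q\<close> on are absent, and for \<open>q = 1\<close> the \<open>\<sigma>\<close> block is just
  \<open>\<sigma>\<^sup>2\<^bsub>t+1\<^esub>\<close>.
\<close>

definition bp_matrix :: "nat \<Rightarrow> nat \<Rightarrow> (nat \<Rightarrow> real) \<Rightarrow> real \<Rightarrow> real mat" where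
  "bp_matrix p q \<theta> e = Matrix.mat (p + q - 1) (p + q - 1) (\<lambda>(i, j).
     if i = 0 then
       (if j = 0 then \<theta> (p + 1) + \<theta> 1 * e\<^sup>2
        else if j < q then \<theta> (p + (j + 1))
        else \<theta> (j - q + 2))
     else if i = q then (if j = 0 then e\<^sup>2 else 0)
     else (if j = i - 1 then 1 else 0))"

definition op_norm :: "nat \<Rightarrow> real mat \<Rightarrow> real" where
  "op_norm d A =
     (SUP x \<in> carrier_vec d - {0\<^sub>v d}.
        max_norm d (vec_index (A *\<^sub>v x)) / max_norm d (vec_index x))"

text \<open>\<open>A\<^sub>0 A\<^bsub>-1\<^esub> \<cdots> A\<^bsub>-(n-1)\<^esub>\<close> along a path \<open>e\<close> of the innovations.\<close>

primrec bp_product :: "nat \<Rightarrow> nat \<Rightarrow> (nat \<Rightarrow> real) \<Rightarrow> (int \<Rightarrow> real) \<Rightarrow> nat \<Rightarrow> real mat" where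
  "bp_product p q \<theta> e 0 = 1\<^sub>m (p + q - 1)"
| "bp_product p q \<theta> e (Suc n) = bp_product p q \<theta> e n * bp_matrix p q \<theta> (e (- int n))"

definition log_ereal :: "real \<Rightarrow> ereal" where
  "log_ereal x = (if x \<le> 0 then - \<infinity> else ereal (ln x))"

text \<open>
  The expectations in the Lyapunov exponent may be \<open>- \<infinity>\<close>, hence the extended integral
  (positive minus negative part) instead of the Bochner integral. Note that \<^const>\<open>e2ennreal\<close>
  maps negative values to \<open>0\<close>.
\<close>

definition ereal_expectation :: "'a measure \<Rightarrow> ('a \<Rightarrow> ereal) \<Rightarrow> ereal" where
  "ereal_expectation M f =
     enn2ereal (\<integral>\<^sup>+\<omega>. e2ennreal (f \<omega>) \<partial>M) - enn2ereal (\<integral>\<^sup>+\<omega>. e2ennreal (- f \<omega>) \<partial>M)"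

definition top_lyapunov ::
  "'a measure \<Rightarrow> nat \<Rightarrow> nat \<Rightarrow> (nat \<Rightarrow> real) \<Rightarrow> (int \<Rightarrow> 'a \<Rightarrow> real) \<Rightarrow> ereal" where
  "top_lyapunov M p q \<theta> \<epsilon> =
     (INF n\<in>{1..}. ereal_expectation M
        (\<lambda>\<omega>. log_ereal (op_norm (p + q - 1) (bp_product p q \<theta> (\<lambda>t. \<epsilon> t \<omega>) n))) / ereal (real n))"

definition bougerol_picard ::
  "'a measure \<Rightarrow> nat \<Rightarrow> nat \<Rightarrow> (nat \<Rightarrow> real) \<Rightarrow> (int \<Rightarrow> 'a \<Rightarrow> real) \<Rightarrow> bool" where
  "bougerol_picard M p q \<theta> \<epsilon> \<longleftrightarrow>
     integrable M (\<lambda>\<omega>. max 0 (ln (op_norm (p + q - 1) (bp_matrix p q \<theta> (\<epsilon> 0 \<omega>))))) \<and>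
     top_lyapunov M p q \<theta> \<epsilon> < 0"

subsection \<open>The GARCH sequence\<close>

text \<open>
  \<open>X\<close> is the strictly stationary solution of the GARCH equations, with volatility
  \<open>\<sigma>\<^sub>t = g(\<epsilon>\<^bsub>t-1\<^esub>, \<epsilon>\<^bsub>t-2\<^esub>, \<dots>)\<close>.
\<close>

locale garch = prob_space M for M :: "'a measure" +
  fixes p q :: nat and \<theta> :: "nat \<Rightarrow> real" and \<epsilon> X \<sigma> :: "int \<Rightarrow> 'a \<Rightarrow> real"
  assumes orders: "p \<ge> 1" "q \<ge> 1"
    and theta_vec: "\<theta> \<in> topspace (Euclidean_space (p + q + 1))"
    and alpha0: "\<theta> 0 > 0"
    and alpha: "\<And>i. i \<in> {1..p} \<Longrightarrow> \<theta> i \<ge> 0"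
    and beta: "\<And>j. j \<in> {1..q} \<Longrightarrow> \<theta> (p + j) \<ge> 0"
    and innov_indep: "indep_vars (\<lambda>_. borel) \<epsilon> UNIV"
    and innov_ident: "\<And>t. distr M borel (\<epsilon> t) = distr M borel (\<epsilon> 0)"
    and innov_integrable: "integrable M (\<epsilon> 0)" "integrable M (\<lambda>\<omega>. (\<epsilon> 0 \<omega>)\<^sup>2)"
    and innov_mean: "expectation (\<epsilon> 0) = 0"
    and innov_var: "variance (\<epsilon> 0) = 1"
    and bp: "bougerol_picard M p q \<theta> \<epsilon>"
    and X_rv: "\<And>t. X t \<in> borel_measurable M"
    and sigma_rv: "\<And>t. \<sigma> t \<in> borel_measurable M"
    and sigma_nonneg: "\<And>t. AE \<omega> in M. \<sigma> t \<omega> \<ge> 0"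
    and X_eq: "\<And>t. AE \<omega> in M. X t \<omega> = \<sigma> t \<omega> * \<epsilon> t \<omega>"
    and sigma_eq: "\<And>t. AE \<omega> in M. (\<sigma> t \<omega>)\<^sup>2 = \<theta> 0
                      + (\<Sum>i=1..p. \<theta> i * (X (t - int i) \<omega>)\<^sup>2)
                      + (\<Sum>j=1..q. \<theta> (p + j) * (\<sigma> (t - int j) \<omega>)\<^sup>2)"
    and stationary: "strictly_stationary M X"
    and nonanticipative: "\<exists>g \<in> borel_measurable (Pi\<^sub>M UNIV (\<lambda>_. borel)).
                      \<forall>t. AE \<omega> in M. \<sigma> t \<omega> = g (\<lambda>m::nat. \<epsilon> (t - 1 - int m) \<omega>)"

subsection \<open>The functionals of the parameter\<close>

definition param_space :: "nat \<Rightarrow> nat \<Rightarrow> real \<Rightarrow> real \<Rightarrow> real \<Rightarrow> (nat \<Rightarrow> real) set" where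
  "param_space p q ulo uhi \<rho>0 =
     {u \<in> topspace (Euclidean_space (p + q + 1)).
        (\<Sum>j=1..q. u (p + j)) \<le> \<rho>0 \<and> (\<forall>i<p + q + 1. u i \<in> {ulo..uhi})}"

fun c_coeff :: "nat \<Rightarrow> nat \<Rightarrow> (nat \<Rightarrow> real) \<Rightarrow> nat \<Rightarrow> real" where
  "c_coeff p q u 0 = u 0 / (1 - (\<Sum>j=1..q. u (p + j)))"
| "c_coeff p q u (Suc m) =
     (if Suc m \<le> p then u (Suc m) else 0)
     + (\<Sum>j=1..min m q. u (p + j) * c_coeff p q u (Suc m - j))"

text \<open>The \<open>l\<close>-th component of the gradient \<open>\<partial>c\<^sub>i(u)\<close>.\<close>

definition grad_c :: "nat \<Rightarrow> nat \<Rightarrow> (nat \<Rightarrow> real) \<Rightarrow> nat \<Rightarrow> nat \<Rightarrow> real" where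
  "grad_c p q u i l = deriv (\<lambda>x. c_coeff p q (u(l := x)) i) (u l)"

text \<open>In the following, \<open>x\<close> is a path of \<open>(X\<^sub>t)\<close>.\<close>

definition sigma2 :: "nat \<Rightarrow> nat \<Rightarrow> (nat \<Rightarrow> real) \<Rightarrow> (int \<Rightarrow> real) \<Rightarrow> int \<Rightarrow> real" where
  "sigma2 p q u x t =
     c_coeff p q u 0 + (\<Sum>m. c_coeff p q u (Suc m) * (x (t - int (Suc m)))\<^sup>2)"

definition grad_log_sigma2 ::
  "nat \<Rightarrow> nat \<Rightarrow> (nat \<Rightarrow> real) \<Rightarrow> (int \<Rightarrow> real) \<Rightarrow> int \<Rightarrow> nat \<Rightarrow> real" where
  "grad_log_sigma2 p q u x t l =
     (grad_c p q u 0 l + (\<Sum>m. grad_c p q u (Suc m) l * (x (t - int (Suc m)))\<^sup>2))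
     / sigma2 p q u x t"

definition sigma2_hat :: "nat \<Rightarrow> nat \<Rightarrow> (nat \<Rightarrow> real) \<Rightarrow> (int \<Rightarrow> real) \<Rightarrow> nat \<Rightarrow> real" where
  "sigma2_hat p q u x t =
     c_coeff p q u 0 + (\<Sum>i=1..t. c_coeff p q u i * (x (int t - int i))\<^sup>2)"

text \<open>The residual \<open>X\<^sub>t / \<sigma>\<close>-hat\<open>\<^sub>t\<close> when the parameter estimate is \<open>u\<close>.\<close>

definition residual :: "nat \<Rightarrow> nat \<Rightarrow> (nat \<Rightarrow> real) \<Rightarrow> (int \<Rightarrow> real) \<Rightarrow> nat \<Rightarrow> real" where
  "residual p q u x t = x (int t) / sqrt (sigma2_hat p q u x t)"

definition psi ::
  "'a measure \<Rightarrow> nat \<Rightarrow> nat \<Rightarrow> (nat \<Rightarrow> real) \<Rightarrow> (int \<Rightarrow> 'a \<Rightarrow> real) \<Rightarrow> (int \<Rightarrow> 'a \<Rightarrow> real)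
     \<Rightarrow> nat \<Rightarrow> (nat \<Rightarrow> real) \<Rightarrow> real" where
  "psi M p q \<theta> \<epsilon> X k u =
     (\<integral>\<omega>. \<bar>inner_prod (p + q + 1)
           (\<lambda>l. \<epsilon> 0 \<omega> ^ k * grad_log_sigma2 p q \<theta> (\<lambda>s. X s \<omega>) 0 l) u\<bar> \<partial>M)"

text \<open>
  \<open>\<theta>\<^sub>n\<close>-hat takes values in \<open>\<real>\<^sup>d\<close>, and each of its coordinates is a Borel function of the
  observations \<open>X\<^sub>0, \<dots>, X\<^sub>n\<close>.
\<close>

definition estimator_seq ::
  "'a measure \<Rightarrow> (int \<Rightarrow> 'a \<Rightarrow> real) \<Rightarrow> nat \<Rightarrow> (nat \<Rightarrow> 'a \<Rightarrow> nat \<Rightarrow> real) \<Rightarrow> bool" where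
  "estimator_seq M X d \<theta>hat \<longleftrightarrow>
     (\<forall>n. (\<forall>\<omega>\<in>space M. \<theta>hat n \<omega> \<in> topspace (Euclidean_space d)) \<and>
          (\<forall>l<d. \<exists>h \<in> borel_measurable (Pi\<^sub>M {..n} (\<lambda>_. borel)).
             \<forall>\<omega>\<in>space M. \<theta>hat n \<omega> l = h (\<lambda>i\<in>{..n}. X (int i) \<omega>)))"

end

theory Submission
  imports Defs
begin

text \<open>
  Put \<open>\<kappa> = k/2\<close> and \<open>h = \<theta>hat - \<theta>\<close>. A power of a residual is
  \<open>\<epsilon>\<^sub>t\<^sup>k (\<sigma>\<^sub>t\<^sup>2 / \<sigma>hat\<^sub>t\<^sup>2)\<^sup>\<kappa>\<close>, so its distance from \<open>\<epsilon>\<^sub>t\<^sup>k\<close> is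
  \<open>\<bar>\<epsilon>\<^sub>t\<bar>\<^sup>k \<bar>(\<sigma>\<^sub>t\<^sup>2 / \<sigma>hat\<^sub>t\<^sup>2)\<^sup>\<kappa> - 1\<bar>\<close>, which to first order in \<open>h\<close> is
  \<open>\<kappa> \<bar>\<epsilon>\<^sub>t\<bar>\<^sup>k \<bar>\<langle>\<partial> log \<sigma>\<^sub>t\<^sup>2(\<theta>), h\<rangle>\<bar>\<close>. Summed over \<open>t \<le> n\<close> and divided by the square root of \<open>n\<close>,
  the first order terms form \<open>\<kappa>\<close> times an average of a stationary functional in the direction
  \<open>sqrt n h\<close>, which is bounded in probability, and by the ergodic theorem such averages converge to \<open>\<psi>\<^sub>k\<close>. Three things make this precise.

  The expansion. The coefficients \<open>c\<^sub>i\<close> with \<open>i \<ge> 1\<close> are polynomials of degree at most \<open>i\<close> with nonnegative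
  coefficients, so a relative change \<open>\<eta>\<close> of the parameters changes \<open>c\<^sub>i\<close> by a factor between
  \<open>(1 - \<eta>)\<^sup>i\<close> and \<open>(1 + \<eta>)\<^sup>i\<close>, with matching bounds for the gradient and the second order term
  (\<open>c_coeff_perturbation\<close>). Relative to \<open>\<sigma>\<^sub>t\<^sup>2\<close>, a perturbed volatility is therefore a weighted mean of
  numbers close to \<open>1\<close>, and convexity of \<open>y \<mapsto> y\<^bsup>-\<kappa>\<^esup>\<close> passes the expansion of the power through the mean
  (\<open>powr_weighted_mean_expansion\<close>). The weights decay geometrically up to a fractional power of past
  observations (\<open>volatility_expansion\<close>). Hence the error is at most \<open>\<eta>\<^sup>2\<close> times a stationary variable that
  has a finite mean as soon as \<open>X\<^sub>0\<close> has some fractional moment, and being a function of the past it is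
  independent of \<open>\<epsilon>\<^sub>t\<close>. Replacing the series by the sum over the available observations costs a term that is
  geometrically small in \<open>t\<close> (\<open>residual_expansion\<close>).

  The fractional moment. A negative Lyapunov exponent makes the mean of the logarithm of the norm of some
  product of the companion matrices negative, hence some fractional moment of that norm is less than \<open>1\<close>
  (\<open>fractional_moment_contraction\<close>); a truncation argument for the resulting stochastic recursion bounds the
  same moment of the volatility (\<open>integrable_of_stochastic_recursion\<close>, \<open>fractional_moment_vol\<close>). The same
  moment shows that the volatility equals its series in the past observations (\<open>sigma_eq_sigma2\<close>).

  The averages. The mean ergodic theorem for functionals of an i.i.d. sequence (\<open>mean_ergodic\<close>) gives the
  convergence for each fixed direction. Averages and limits are Lipschitz in the direction, so convergence on a
  finite grid is enough for a random direction that is bounded in probability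
  (\<open>residual_power_deviation\<close>).
\<close>


section \<open>Perturbation of the coefficients\<close>

declare c_coeff.simps(2) [simp del]

lemma DERIV_fun_upd:
  "((\<lambda>x::real. (u(l := x)) i) has_real_derivative of_bool (i = l)) (at a)"
  by (cases "i = l") auto

lemma c_coeff_DERIV_rec:
  fixes u :: "nat \<Rightarrow> real"
  assumes S: "(\<Sum>j=1..q. u (p + j)) \<noteq> 1"
  shows "((\<lambda>x. c_coeff p q (u(l := x)) i) has_real_derivative grad_c p q u i l) (at (u l))"
    and "grad_c p q u 0 l = of_bool (0 = l) / (1 - (\<Sum>j=1..q. u (p + j)))
           + u 0 * (\<Sum>j=1..q. of_bool (p + j = l)) / (1 - (\<Sum>j=1..q. u (p + j)))\<^sup>2"
    and "grad_c p q u (Suc m) l = (if Suc m \<le> p then of_bool (Suc m = l) else 0)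
           + (\<Sum>j=1..min m q. of_bool (p + j = l) * c_coeff p q u (Suc m - j)
                              + u (p + j) * grad_c p q u (Suc m - j) l)"
proof -
  have D0: "((\<lambda>x. c_coeff p q (u(l := x)) 0) has_real_derivative
      of_bool (0 = l) / (1 - (\<Sum>j=1..q. u (p + j)))
           + u 0 * (\<Sum>j=1..q. of_bool (p + j = l)) / (1 - (\<Sum>j=1..q. u (p + j)))\<^sup>2) (at (u l))"
  proof -
    have "((\<lambda>x. (u(l := x)) 0 / (1 - (\<Sum>j=1..q. (u(l := x)) (p + j)))) has_real_derivative
       (of_bool (0 = l) * (1 - (\<Sum>j=1..q. (u(l := u l)) (p + j)))
         - (u(l := u l)) 0 * (0 - (\<Sum>j=1..q. of_bool (p + j = l))))
       / ((1 - (\<Sum>j=1..q. (u(l := u l)) (p + j))) * (1 - (\<Sum>j=1..q. (u(l := u l)) (p + j))))) (at (u l))"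
      using S
      by (intro DERIV_divide DERIV_fun_upd DERIV_diff DERIV_const DERIV_sum) simp_all
    moreover have "(of_bool (0 = l) * (1 - (\<Sum>j=1..q. (u(l := u l)) (p + j)))
         - (u(l := u l)) 0 * (0 - (\<Sum>j=1..q. of_bool (p + j = l))))
       / ((1 - (\<Sum>j=1..q. (u(l := u l)) (p + j))) * (1 - (\<Sum>j=1..q. (u(l := u l)) (p + j))))
      = of_bool (0 = l) / (1 - (\<Sum>j=1..q. u (p + j)))
           + u 0 * (\<Sum>j=1..q. of_bool (p + j = l)) / (1 - (\<Sum>j=1..q. u (p + j)))\<^sup>2"
      using S by (simp add: add_divide_distrib power2_eq_square)
    ultimately show ?thesis by (simp only: c_coeff.simps)
  qed
  have DS: "((\<lambda>x. c_coeff p q (u(l := x)) (Suc m)) has_real_derivative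
      (if Suc m \<le> p then of_bool (Suc m = l) else 0)
           + (\<Sum>j=1..min m q. of_bool (p + j = l) * c_coeff p q u (Suc m - j)
                              + u (p + j) * grad_c p q u (Suc m - j) l)) (at (u l))"
    if IH: "\<And>i. i \<le> m \<Longrightarrow> ((\<lambda>x. c_coeff p q (u(l := x)) i) has_real_derivative grad_c p q u i l) (at (u l))" for m
  proof -
    have "((\<lambda>x. (u(l := x)) (p + j) * c_coeff p q (u(l := x)) (Suc m - j)) has_real_derivative
        of_bool (p + j = l) * c_coeff p q u (Suc m - j) + u (p + j) * grad_c p q u (Suc m - j) l) (at (u l))"
      if "j \<in> {1..min m q}" for j
    proof -
      have "((\<lambda>x. (u(l := x)) (p + j) * c_coeff p q (u(l := x)) (Suc m - j)) has_real_derivative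
        of_bool (p + j = l) * c_coeff p q (u(l := u l)) (Suc m - j)
          + grad_c p q u (Suc m - j) l * (u(l := u l)) (p + j)) (at (u l))"
        using that by (intro DERIV_mult DERIV_fun_upd IH) auto
      then show ?thesis by (simp add: mult.commute)
    qed
    moreover have "((\<lambda>x. if Suc m \<le> p then (u(l := x)) (Suc m) else 0) has_real_derivative
        (if Suc m \<le> p then of_bool (Suc m = l) else 0)) (at (u l))"
      by (cases "Suc m = l") auto
    ultimately show ?thesis
      unfolding c_coeff.simps(2) by (intro DERIV_add DERIV_sum)
  qed
  show D: "((\<lambda>x. c_coeff p q (u(l := x)) i) has_real_derivative grad_c p q u i l) (at (u l))" for i
  proof (induction i rule: less_induct)
    case (less i)
    show ?case
    proof (cases i)
      case 0
      show ?thesis unfolding grad_c_def using D0 DERIV_imp_deriv[OF D0] 0 by simp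
    next
      case (Suc m)
      note * = DS[of m]
      have "((\<lambda>x. c_coeff p q (u(l := x)) (Suc m)) has_real_derivative
      (if Suc m \<le> p then of_bool (Suc m = l) else 0)
           + (\<Sum>j=1..min m q. of_bool (p + j = l) * c_coeff p q u (Suc m - j)
                              + u (p + j) * grad_c p q u (Suc m - j) l)) (at (u l))"
        using Suc by (intro * less.IH) auto
      from this DERIV_imp_deriv[OF this] show ?thesis
        unfolding Suc grad_c_def[of p q u "Suc m"] by metis
    qed
  qed
  show "grad_c p q u 0 l = of_bool (0 = l) / (1 - (\<Sum>j=1..q. u (p + j)))
           + u 0 * (\<Sum>j=1..q. of_bool (p + j = l)) / (1 - (\<Sum>j=1..q. u (p + j)))\<^sup>2"
    unfolding grad_c_def by (rule DERIV_imp_deriv[OF D0])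
  show "grad_c p q u (Suc m) l = (if Suc m \<le> p then of_bool (Suc m = l) else 0)
           + (\<Sum>j=1..min m q. of_bool (p + j = l) * c_coeff p q u (Suc m - j)
                              + u (p + j) * grad_c p q u (Suc m - j) l)"
    unfolding grad_c_def[of p q u "Suc m"] by (rule DERIV_imp_deriv[OF DS[OF D]])
qed

definition dir_c :: "nat \<Rightarrow> nat \<Rightarrow> (nat \<Rightarrow> real) \<Rightarrow> (nat \<Rightarrow> real) \<Rightarrow> nat \<Rightarrow> real" where
  "dir_c p q u h i = (\<Sum>l<p + q + 1. grad_c p q u i l * h l)"

lemma sum_of_bool_eq:
  fixes h :: "nat \<Rightarrow> real"
  assumes "a < d"
  shows "(\<Sum>l<d. of_bool (a = l) * h l) = h a"
proof -
  have "(\<Sum>l<d. of_bool (a = l) * h l) = (\<Sum>l<d. if a = l then h l else 0)"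
    by (intro sum.cong) auto
  then show ?thesis using assms by simp
qed

text \<open>The directional derivative obeys the differentiated recursion of the coefficients. It is
  this recursion, rather than the gradient itself, that all bounds below are derived from.\<close>

lemma dir_c_rec:
  fixes u :: "nat \<Rightarrow> real"
  assumes S: "(\<Sum>j=1..q. u (p + j)) \<noteq> 1"
  shows dir_c_0: "dir_c p q u h 0 = h 0 / (1 - (\<Sum>j=1..q. u (p + j)))
           + u 0 * (\<Sum>j=1..q. h (p + j)) / (1 - (\<Sum>j=1..q. u (p + j)))\<^sup>2"
    and dir_c_Suc: "dir_c p q u h (Suc m) = (if Suc m \<le> p then h (Suc m) else 0)
           + (\<Sum>j=1..min m q. h (p + j) * c_coeff p q u (Suc m - j)
                              + u (p + j) * dir_c p q u h (Suc m - j))"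
proof -
  let ?S = "1 - (\<Sum>j=1..q. u (p + j))"
  have sw: "(\<Sum>l<p + q + 1. (\<Sum>j=1..q. of_bool (p + j = l)) * h l) = (\<Sum>j=1..q. h (p + j))"
  proof -
    have "(\<Sum>l<p + q + 1. (\<Sum>j=1..q. of_bool (p + j = l)) * h l)
        = (\<Sum>j=1..q. \<Sum>l<p + q + 1. of_bool (p + j = l) * h l)"
      unfolding sum_distrib_right by (rule sum.swap)
    also have "\<dots> = (\<Sum>j=1..q. h (p + j))"
      by (intro sum.cong refl sum_of_bool_eq) auto
    finally show ?thesis .
  qed
  have "dir_c p q u h 0 = (\<Sum>l<p + q + 1. (of_bool (0 = l) * h l) / ?S
      + u 0 * ((\<Sum>j=1..q. of_bool (p + j = l)) * h l) / ?S\<^sup>2)"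
    unfolding dir_c_def c_coeff_DERIV_rec(2)[OF S] by (intro sum.cong refl) (simp add: algebra_simps)
  also have "\<dots> = (\<Sum>l<p + q + 1. of_bool (0 = l) * h l) / ?S
      + u 0 * (\<Sum>l<p + q + 1. (\<Sum>j=1..q. of_bool (p + j = l)) * h l) / ?S\<^sup>2"
    by (simp only: sum.distrib sum_divide_distrib sum_distrib_left)
  also have "\<dots> = h 0 / ?S + u 0 * (\<Sum>j=1..q. h (p + j)) / ?S\<^sup>2"
    by (subst sw, subst sum_of_bool_eq) simp_all
  finally show "dir_c p q u h 0 = h 0 / ?S + u 0 * (\<Sum>j=1..q. h (p + j)) / ?S\<^sup>2" .
  have "dir_c p q u h (Suc m) = (\<Sum>l<p + q + 1. (if Suc m \<le> p then of_bool (Suc m = l) * h l else 0)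
      + (\<Sum>j=1..min m q. of_bool (p + j = l) * h l * c_coeff p q u (Suc m - j)
                              + u (p + j) * (grad_c p q u (Suc m - j) l * h l)))"
    unfolding dir_c_def c_coeff_DERIV_rec(3)[OF S] distrib_right sum_distrib_right
    by (intro sum.cong refl arg_cong2[where f="(+)"]) (auto simp: algebra_simps)
  also have "\<dots> = (\<Sum>l<p + q + 1. if Suc m \<le> p then of_bool (Suc m = l) * h l else 0)
      + (\<Sum>j=1..min m q. (\<Sum>l<p + q + 1. of_bool (p + j = l) * h l) * c_coeff p q u (Suc m - j)
                              + u (p + j) * (\<Sum>l<p + q + 1. grad_c p q u (Suc m - j) l * h l))"
    unfolding sum.distrib sum_distrib_left sum_distrib_right
    by (simp only: sum.swap[of _ "{1..min m q}"])
  also have "(\<Sum>l<p + q + 1. if Suc m \<le> p then of_bool (Suc m = l) * h l else 0)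
      = (if Suc m \<le> p then h (Suc m) else 0)"
    using sum_of_bool_eq[of "Suc m" "p + q + 1" h] by auto
  also have "(\<Sum>j=1..min m q. (\<Sum>l<p + q + 1. of_bool (p + j = l) * h l) * c_coeff p q u (Suc m - j)
                              + u (p + j) * (\<Sum>l<p + q + 1. grad_c p q u (Suc m - j) l * h l))
     = (\<Sum>j=1..min m q. h (p + j) * c_coeff p q u (Suc m - j) + u (p + j) * dir_c p q u h (Suc m - j))"
    unfolding dir_c_def by (intro sum.cong refl) (subst sum_of_bool_eq, auto)
  finally show "dir_c p q u h (Suc m) = (if Suc m \<le> p then h (Suc m) else 0)
           + (\<Sum>j=1..min m q. h (p + j) * c_coeff p q u (Suc m - j)
                              + u (p + j) * dir_c p q u h (Suc m - j))" .
qed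

lemma c_coeff_nonneg:
  fixes u :: "nat \<Rightarrow> real"
  assumes u: "\<And>l. l < p + q + 1 \<Longrightarrow> 0 \<le> u l" and S: "(\<Sum>j=1..q. u (p + j)) < 1"
  shows "0 \<le> c_coeff p q u i"
proof (induction i rule: less_induct)
  case (less i)
  show ?case
  proof (cases i)
    case 0
    then show ?thesis using u[of 0] S by simp
  next
    case (Suc m)
    show ?thesis unfolding Suc c_coeff.simps(2) using Suc
      by (intro add_nonneg_nonneg sum_nonneg mult_nonneg_nonneg less.IH) (auto intro!: u)
  qed
qed

lemma c_coeff_pos:
  fixes u :: "nat \<Rightarrow> real"
  assumes pq: "1 \<le> p" "1 \<le> q"
    and u: "\<And>l. l < p + q + 1 \<Longrightarrow> 0 < u l" and S: "(\<Sum>j=1..q. u (p + j)) < 1"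
  shows "0 < c_coeff p q u i"
proof (induction i rule: less_induct)
  case (less i)
  have nn: "0 \<le> c_coeff p q u k" for k
    by (rule c_coeff_nonneg[OF less_imp_le[OF u] S])
  consider "i = 0" | "i = Suc 0" | "2 \<le> i" by linarith
  then show ?case
  proof cases
    case 1
    then show ?thesis using u[of 0] S by simp
  next
    case 2
    then show ?thesis using u[of "Suc 0"] pq unfolding 2 c_coeff.simps(2) by simp
  next
    case 3
    then obtain m where "i = Suc m" "1 \<le> m" by (cases i) auto
    have "0 < u (p + 1) * c_coeff p q u (Suc m - 1)"
    proof (intro mult_pos_pos less.IH)
      show "0 < u (p + 1)" using pq by (intro u) simp
    qed (use \<open>i = Suc m\<close> in simp)
    moreover have "u (p + 1) * c_coeff p q u (Suc m - 1)
        \<le> (\<Sum>j=1..min m q. u (p + j) * c_coeff p q u (Suc m - j))"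
    proof (intro member_le_sum mult_nonneg_nonneg nn)
      show "0 \<le> u (p + j)" if "j \<in> {1..min m q} - {1}" for j
        using that by (intro less_imp_le u) simp
    qed (use \<open>1 \<le> m\<close> pq in simp_all)
    moreover have "0 \<le> (if Suc m \<le> p then u (Suc m) else 0)"
      using u[of "Suc m"] by auto
    ultimately show ?thesis unfolding \<open>i = Suc m\<close> c_coeff.simps(2) by linarith
  qed
qed

text \<open>The recursion multiplies by a sum of parameters that is below \<open>1\<close> and reaches back at most \<open>q\<close>
  steps, so the \<open>q\<close>-th root of this sum is an admissible rate.\<close>

lemma c_coeff_geometric:
  fixes u :: "nat \<Rightarrow> real"
  assumes q: "1 \<le> q"
    and u: "\<And>l. l < p + q + 1 \<Longrightarrow> 0 \<le> u l" and S: "(\<Sum>j=1..q. u (p + j)) < 1"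
  obtains K r where "0 < K" "0 < r" "r < 1" "\<And>i. c_coeff p q u i \<le> K * r ^ i"
proof -
  define s where "s = max (\<Sum>j=1..q. u (p + j)) (1/2)"
  define r where "r = root q s"
  have s: "0 < s" "s < 1" using S by (auto simp: s_def)
  have r: "0 < r" "r < 1" using s q by (auto simp: r_def)
  have rq: "r ^ q = s" using s q by (simp add: r_def)
  define K where "K = Max ((\<lambda>i. c_coeff p q u i / r ^ i) ` {..p}) + 1"
  have K0: "c_coeff p q u i \<le> K * r ^ i" if "i \<le> p" for i
  proof -
    have "c_coeff p q u i / r ^ i \<le> Max ((\<lambda>i. c_coeff p q u i / r ^ i) ` {..p})"
      using that by (intro Max_ge) auto
    then have "c_coeff p q u i / r ^ i \<le> K" by (simp add: K_def)
    then show ?thesis using r by (simp add: pos_divide_le_eq)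
  qed
  have "0 < K"
  proof -
    have "0 \<le> c_coeff p q u 0 / r ^ 0" using u S by (simp add: c_coeff_nonneg)
    also have "\<dots> \<le> Max ((\<lambda>i. c_coeff p q u i / r ^ i) ` {..p})" by (intro Max_ge imageI) auto
    finally show ?thesis by (simp add: K_def)
  qed
  have "c_coeff p q u i \<le> K * r ^ i" for i
  proof (induction i rule: less_induct)
    case (less i)
    show ?case
    proof (cases "i \<le> p")
      case True
      then show ?thesis by (rule K0)
    next
      case False
      then obtain m where m: "i = Suc m" "\<not> Suc m \<le> p" by (cases i) auto
      have "c_coeff p q u (Suc m) = (\<Sum>j=1..min m q. u (p + j) * c_coeff p q u (Suc m - j))"
        using m by (simp add: c_coeff.simps(2))
      also have "\<dots> \<le> (\<Sum>j=1..min m q. u (p + j) * (K * r ^ Suc m / s))"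
      proof (intro sum_mono mult_left_mono)
        fix j assume j: "j \<in> {1..min m q}"
        then have "c_coeff p q u (Suc m - j) \<le> K * r ^ (Suc m - j)"
          using m by (intro less.IH) auto
        also have "\<dots> \<le> K * (r ^ Suc m / s)"
        proof (intro mult_left_mono)
          have "r ^ (Suc m - j) * r ^ q \<le> r ^ (Suc m - j) * r ^ j"
            using j r by (intro mult_left_mono power_decreasing) auto
          also have "\<dots> = r ^ Suc m" using j by (simp flip: power_add)
          finally show "r ^ (Suc m - j) \<le> r ^ Suc m / s"
            using s by (simp add: rq field_simps)
        qed (use \<open>0 < K\<close> in simp)
        finally show "c_coeff p q u (Suc m - j) \<le> K * r ^ Suc m / s" by simp
        show "0 \<le> u (p + j)" using j by (intro u) auto
      qed
      also have "\<dots> = (\<Sum>j=1..min m q. u (p + j)) * (K * r ^ Suc m / s)"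
        by (rule sum_distrib_right[symmetric])
      also have "\<dots> \<le> s * (K * r ^ Suc m / s)"
      proof (intro mult_right_mono)
        have "(\<Sum>j=1..min m q. u (p + j)) \<le> (\<Sum>j=1..q. u (p + j))"
          by (intro sum_mono2) (auto intro!: u)
        then show "(\<Sum>j=1..min m q. u (p + j)) \<le> s" by (simp add: s_def)
      qed (use \<open>0 < K\<close> s r in simp)
      also have "\<dots> = K * r ^ Suc m" using s by simp
      finally show ?thesis by (simp only: m)
    qed
  qed
  then show ?thesis using that \<open>0 < K\<close> r by blast
qed

context
  fixes p q :: nat and u v h :: "nat \<Rightarrow> real" and \<eta> :: real
  assumes u: "\<And>l. l < p + q + 1 \<Longrightarrow> 0 \<le> u l" and S: "(\<Sum>j=1..q. u (p + j)) < 1"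
    and eta: "0 \<le> \<eta>"
    and hb: "\<And>l. l < p + q + 1 \<Longrightarrow> \<bar>h l\<bar> \<le> \<eta> * u l"
    and v: "\<And>l. v l = u l + h l"
begin

text \<open>Every product in the recursion has one parameter as a factor and raises the index by at least
  one, so relative errors of size \<open>\<eta>\<close> accumulate to at most the power of the index.\<close>

lemma c_coeff_bounds:
  assumes "\<eta> \<le> 1"
  shows "(1 - \<eta>) ^ Suc m * c_coeff p q u (Suc m) \<le> c_coeff p q v (Suc m)
       \<and> c_coeff p q v (Suc m) \<le> (1 + \<eta>) ^ Suc m * c_coeff p q u (Suc m)"
proof (induction m rule: less_induct)
  case (less m)
  note nn = c_coeff_nonneg[of p q u, OF u S]
  have vb: "(1 - \<eta>) * u l \<le> v l" "v l \<le> (1 + \<eta>) * u l" if "l < p + q + 1" for l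
    using hb[OF that] v[of l] by (auto simp: algebra_simps abs_le_iff)
  have pw: "(1 - \<eta>) ^ Suc m \<le> 1 - \<eta>" "1 + \<eta> \<le> (1 + \<eta>) ^ Suc m"
    using assms eta power_decreasing[of 1 "Suc m" "1 - \<eta>"] power_increasing[of 1 "Suc m" "1 + \<eta>"] by auto
  have first: "(1 - \<eta>) ^ Suc m * (if Suc m \<le> p then u (Suc m) else 0) \<le> (if Suc m \<le> p then v (Suc m) else 0)
     \<and> (if Suc m \<le> p then v (Suc m) else 0) \<le> (1 + \<eta>) ^ Suc m * (if Suc m \<le> p then u (Suc m) else 0)"
  proof (cases "Suc m \<le> p")
    case True
    have "(1 - \<eta>) ^ Suc m * u (Suc m) \<le> (1 - \<eta>) * u (Suc m)"
      "(1 + \<eta>) * u (Suc m) \<le> (1 + \<eta>) ^ Suc m * u (Suc m)"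
      using pw u[of "Suc m"] True by (auto intro!: mult_right_mono simp del: power_Suc)
    with vb[of "Suc m"] True show ?thesis by (auto simp del: power_Suc)
  qed simp
  have IH: "(1 - \<eta>) ^ (Suc m - j) * c_coeff p q u (Suc m - j) \<le> c_coeff p q v (Suc m - j)
       \<and> c_coeff p q v (Suc m - j) \<le> (1 + \<eta>) ^ (Suc m - j) * c_coeff p q u (Suc m - j)"
    if "j \<in> {1..min m q}" for j
    using less.IH[of "m - j"] that by (auto simp: Suc_diff_le)
  have lo: "(1 - \<eta>) ^ Suc m * (u (p + j) * c_coeff p q u (Suc m - j)) \<le> v (p + j) * c_coeff p q v (Suc m - j)"
    if j: "j \<in> {1..min m q}" for j
  proof -
    have "(1 - \<eta>) ^ Suc m \<le> (1 - \<eta>) ^ Suc (Suc m - j)"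
      using j assms eta by (intro power_decreasing) auto
    then have "(1 - \<eta>) ^ Suc m * (u (p + j) * c_coeff p q u (Suc m - j))
      \<le> (1 - \<eta>) ^ Suc (Suc m - j) * (u (p + j) * c_coeff p q u (Suc m - j))"
      using j nn u[of "p + j"] by (intro mult_right_mono) auto
    also have "\<dots> = ((1 - \<eta>) * u (p + j)) * ((1 - \<eta>) ^ (Suc m - j) * c_coeff p q u (Suc m - j))"
      by (simp add: algebra_simps)
    also have "\<dots> \<le> v (p + j) * c_coeff p q v (Suc m - j)"
    proof (intro mult_mono)
      show "(1 - \<eta>) * u (p + j) \<le> v (p + j)" using vb[of "p + j"] j by auto
      moreover have "0 \<le> (1 - \<eta>) * u (p + j)" using u[of "p + j"] j assms by auto
      ultimately show "0 \<le> v (p + j)" by linarith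
    qed (use IH[OF j] nn assms in auto)
    finally show ?thesis .
  qed
  have up: "v (p + j) * c_coeff p q v (Suc m - j) \<le> (1 + \<eta>) ^ Suc m * (u (p + j) * c_coeff p q u (Suc m - j))"
    if j: "j \<in> {1..min m q}" for j
  proof -
    have "0 \<le> (1 - \<eta>) ^ (Suc m - j) * c_coeff p q u (Suc m - j)"
      using nn assms by auto
    with IH[OF j] have nnv: "0 \<le> c_coeff p q v (Suc m - j)" by linarith
    have "v (p + j) * c_coeff p q v (Suc m - j)
        \<le> ((1 + \<eta>) * u (p + j)) * ((1 + \<eta>) ^ (Suc m - j) * c_coeff p q u (Suc m - j))"
      using j IH[OF j] vb[of "p + j"] u[of "p + j"] nnv eta by (intro mult_mono) auto
    also have "\<dots> = (1 + \<eta>) ^ Suc (Suc m - j) * (u (p + j) * c_coeff p q u (Suc m - j))"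
      by (simp add: algebra_simps)
    also have "\<dots> \<le> (1 + \<eta>) ^ Suc m * (u (p + j) * c_coeff p q u (Suc m - j))"
      using j nn u[of "p + j"] eta by (intro mult_right_mono power_increasing) auto
    finally show ?thesis .
  qed
  show ?case
    unfolding c_coeff.simps(2) distrib_left sum_distrib_left
    by (intro conjI add_mono sum_mono lo up conjunct1[OF first] conjunct2[OF first])
qed

lemma dir_c_bound: "\<bar>dir_c p q u h (Suc m)\<bar> \<le> real (Suc m) * \<eta> * c_coeff p q u (Suc m)"
proof (induction m rule: less_induct)
  case (less m)
  note nn = c_coeff_nonneg[of p q u, OF u S]
  have "\<bar>dir_c p q u h (Suc m)\<bar> \<le> \<bar>if Suc m \<le> p then h (Suc m) else 0\<bar>
       + (\<Sum>j=1..min m q. \<bar>h (p + j) * c_coeff p q u (Suc m - j) + u (p + j) * dir_c p q u h (Suc m - j)\<bar>)"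
    unfolding dir_c_Suc[OF less_imp_neq[OF S]]
    by (rule order_trans[OF abs_triangle_ineq add_left_mono[OF sum_abs]])
  also have "\<dots> \<le> real (Suc m) * \<eta> * (if Suc m \<le> p then u (Suc m) else 0)
       + (\<Sum>j=1..min m q. real (Suc m) * \<eta> * (u (p + j) * c_coeff p q u (Suc m - j)))"
  proof (intro add_mono sum_mono)
    show "\<bar>if Suc m \<le> p then h (Suc m) else 0\<bar> \<le> real (Suc m) * \<eta> * (if Suc m \<le> p then u (Suc m) else 0)"
    proof (cases "Suc m \<le> p")
      case True
      then have "\<bar>h (Suc m)\<bar> \<le> 1 * (\<eta> * u (Suc m))" using hb[of "Suc m"] by auto
      also have "\<dots> \<le> real (Suc m) * (\<eta> * u (Suc m))"
        using eta u[of "Suc m"] True by (intro mult_right_mono) auto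
      finally show ?thesis using True by simp
    qed simp
    fix j assume j: "j \<in> {1..min m q}"
    have "\<bar>h (p + j) * c_coeff p q u (Suc m - j) + u (p + j) * dir_c p q u h (Suc m - j)\<bar>
        \<le> \<bar>h (p + j)\<bar> * c_coeff p q u (Suc m - j) + u (p + j) * \<bar>dir_c p q u h (Suc m - j)\<bar>"
      using nn u[of "p + j"] j by (intro order_trans[OF abs_triangle_ineq]) (auto simp: abs_mult)
    also have "\<dots> \<le> (\<eta> * u (p + j)) * c_coeff p q u (Suc m - j)
        + u (p + j) * (real (Suc m - j) * \<eta> * c_coeff p q u (Suc m - j))"
      using nn u[of "p + j"] j hb[of "p + j"] less.IH[of "m - j"]
      by (intro add_mono mult_left_mono mult_right_mono) (auto simp: Suc_diff_le)
    also have "\<dots> = (1 + real (Suc m - j)) * (\<eta> * (u (p + j) * c_coeff p q u (Suc m - j)))"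
      by (simp add: algebra_simps)
    also have "\<dots> \<le> real (Suc m) * (\<eta> * (u (p + j) * c_coeff p q u (Suc m - j)))"
      using j nn u[of "p + j"] eta by (intro mult_right_mono) auto
    finally show "\<bar>h (p + j) * c_coeff p q u (Suc m - j) + u (p + j) * dir_c p q u h (Suc m - j)\<bar>
        \<le> real (Suc m) * \<eta> * (u (p + j) * c_coeff p q u (Suc m - j))" by (simp add: mult.assoc)
  qed
  also have "\<dots> = real (Suc m) * \<eta> * c_coeff p q u (Suc m)"
    unfolding c_coeff.simps(2) distrib_left sum_distrib_left ..
  finally show ?case .
qed

lemma one_plus_power_excess_mono:
  "(1 + \<eta>) ^ n - 1 - real n * \<eta> \<le> (1 + \<eta>) ^ Suc n - 1 - real (Suc n) * \<eta>"
proof -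
  have "\<eta> * 1 \<le> \<eta> * (1 + \<eta>) ^ n" using eta by (intro mult_left_mono one_le_power) auto
  then show ?thesis by (simp add: algebra_simps)
qed

text \<open>The bound \<open>(1 + \<eta>)\<^sup>i - 1 - i\<eta>\<close> is the second order remainder of the monomial of degree
  \<open>i\<close>, and it reproduces itself under the recursion.\<close>

lemma c_coeff_remainder:
  assumes "\<eta> \<le> 1"
  shows "\<bar>c_coeff p q v (Suc m) - c_coeff p q u (Suc m) - dir_c p q u h (Suc m)\<bar>
     \<le> ((1 + \<eta>) ^ Suc m - 1 - real (Suc m) * \<eta>) * c_coeff p q u (Suc m)"
proof (induction m rule: less_induct)
  case (less m)
  note nn = c_coeff_nonneg[of p q u, OF u S]
  define E where "E n = (1 + \<eta>) ^ n - 1 - real n * \<eta>" for n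
  define R where "R n = c_coeff p q v n - c_coeff p q u n - dir_c p q u h n" for n
  have Emono: "E n \<le> E n'" if "n \<le> n'" for n n'
    by (rule lift_Suc_mono_le[OF _ that]) (simp only: E_def one_plus_power_excess_mono)
  have Epos: "0 \<le> E n" for n using Emono[of 0 n] by (simp add: E_def)
  have lowpow: "1 - (1 - \<eta>) ^ n \<le> (1 + \<eta>) ^ n - 1" for n
  proof -
    have "1 + real n * \<eta> \<le> (1 + \<eta>) ^ n" using eta by (intro Bernoulli_inequality) simp
    moreover have "1 + real n * (- \<eta>) \<le> (1 + - \<eta>) ^ n" using assms by (intro Bernoulli_inequality) simp
    ultimately show ?thesis by simp
  qed
  have Req: "R (Suc m) = (\<Sum>j=1..min m q. h (p + j) * (c_coeff p q v (Suc m - j) - c_coeff p q u (Suc m - j))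
      + u (p + j) * R (Suc m - j))"
  proof -
    have "(\<Sum>j=1..min m q. v (p + j) * c_coeff p q v (Suc m - j)) - (\<Sum>j=1..min m q. u (p + j) * c_coeff p q u (Suc m - j))
        - (\<Sum>j=1..min m q. h (p + j) * c_coeff p q u (Suc m - j) + u (p + j) * dir_c p q u h (Suc m - j))
      = (\<Sum>j=1..min m q. h (p + j) * (c_coeff p q v (Suc m - j) - c_coeff p q u (Suc m - j))
      + u (p + j) * R (Suc m - j))"
      unfolding sum_subtractf[symmetric] R_def v by (intro sum.cong refl) (simp only: algebra_simps)
    then show ?thesis
      unfolding R_def[of "Suc m"] dir_c_Suc[OF less_imp_neq[OF S]] c_coeff.simps(2) v[of "Suc m"] by simp
  qed
  have "\<bar>R (Suc m)\<bar> \<le> (\<Sum>j=1..min m q. E (Suc m) * (u (p + j) * c_coeff p q u (Suc m - j)))"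
    unfolding Req
  proof (intro order_trans[OF sum_abs] sum_mono)
    fix j assume j: "j \<in> {1..min m q}"
    let ?n = "Suc m - j"
    have n: "?n = Suc (m - j)" using j by auto
    have c: "\<bar>c_coeff p q v ?n - c_coeff p q u ?n\<bar> \<le> ((1 + \<eta>) ^ ?n - 1) * c_coeff p q u ?n"
    proof -
      have "(1 - (1 - \<eta>) ^ ?n) * c_coeff p q u ?n \<le> ((1 + \<eta>) ^ ?n - 1) * c_coeff p q u ?n"
        by (intro mult_right_mono lowpow nn) auto
      moreover have "(1 - \<eta>) ^ ?n * c_coeff p q u ?n \<le> c_coeff p q v ?n"
        "c_coeff p q v ?n \<le> (1 + \<eta>) ^ ?n * c_coeff p q u ?n"
        unfolding n using c_coeff_bounds[OF assms, of "m - j"] by auto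
      ultimately show ?thesis unfolding abs_le_iff left_diff_distrib by linarith
    qed
    have r: "\<bar>R ?n\<bar> \<le> E ?n * c_coeff p q u ?n"
      unfolding R_def E_def n by (rule less.IH) (use j in simp)
    have "\<bar>h (p + j) * (c_coeff p q v ?n - c_coeff p q u ?n) + u (p + j) * R ?n\<bar>
        \<le> (\<eta> * u (p + j)) * (((1 + \<eta>) ^ ?n - 1) * c_coeff p q u ?n) + u (p + j) * (E ?n * c_coeff p q u ?n)"
    proof (rule order_trans[OF abs_triangle_ineq add_mono])
      have "p + j < p + q + 1" using j by simp
      note hj = hb[OF this] and uj = u[OF this]
      show "\<bar>h (p + j) * (c_coeff p q v ?n - c_coeff p q u ?n)\<bar> \<le> (\<eta> * u (p + j)) * (((1 + \<eta>) ^ ?n - 1) * c_coeff p q u ?n)"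
        unfolding abs_mult using eta uj by (intro mult_mono hj c) simp_all
      show "\<bar>u (p + j) * R ?n\<bar> \<le> u (p + j) * (E ?n * c_coeff p q u ?n)"
        unfolding abs_mult abs_of_nonneg[OF uj] by (intro mult_left_mono r uj)
    qed
    also have "\<dots> = E (Suc ?n) * (u (p + j) * c_coeff p q u ?n)"
      by (simp add: E_def algebra_simps)
    also have "\<dots> \<le> E (Suc m) * (u (p + j) * c_coeff p q u ?n)"
    proof (intro mult_right_mono Emono mult_nonneg_nonneg nn u)
      from j have "1 \<le> j" "j \<le> m" by auto
      then show "Suc ?n \<le> Suc m" by arith
    qed (use j in simp_all)
    finally show "\<bar>h (p + j) * (c_coeff p q v ?n - c_coeff p q u ?n) + u (p + j) * R ?n\<bar>
      \<le> E (Suc m) * (u (p + j) * c_coeff p q u ?n)" .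
  qed
  also have "\<dots> \<le> E (Suc m) * c_coeff p q u (Suc m)"
    unfolding c_coeff.simps(2) sum_distrib_left[symmetric]
  proof (intro mult_left_mono Epos)
    show "(\<Sum>j=1..min m q. u (p + j) * c_coeff p q u (Suc m - j))
        \<le> (if Suc m \<le> p then u (Suc m) else 0) + (\<Sum>j=1..min m q. u (p + j) * c_coeff p q u (Suc m - j))"
      using u[of "Suc m"] by simp
  qed
  finally show ?case unfolding R_def E_def .
qed

end

lemma exp_remainder: "\<bar>exp x - 1 - x\<bar> \<le> x\<^sup>2 * exp \<bar>x\<bar>" for x :: real
proof -
  obtain t where t: "\<bar>t\<bar> \<le> \<bar>x\<bar>" and e: "exp x = (\<Sum>m<2. x ^ m / fact m) + exp t / fact 2 * x ^ 2"
    using Maclaurin_exp_le[of x 2] by blast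
  have "\<bar>exp x - 1 - x\<bar> = exp t / 2 * x\<^sup>2" using e by (simp add: numeral_2_eq_2)
  also have "\<dots> \<le> exp \<bar>x\<bar> * x\<^sup>2"
  proof (intro mult_right_mono)
    have "exp t \<le> exp \<bar>x\<bar>" using t by simp
    then show "exp t / 2 \<le> exp \<bar>x\<bar>" using exp_ge_zero[of "\<bar>x\<bar>"] by linarith
  qed simp
  finally show ?thesis by (simp add: mult.commute)
qed

lemma exp_minus_double_le:
  fixes x :: real
  assumes "0 \<le> x" "x \<le> 1 / 2"
  shows "exp (- 2 * x) \<le> 1 - x"
proof -
  have "2 * x\<^sup>2 \<le> x" using mult_right_mono[OF assms(2,1)] by (simp add: power2_eq_square)
  with ln_one_minus_pos_lower_bound[OF assms] have "- 2 * x \<le> ln (1 - x)" by linarith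
  then have "exp (- 2 * x) \<le> exp (ln (1 - x))" by (simp only: exp_le_cancel_iff)
  then show ?thesis using assms by simp
qed

text \<open>The bounds in exponential form, which also covers the constant coefficient \<open>c\<^sub>0\<close>: the relative
  change of the \<open>i\<close>-th coefficient is controlled by \<open>z = L\<eta>(i + 1)\<close>, with the same \<open>L\<close> for all
  \<open>i\<close>. It may grow geometrically in \<open>i\<close>, but at a rate that is close to \<open>1\<close> when \<open>\<eta>\<close> is small.\<close>

lemma c_coeff_perturbation:
  fixes u v h :: "nat \<Rightarrow> real"
  assumes u: "\<And>l. l < p + q + 1 \<Longrightarrow> 0 \<le> u l"
    and b: "b = 1 - (\<Sum>j=1..q. u (p + j))" "0 < b"
    and eta: "0 \<le> \<eta>" "\<eta> \<le> b / 2"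
    and hb: "\<And>l. l < p + q + 1 \<Longrightarrow> \<bar>h l\<bar> \<le> \<eta> * u l"
    and v: "\<And>l. v l = u l + h l"
    and z: "z = 4 / b * \<eta> * (real i + 1)"
  shows "exp (- z) * c_coeff p q u i \<le> c_coeff p q v i"
    and "c_coeff p q v i \<le> exp z * c_coeff p q u i"
    and "\<bar>dir_c p q u h i\<bar> \<le> z * c_coeff p q u i"
    and "\<bar>c_coeff p q v i - c_coeff p q u i - dir_c p q u h i\<bar> \<le> z\<^sup>2 * exp z * c_coeff p q u i"
proof -
  have S: "(\<Sum>j=1..q. u (p + j)) < 1" using b by simp
  have b1: "b \<le> 1" using u unfolding b by (auto intro!: sum_nonneg)
  have eta1: "\<eta> \<le> 1 / 2" using eta b1 by simp
  have expm: "exp (- 2 * \<eta>) \<le> 1 - \<eta>"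
    by (rule exp_minus_double_le[OF eta(1) eta1])
  note nn = c_coeff_nonneg[of p q u, OF u S]
  have "exp (- z) * c_coeff p q u i \<le> c_coeff p q v i \<and> c_coeff p q v i \<le> exp z * c_coeff p q u i
     \<and> \<bar>dir_c p q u h i\<bar> \<le> z * c_coeff p q u i
     \<and> \<bar>c_coeff p q v i - c_coeff p q u i - dir_c p q u h i\<bar> \<le> z\<^sup>2 * exp z * c_coeff p q u i"
  proof (cases i)
    case (Suc m)
    have z2: "2 * \<eta> * real i \<le> z" "\<eta> * real i \<le> z"
    proof -
      have "0 \<le> \<eta> * real i" using eta by simp
      then have "2 * \<eta> * real i \<le> 4 * (\<eta> * (real i + 1))" using eta unfolding distrib_left by simp
      also have "\<dots> \<le> 4 / b * (\<eta> * (real i + 1))"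
        using eta b b1 by (intro mult_right_mono) (simp_all add: pos_le_divide_eq)
      finally have "2 * \<eta> * real i \<le> 4 / b * (\<eta> * (real i + 1))" .
      then show "2 * \<eta> * real i \<le> z" by (simp add: z mult.assoc)
      moreover have "0 \<le> \<eta> * real i" using eta by simp
      ultimately show "\<eta> * real i \<le> z" by linarith
    qed
    have "(1 + \<eta>) ^ i \<le> exp \<eta> ^ i" using eta by (intro power_mono) (auto simp: exp_ge_add_one_self)
    also have e: "\<dots> = exp (\<eta> * real i)" by (rule exp_of_nat2_mult[symmetric])
    finally have up: "(1 + \<eta>) ^ i \<le> exp (\<eta> * real i)" .
    have "exp (- (2 * \<eta> * real i)) = exp (- 2 * \<eta>) ^ i" by (simp flip: exp_of_nat_mult add: mult_ac)
    also have "\<dots> \<le> (1 - \<eta>) ^ i" using expm by (intro power_mono) auto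
    finally have lo: "exp (- z) \<le> (1 - \<eta>) ^ i"
      using z2 by (meson exp_le_cancel_iff neg_le_iff_le order_trans)
    have "(1 + \<eta>) ^ i - 1 - real i * \<eta> \<le> exp (\<eta> * real i) - 1 - \<eta> * real i"
      using up by (simp add: mult.commute)
    also have "\<dots> \<le> (\<eta> * real i)\<^sup>2 * exp \<bar>\<eta> * real i\<bar>" using exp_remainder[of "\<eta> * real i"] by linarith
    also have "\<dots> \<le> z\<^sup>2 * exp z" using z2 eta by (intro mult_mono power_mono) auto
    finally have rem: "(1 + \<eta>) ^ i - 1 - real i * \<eta> \<le> z\<^sup>2 * exp z" .
    show ?thesis
    proof (intro conjI)
      show "exp (- z) * c_coeff p q u i \<le> c_coeff p q v i"
      proof -
        have "exp (- z) * c_coeff p q u i \<le> (1 - \<eta>) ^ i * c_coeff p q u i" by (intro mult_right_mono lo nn)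
        moreover have "(1 - \<eta>) ^ i * c_coeff p q u i \<le> c_coeff p q v i"
          unfolding Suc using c_coeff_bounds[OF u S eta(1) hb v, of m] eta1 by auto
        ultimately show ?thesis by linarith
      qed
      show "c_coeff p q v i \<le> exp z * c_coeff p q u i"
      proof -
        have "(1 + \<eta>) ^ i \<le> exp z" using up z2 by (meson exp_le_cancel_iff order_trans)
        then have "(1 + \<eta>) ^ i * c_coeff p q u i \<le> exp z * c_coeff p q u i" by (intro mult_right_mono nn)
        moreover have "c_coeff p q v i \<le> (1 + \<eta>) ^ i * c_coeff p q u i"
          unfolding Suc using c_coeff_bounds[OF u S eta(1) hb v, of m] eta1 by auto
        ultimately show ?thesis by linarith
      qed
      show "\<bar>dir_c p q u h i\<bar> \<le> z * c_coeff p q u i"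
        using dir_c_bound[OF u S eta(1) hb v, of m] mult_right_mono[OF z2(2), of "c_coeff p q u i"] nn Suc
        by (simp add: mult_ac)
      show "\<bar>c_coeff p q v i - c_coeff p q u i - dir_c p q u h i\<bar> \<le> z\<^sup>2 * exp z * c_coeff p q u i"
      proof (rule order_trans[OF _ mult_right_mono[OF rem nn]])
        show "\<bar>c_coeff p q v i - c_coeff p q u i - dir_c p q u h i\<bar>
            \<le> ((1 + \<eta>) ^ i - 1 - real i * \<eta>) * c_coeff p q u i"
          unfolding Suc using eta1 by (intro c_coeff_remainder[OF u S eta(1) hb v]) auto
      qed
    qed
  next
    case 0
    define s where "s = (\<Sum>j=1..q. h (p + j)) / b"
    have sb: "\<bar>s\<bar> \<le> \<eta> / b"
    proof -
      have "\<bar>\<Sum>j=1..q. h (p + j)\<bar> \<le> (\<Sum>j=1..q. \<eta> * u (p + j))"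
        by (intro order_trans[OF sum_abs] sum_mono hb) auto
      also have "\<dots> = \<eta> * (1 - b)" by (simp add: b sum_distrib_left)
      also have "\<dots> \<le> \<eta>" using eta b b1 by (simp add: mult_left_le)
      finally show ?thesis using b by (simp add: s_def divide_right_mono)
    qed
    have s2: "\<bar>s\<bar> \<le> 1 / 2" 
    proof -
      have "\<eta> / b \<le> 1 / 2" using eta b by (simp add: pos_divide_le_eq)
      with sb show "\<bar>s\<bar> \<le> 1 / 2" by linarith
    qed
    have etab: "\<eta> \<le> \<eta> / b" using eta b b1 by (simp add: pos_le_divide_eq mult_left_le)
    have z0: "z = 4 * (\<eta> / b)" using 0 by (simp add: z)
    have zn: "0 \<le> z" using eta b by (simp add: z)
    have cu: "c_coeff p q u 0 = u 0 / b" by (simp add: b)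
    have den: "1 - (\<Sum>j=1..q. v (p + j)) = b * (1 - s)"
      using b by (simp add: v sum.distrib s_def algebra_simps)
    have cv: "c_coeff p q v 0 = (u 0 + h 0) / (b * (1 - s))" by (simp only: c_coeff.simps den) (simp add: v)
    have dc: "dir_c p q u h 0 = h 0 / b + u 0 / b * s"
      unfolding dir_c_0[OF less_imp_neq[OF S]] b(1)[symmetric] by (simp add: s_def power2_eq_square)
    have h0: "\<bar>h 0\<bar> \<le> \<eta> * u 0" and u0: "0 \<le> u 0" using hb[of 0] u[of 0] by auto
    have lo: "exp (- z) \<le> (1 - \<eta>) / (1 - s)"
    proof -
      have "1 - s \<le> exp (\<bar>s\<bar>)" using exp_ge_add_one_self[of "\<bar>s\<bar>"] by linarith
      also have "\<dots> \<le> exp (2 * (\<eta> / b))" using sb eta b by auto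
      finally have "exp (- z) * (1 - s) \<le> exp (- z) * exp (2 * (\<eta> / b))" by (intro mult_left_mono) auto
      also have "\<dots> = exp (- 2 * (\<eta> / b))" by (simp flip: exp_add add: z0)
      also have "\<dots> \<le> exp (- 2 * \<eta>)" using etab by simp
      also have "\<dots> \<le> 1 - \<eta>" by (rule expm)
      finally show ?thesis using s2 by (simp add: pos_le_divide_eq)
    qed
    have up: "(1 + \<eta>) / (1 - s) \<le> exp z"
    proof -
      have "exp (- 2 * \<bar>s\<bar>) \<le> 1 - \<bar>s\<bar>"
        using s2 by (intro exp_minus_double_le) auto
      moreover have "exp (- 2 * (\<eta> / b)) \<le> exp (- 2 * \<bar>s\<bar>)" using sb by simp
      ultimately have "exp (- 2 * (\<eta> / b)) \<le> 1 - s" by linarith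
      then have "exp z * exp (- 2 * (\<eta> / b)) \<le> exp z * (1 - s)" by (intro mult_left_mono) auto
      moreover have "exp z * exp (- 2 * (\<eta> / b)) = exp (2 * (\<eta> / b))" by (simp flip: exp_add add: z0)
      moreover have "1 + \<eta> \<le> exp (2 * (\<eta> / b))"
        using exp_ge_add_one_self[of "2 * (\<eta> / b)"] etab eta by linarith
      ultimately have "1 + \<eta> \<le> exp z * (1 - s)" by linarith
      then show ?thesis using s2 by (simp add: pos_divide_le_eq)
    qed
    have sp: "0 < 1 - s" using s2 by auto
    show ?thesis unfolding 0 cu
    proof (intro conjI)
      have "exp (- z) * (u 0 / b) \<le> (1 - \<eta>) / (1 - s) * (u 0 / b)"
        using u0 b by (intro mult_right_mono lo) auto
      also have "\<dots> \<le> c_coeff p q v 0" 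
      proof -
        have "(1 - \<eta>) * u 0 \<le> u 0 + h 0" using h0 by (simp add: algebra_simps abs_le_iff)
        then have "(1 - \<eta>) * u 0 / (b * (1 - s)) \<le> (u 0 + h 0) / (b * (1 - s))"
          using sp b by (intro divide_right_mono) simp_all
        then show ?thesis unfolding cv by (simp add: mult.commute)
      qed
      finally show "exp (- z) * (u 0 / b) \<le> c_coeff p q v 0" .
      have "c_coeff p q v 0 \<le> (1 + \<eta>) / (1 - s) * (u 0 / b)" 
      proof -
        have "u 0 + h 0 \<le> (1 + \<eta>) * u 0" using h0 by (simp add: algebra_simps abs_le_iff)
        then have "(u 0 + h 0) / (b * (1 - s)) \<le> (1 + \<eta>) * u 0 / (b * (1 - s))"
          using sp b by (intro divide_right_mono) simp_all
        then show ?thesis unfolding cv by (simp add: mult.commute)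
      qed
      also have "\<dots> \<le> exp z * (u 0 / b)" using u0 b by (intro mult_right_mono up) auto
      finally show "c_coeff p q v 0 \<le> exp z * (u 0 / b)" .
      have hb': "\<bar>h 0 / b\<bar> \<le> \<eta> / b * (u 0 / b)"
      proof -
        have "\<bar>h 0 / b\<bar> \<le> \<eta> * u 0 / b" using h0 b by (simp add: divide_right_mono)
        also have "\<dots> = \<eta> * (u 0 / b)" by simp
        also have "\<dots> \<le> \<eta> / b * (u 0 / b)" using etab u0 b by (intro mult_right_mono) auto
        finally show ?thesis .
      qed
      have us: "\<bar>u 0 / b * s\<bar> \<le> \<eta> / b * (u 0 / b)"
        using mult_right_mono[OF sb, of "u 0 / b"] u0 b by (simp add: abs_mult mult.commute)
      have "0 \<le> \<eta> / b * (u 0 / b)" using u0 eta b by simp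
      then show "\<bar>dir_c p q u h 0\<bar> \<le> z * (u 0 / b)"
        unfolding dc using hb' us by (simp only: z0)
      have "c_coeff p q v 0 - u 0 / b - dir_c p q u h 0 = (h 0 / b + u 0 / b * s) * s / (1 - s)"
        unfolding cv dc using sp b by (simp add: field_simps)
      then have "\<bar>c_coeff p q v 0 - u 0 / b - dir_c p q u h 0\<bar> = \<bar>h 0 / b + u 0 / b * s\<bar> * \<bar>s\<bar> * (1 / (1 - s))"
        using sp by (simp add: abs_mult)
      also have "\<dots> \<le> (2 * (\<eta> / b * (u 0 / b))) * (\<eta> / b) * 2"
      proof (intro mult_mono)
        show "\<bar>h 0 / b + u 0 / b * s\<bar> \<le> 2 * (\<eta> / b * (u 0 / b))" using hb' us by linarith
        show "1 / (1 - s) \<le> 2" using s2 sp by (simp add: pos_divide_le_eq)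
      qed (use sb u0 eta b sp in simp_all)
      also have "\<dots> = z\<^sup>2 / 4 * (u 0 / b)" by (simp add: z0 power2_eq_square)
      also have "\<dots> \<le> z\<^sup>2 * exp z * (u 0 / b)"
      proof (intro mult_right_mono)
        have "z\<^sup>2 * (1 / 4) \<le> z\<^sup>2 * exp z" 
          using exp_ge_add_one_self[of z] zn by (intro mult_left_mono) (linarith, simp)
        then show "z\<^sup>2 / 4 \<le> z\<^sup>2 * exp z" by simp
      qed (use u0 b in auto)
      finally show "\<bar>c_coeff p q v 0 - u 0 / b - dir_c p q u h 0\<bar> \<le> z\<^sup>2 * exp z * (u 0 / b)" .
    qed
  qed
  then show "exp (- z) * c_coeff p q u i \<le> c_coeff p q v i"
    and "c_coeff p q v i \<le> exp z * c_coeff p q u i"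
    and "\<bar>dir_c p q u h i\<bar> \<le> z * c_coeff p q u i"
    and "\<bar>c_coeff p q v i - c_coeff p q u i - dir_c p q u h i\<bar> \<le> z\<^sup>2 * exp z * c_coeff p q u i"
    by blast+
qed

lemma grad_c_bound:
  fixes u :: "nat \<Rightarrow> real"
  assumes u: "\<And>l. l < p + q + 1 \<Longrightarrow> 0 < u l"
    and b: "b = 1 - (\<Sum>j=1..q. u (p + j))" "0 < b" and l: "l < p + q + 1"
  shows "\<bar>grad_c p q u i l\<bar> \<le> 4 / (b * u l) * (real i + 1) * c_coeff p q u i"
proof -
  define h where "h = (\<lambda>l'. of_bool (l = l') * (b / 2 * u l))"
  have hb: "\<bar>h l'\<bar> \<le> b / 2 * u l'" if "l' < p + q + 1" for l'
    using u[OF that] b(2) by (cases "l = l'") (simp_all add: h_def)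
  have b0: "0 \<le> b / 2" "b / 2 \<le> b / 2" using b(2) by simp_all
  have "\<bar>dir_c p q u h i\<bar> \<le> 4 / b * (b / 2) * (real i + 1) * c_coeff p q u i"
    by (rule c_coeff_perturbation(3)[OF less_imp_le[OF u] b b0 hb refl refl])
  moreover have "dir_c p q u h i = grad_c p q u i l * (b / 2 * u l)"
    using sum_of_bool_eq[OF l, of "\<lambda>l'. grad_c p q u i l' * (b / 2 * u l)"]
    by (simp add: dir_c_def h_def mult_ac)
  ultimately have "\<bar>grad_c p q u i l\<bar> * (b * u l) \<le> 4 * (real i + 1) * c_coeff p q u i"
    using u[OF l] b(2) by (simp add: abs_mult algebra_simps)
  then show ?thesis using u[OF l] b(2) by (simp add: field_simps)
qed

section \<open>Expansion of a power of the volatility ratio\<close>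

text \<open>A power with negative exponent lies above its tangents; the tangent at the mean of the
  \<open>y\<^sub>i\<close> gives Jensen's inequality, the tangent at \<open>1\<close> the sign of the second order term.\<close>

lemma powr_minus_ge_tangent:
  fixes y Y \<kappa> :: real
  assumes "0 < y" "0 < Y" "0 \<le> \<kappa>"
  shows "Y powr (- \<kappa>) - \<kappa> * Y powr (- \<kappa>) * (y / Y - 1) \<le> y powr (- \<kappa>)"
proof -
  define a where "a = ln (y / Y)"
  have a: "y / Y = exp a" using assms by (simp add: a_def)
  have "1 + (- \<kappa> * a) \<le> exp (- \<kappa> * a)" by (rule exp_ge_add_one_self)
  moreover have "a \<le> exp a - 1" using exp_ge_add_one_self[of a] by linarith
  then have "\<kappa> * a \<le> \<kappa> * (exp a - 1)" using assms by (intro mult_left_mono)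
  ultimately have "1 - \<kappa> * (exp a - 1) \<le> exp (- \<kappa> * a)" by simp
  then have "Y powr (- \<kappa>) * (1 - \<kappa> * (y / Y - 1)) \<le> Y powr (- \<kappa>) * exp (- \<kappa> * a)"
    unfolding a by (intro mult_left_mono) simp_all
  also have "\<dots> = Y powr (- \<kappa>) * (y / Y) powr (- \<kappa>)"
    using assms by (simp add: powr_def a_def)
  also have "\<dots> = y powr (- \<kappa>)"
    using assms by (simp flip: powr_mult)
  finally show ?thesis by (simp add: algebra_simps)
qed

lemma powr_minus_taylor:
  fixes y z \<kappa> :: real
  assumes "0 \<le> \<kappa>" "exp (- z) \<le> y" "y \<le> exp z"
  shows "y powr (- \<kappa>) - 1 + \<kappa> * (y - 1) \<le> (\<kappa>\<^sup>2 + \<kappa>) * (z\<^sup>2 * exp ((\<kappa> + 1) * z))"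
proof -
  have y: "0 < y" using assms(2) less_le_trans[OF exp_gt_zero] by blast
  define a where "a = ln y"
  have ya: "y = exp a" using y by (simp add: a_def)
  have az: "\<bar>a\<bar> \<le> z" using assms unfolding ya exp_le_cancel_iff by linarith
  then have z: "0 \<le> z" by linarith
  have a2: "a\<^sup>2 \<le> z\<^sup>2" using az by (metis abs_ge_zero power2_abs power_mono)
  have "exp (- \<kappa> * a) - 1 - (- \<kappa> * a) \<le> (- \<kappa> * a)\<^sup>2 * exp \<bar>- \<kappa> * a\<bar>"
    using exp_remainder[of "- \<kappa> * a"] by linarith
  also have "\<dots> = \<kappa>\<^sup>2 * (a\<^sup>2 * exp (\<kappa> * \<bar>a\<bar>))"
    using assms by (simp add: abs_mult power_mult_distrib)
  also have "\<dots> \<le> \<kappa>\<^sup>2 * (z\<^sup>2 * exp ((\<kappa> + 1) * z))"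
  proof (intro mult_left_mono mult_mono a2)
    have "\<kappa> * \<bar>a\<bar> \<le> \<kappa> * z" using az assms by (intro mult_left_mono)
    then show "exp (\<kappa> * \<bar>a\<bar>) \<le> exp ((\<kappa> + 1) * z)" using z unfolding distrib_right by simp
  qed simp_all
  finally have 1: "exp (- \<kappa> * a) - 1 - (- \<kappa> * a) \<le> \<kappa>\<^sup>2 * (z\<^sup>2 * exp ((\<kappa> + 1) * z))" .
  have "exp a - 1 - a \<le> a\<^sup>2 * exp \<bar>a\<bar>" using exp_remainder[of a] by linarith
  also have "\<dots> \<le> z\<^sup>2 * exp ((\<kappa> + 1) * z)"
  proof (intro mult_mono a2)
    have "0 \<le> \<kappa> * z" using z assms by simp
    then show "exp \<bar>a\<bar> \<le> exp ((\<kappa> + 1) * z)" using az unfolding distrib_right by simp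
  qed simp_all
  finally have "\<kappa> * (exp a - 1 - a) \<le> \<kappa> * (z\<^sup>2 * exp ((\<kappa> + 1) * z))"
    using assms by (intro mult_left_mono)
  with 1 show ?thesis using y by (simp add: powr_def ya algebra_simps)
qed

text \<open>The power of a weighted mean, expanded to first order. Convexity turns the second order
  term of the mean into the mean of the second order terms, so that no moment of the weighted
  mean itself enters.\<close>

lemma powr_weighted_mean_expansion:
  fixes w y g z :: "nat \<Rightarrow> real" and \<kappa> :: real
  assumes \<kappa>: "0 \<le> \<kappa>"
    and w: "\<And>i. 0 \<le> w i" "w sums 1"
    and y: "\<And>i. exp (- z i) \<le> y i" "\<And>i. y i \<le> exp (z i)"
    and g: "\<And>i. \<bar>y i - 1 - g i\<bar> \<le> (z i)\<^sup>2 * exp (z i)"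
    and s1: "summable (\<lambda>i. w i * exp ((\<kappa> + 1) * z i))"
    and s2: "summable (\<lambda>i. w i * ((z i)\<^sup>2 * exp ((\<kappa> + 1) * z i)))"
    and s3: "summable (\<lambda>i. w i * g i)"
  shows "summable (\<lambda>i. w i * y i)" "0 < (\<Sum>i. w i * y i)"
    and "(\<Sum>i. w i * y i) powr (- \<kappa>) \<le> (\<Sum>i. w i * exp ((\<kappa> + 1) * z i))"
    and "\<bar>(\<Sum>i. w i * y i) powr (- \<kappa>) - 1 + \<kappa> * (\<Sum>i. w i * g i)\<bar>
      \<le> (\<kappa>\<^sup>2 + 2 * \<kappa>) * (\<Sum>i. w i * ((z i)\<^sup>2 * exp ((\<kappa> + 1) * z i)))"
proof -
  have ypos: "0 < y i" for i using y(1)[of i] less_le_trans[OF exp_gt_zero] by blast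
  have "exp (- z i) \<le> exp (z i)" for i using y[of i] by (rule order_trans)
  then have z: "0 \<le> z i" for i by (simp add: less_eq_real_def)
  have kz: "0 \<le> \<kappa> * z i" for i using \<kappa> z by simp
  have ez: "exp (z i) \<le> exp ((\<kappa> + 1) * z i)" "exp (\<kappa> * z i) \<le> exp ((\<kappa> + 1) * z i)" for i
    using kz z[of i] unfolding exp_le_cancel_iff distrib_right by simp_all
  have sw: "summable w" and w1: "(\<Sum>i. w i) = 1" using w(2) by (auto simp: sums_iff)
  show sy: "summable (\<lambda>i. w i * y i)"
  proof (rule summable_comparison_test'[OF s1, of 0])
    fix i
    have "w i * y i \<le> w i * exp ((\<kappa> + 1) * z i)"
      by (intro mult_left_mono order_trans[OF y(2) ez(1)] w(1))
    then show "norm (w i * y i) \<le> w i * exp ((\<kappa> + 1) * z i)" using w(1)[of i] ypos[of i] by simp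
  qed
  obtain j where "0 < w j"
    using w by (metis less_eq_real_def sums_0 sums_unique2 zero_neq_one)
  then show Ypos: "0 < (\<Sum>i. w i * y i)"
    using w(1) ypos less_imp_le[OF ypos] by (intro suminf_pos2[OF sy, of j]) simp_all
  define Y where "Y = (\<Sum>i. w i * y i)"
  have py: "y i powr (- \<kappa>) \<le> exp (\<kappa> * z i)" for i
  proof -
    have "ln (exp (- z i)) \<le> ln (y i)" using ln_le_cancel_iff[OF exp_gt_zero ypos, of "- z i" i] y(1)[of i] by blast
    then have "- z i \<le> ln (y i)" by simp
    then have "\<kappa> * (- z i) \<le> \<kappa> * ln (y i)" using \<kappa> by (intro mult_left_mono)
    then show ?thesis using ypos[of i] by (simp add: powr_def)
  qed
  have sp: "summable (\<lambda>i. w i * y i powr (- \<kappa>))"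
  proof (rule summable_comparison_test'[OF s1, of 0])
    fix i
    have "w i * y i powr (- \<kappa>) \<le> w i * exp ((\<kappa> + 1) * z i)"
      by (intro mult_left_mono order_trans[OF py ez(2)] w(1))
    then show "norm (w i * y i powr (- \<kappa>)) \<le> w i * exp ((\<kappa> + 1) * z i)" using w(1)[of i] by simp
  qed
  have jensen: "Y powr (- \<kappa>) \<le> (\<Sum>i. w i * y i powr (- \<kappa>))"
  proof -
    let ?P = "Y powr (- \<kappa>)"
    have "(\<lambda>i. (?P + \<kappa> * ?P) * w i - (\<kappa> * ?P / Y) * (w i * y i)) sums ((?P + \<kappa> * ?P) * 1 - (\<kappa> * ?P / Y) * Y)"
      unfolding Y_def using sy w(2) by (intro sums_diff sums_mult summable_sums)
    then have s: "(\<lambda>i. w i * (?P - \<kappa> * ?P * (y i / Y - 1))) sums ?P"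
      using Ypos by (simp add: Y_def[symmetric] algebra_simps)
    have le: "w i * (?P - \<kappa> * ?P * (y i / Y - 1)) \<le> w i * y i powr (- \<kappa>)" for i
      using w(1) ypos Ypos \<kappa> by (intro mult_left_mono powr_minus_ge_tangent) (simp_all add: Y_def)
    have "suminf (\<lambda>i. w i * (?P - \<kappa> * ?P * (y i / Y - 1))) \<le> (\<Sum>i. w i * y i powr (- \<kappa>))"
      by (rule suminf_le[OF le sums_summable[OF s] sp])
    then show ?thesis using s by (simp only: sums_unique[OF s, symmetric])
  qed
  also have "\<dots> \<le> (\<Sum>i. w i * exp ((\<kappa> + 1) * z i))"
    using w(1) by (intro suminf_le sp s1 mult_left_mono order_trans[OF py ez(2)])
  finally show "(\<Sum>i. w i * y i) powr (- \<kappa>) \<le> (\<Sum>i. w i * exp ((\<kappa> + 1) * z i))"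
    unfolding Y_def .
  let ?Z = "\<Sum>i. w i * ((z i)\<^sup>2 * exp ((\<kappa> + 1) * z i))"
  have Phi: "Y powr (- \<kappa>) - 1 + \<kappa> * (Y - 1) \<le> (\<kappa>\<^sup>2 + \<kappa>) * ?Z"
  proof -
    have s: "(\<lambda>i. w i * y i powr (- \<kappa>) + (\<kappa> * (w i * y i) - (1 + \<kappa>) * w i))
        sums ((\<Sum>i. w i * y i powr (- \<kappa>)) + (\<kappa> * Y - (1 + \<kappa>) * 1))"
      unfolding Y_def using sy sp w(2) by (intro sums_add sums_diff sums_mult summable_sums)
    have sr: "(\<lambda>i. (\<kappa>\<^sup>2 + \<kappa>) * (w i * ((z i)\<^sup>2 * exp ((\<kappa> + 1) * z i)))) sums ((\<kappa>\<^sup>2 + \<kappa>) * ?Z)"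
      using s2 by (intro sums_mult summable_sums)
    have "w i * y i powr (- \<kappa>) + (\<kappa> * (w i * y i) - (1 + \<kappa>) * w i)
        \<le> (\<kappa>\<^sup>2 + \<kappa>) * (w i * ((z i)\<^sup>2 * exp ((\<kappa> + 1) * z i)))" for i
    proof -
      have "w i * (y i powr (- \<kappa>) - 1 + \<kappa> * (y i - 1)) \<le> w i * ((\<kappa>\<^sup>2 + \<kappa>) * ((z i)\<^sup>2 * exp ((\<kappa> + 1) * z i)))"
        using w(1) by (intro mult_left_mono powr_minus_taylor \<kappa> y)
      then show ?thesis by (simp add: algebra_simps)
    qed
    from sums_le[OF this s sr] jensen show ?thesis by (simp add: algebra_simps)
  qed
  have Phi0: "0 \<le> Y powr (- \<kappa>) - 1 + \<kappa> * (Y - 1)"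
    using powr_minus_ge_tangent[of Y 1 \<kappa>] Ypos \<kappa> by (simp add: Y_def)
  have lin: "\<bar>(Y - 1) - (\<Sum>i. w i * g i)\<bar> \<le> ?Z"
  proof -
    have s: "(\<lambda>i. w i * y i - w i - w i * g i) sums (Y - 1 - (\<Sum>i. w i * g i))"
      unfolding Y_def using sy s3 w(2) by (intro sums_diff summable_sums)
    have le: "\<bar>w i * y i - w i - w i * g i\<bar> \<le> w i * ((z i)\<^sup>2 * exp ((\<kappa> + 1) * z i))" for i
    proof -
      have "w i * y i - w i - w i * g i = w i * (y i - 1 - g i)" by (simp add: algebra_simps)
      then have "\<bar>w i * y i - w i - w i * g i\<bar> = w i * \<bar>y i - 1 - g i\<bar>" using w(1) by (simp add: abs_mult)
      also have "\<dots> \<le> w i * ((z i)\<^sup>2 * exp (z i))" by (intro mult_left_mono g w(1))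
      also have "\<dots> \<le> w i * ((z i)\<^sup>2 * exp ((\<kappa> + 1) * z i))"
        by (intro mult_left_mono ez w(1)) simp
      finally show ?thesis .
    qed
    have sa: "summable (\<lambda>i. \<bar>w i * y i - w i - w i * g i\<bar>)"
      by (rule summable_comparison_test'[OF s2, of 0]) (use le in simp)
    have "\<bar>Y - 1 - (\<Sum>i. w i * g i)\<bar> \<le> (\<Sum>i. \<bar>w i * y i - w i - w i * g i\<bar>)"
      using summable_rabs[OF sa] by (simp only: sums_unique[OF s, symmetric])
    also have "\<dots> \<le> ?Z" by (rule suminf_le[OF le sa s2])
    finally show ?thesis .
  qed
  then have "\<bar>\<kappa> * (Y - 1) - \<kappa> * (\<Sum>i. w i * g i)\<bar> \<le> \<kappa> * ?Z"
    using \<kappa> by (simp add: abs_mult mult_left_mono flip: right_diff_distrib)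
  with Phi Phi0 show "\<bar>(\<Sum>i. w i * y i) powr (- \<kappa>) - 1 + \<kappa> * (\<Sum>i. w i * g i)\<bar>
      \<le> (\<kappa>\<^sup>2 + 2 * \<kappa>) * ?Z"
    unfolding Y_def[symmetric] distrib_right by linarith
qed

lemma summable_of_summable_powr:
  fixes a :: "nat \<Rightarrow> real"
  assumes a: "\<And>i. 0 \<le> a i" and \<delta>: "0 < \<delta>" "\<delta> \<le> 1" and s: "summable (\<lambda>i. a i powr \<delta>)"
  shows "summable a"
proof -
  have "(\<lambda>i. a i powr \<delta>) \<longlonglongrightarrow> 0" by (rule summable_LIMSEQ_zero[OF s])
  then have "\<forall>\<^sub>F i in sequentially. a i powr \<delta> < 1" by (rule order_tendstoD) simp
  then obtain N where N: "\<And>i. i \<ge> N \<Longrightarrow> a i powr \<delta> < 1" by (auto simp: eventually_sequentially)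
  have "norm (a i) \<le> a i powr \<delta>" if "i \<ge> N" for i
  proof -
    have "a i < 1" using N[OF that] \<delta> ge_one_powr_ge_zero[of "a i" \<delta>] by fastforce
    then have "a i powr 1 \<le> a i powr \<delta>" using a[of i] \<delta> by (intro powr_mono') simp_all
    then show ?thesis using a[of i] by (simp add: powr_one_gt_zero_iff split: if_splits)
  qed
  then show ?thesis by (rule summable_comparison_test'[OF s])
qed

lemma succ_square_le_geometric:
  fixes s :: real
  assumes "0 < s" "s < 1"
  obtains P where "0 < P" "\<And>i. (real i + 1)\<^sup>2 * s ^ i \<le> P"
proof -
  define a where "a = 1 / sqrt s - 1"
  have a: "0 < a" using assms by (simp add: a_def)
  have le: "real i + 1 \<le> (1 + 1 / a) * (1 / sqrt s) ^ i" for i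
  proof -
    have "1 + real i * a \<le> (1 + a) ^ i" using a by (intro Bernoulli_inequality) simp
    then have "(1 + 1 / a) * (1 + real i * a) \<le> (1 + 1 / a) * (1 / sqrt s) ^ i"
      using a by (intro mult_left_mono) (simp_all add: a_def)
    moreover have "(1 + 1 / a) * (1 + real i * a) = (real i + 1) + (real i * a + 1 / a)"
      using a by (simp add: field_simps)
    moreover have "0 \<le> real i * a + 1 / a" using a by simp
    ultimately show ?thesis by linarith
  qed
  have "(real i + 1)\<^sup>2 * s ^ i \<le> (1 + 1 / a)\<^sup>2" for i
  proof -
    have "(real i + 1)\<^sup>2 \<le> ((1 + 1 / a) * (1 / sqrt s) ^ i)\<^sup>2" by (intro power_mono le) simp
    also have "\<dots> = (1 + 1 / a)\<^sup>2 * (1 / s) ^ i"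
    proof -
      have "((1 / sqrt s) ^ i)\<^sup>2 = ((1 / sqrt s)\<^sup>2) ^ i" by (simp flip: power_mult add: mult.commute)
      then show ?thesis using assms by (simp add: power_mult_distrib power_divide)
    qed
    finally have "(real i + 1)\<^sup>2 * s ^ i \<le> (1 + 1 / a)\<^sup>2 * (1 / s) ^ i * s ^ i"
      using assms by (intro mult_right_mono) simp_all
    also have "\<dots> = (1 + 1 / a)\<^sup>2" using assms by (simp add: power_divide)
    finally show ?thesis .
  qed
  moreover have "0 < (1 + 1 / a)\<^sup>2" using a by (intro zero_less_power add_pos_pos) simp_all
  ultimately show ?thesis using that by blast
qed

lemma le_powr_of_le_one:
  fixes w a \<delta> :: real
  assumes "0 \<le> w" "w \<le> 1" "w \<le> a" "0 < \<delta>" "\<delta> \<le> 1"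
  shows "w \<le> a powr \<delta>"
proof -
  have "w \<le> w powr \<delta>"
  proof (cases "w = 0")
    case False
    then have "w powr 1 \<le> w powr \<delta>" using assms by (intro powr_mono') simp_all
    then show ?thesis using assms False by simp
  qed simp
  also have "\<dots> \<le> a powr \<delta>" using assms by (intro powr_mono2) simp_all
  finally show ?thesis .
qed

lemma power_powr_swap: "0 < a \<Longrightarrow> (a ^ i) powr e = (a powr e) ^ i" for a e :: real
  by (simp add: powr_powr mult.commute flip: powr_realpow)

text \<open>The expansion for the volatility. In terms of the weights
  \<open>w\<^sub>i = c\<^sub>i x\<^sub>i / \<Sum>\<^sub>j c\<^sub>j x\<^sub>j\<close> a perturbed volatility is, relative to the original one, the weighted
  mean of the ratios of the coefficients. These ratios grow at most like a small power
  \<open>exp (z\<^sub>i)\<close>, and since \<open>w\<^sub>i \<le> 1\<close> also \<open>w\<^sub>i \<le> (c\<^sub>i x\<^sub>i / c\<^sub>0)\<^sup>\<delta>\<close>, which decays geometrically and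
  has a finite mean as soon as \<open>x\<^sub>i\<^sup>\<delta>\<close> has one. This is where a fractional moment, however small,
  suffices.\<close>

lemma volatility_expansion:
  fixes \<theta> :: "nat \<Rightarrow> real" and \<kappa> \<delta> :: real
  assumes pq: "1 \<le> p" "1 \<le> q"
    and \<theta>: "\<And>l. l < p + q + 1 \<Longrightarrow> 0 < \<theta> l" and S: "(\<Sum>j=1..q. \<theta> (p + j)) < 1"
    and \<kappa>: "0 \<le> \<kappa>" and \<delta>: "0 < \<delta>" "\<delta> \<le> 1"
  obtains \<eta>0 B C where "0 < \<eta>0" "0 < B" "B < 1" "0 < C"
    "\<And>x. (\<And>i. 0 \<le> x i) \<Longrightarrow> x 0 = 1 \<Longrightarrow> summable (\<lambda>i. B ^ i * x i powr \<delta>) \<Longrightarrow>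
       summable (\<lambda>i. (B powr (1 / \<delta>)) ^ i * x i) \<and>
       summable (\<lambda>i. c_coeff p q \<theta> i * x i) \<and> c_coeff p q \<theta> 0 \<le> (\<Sum>i. c_coeff p q \<theta> i * x i) \<and>
       (\<forall>l<p + q + 1. summable (\<lambda>i. grad_c p q \<theta> i l * x i) \<and>
          \<bar>(\<Sum>i. grad_c p q \<theta> i l * x i) / (\<Sum>i. c_coeff p q \<theta> i * x i)\<bar> \<le> C * (\<Sum>i. B ^ i * x i powr \<delta>))"
    "\<And>v \<eta>. 0 \<le> \<eta> \<Longrightarrow> \<eta> \<le> \<eta>0 \<Longrightarrow> (\<And>l. l < p + q + 1 \<Longrightarrow> \<bar>v l - \<theta> l\<bar> \<le> \<eta> * \<theta> l) \<Longrightarrow>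
       (\<forall>i. 0 \<le> c_coeff p q v i \<and> c_coeff p q v i \<le> C * (B powr (1 / \<delta>)) ^ i) \<and> 1 / C \<le> c_coeff p q v 0"
    "\<And>x v \<eta>. (\<And>i. 0 \<le> x i) \<Longrightarrow> x 0 = 1 \<Longrightarrow> summable (\<lambda>i. B ^ i * x i powr \<delta>) \<Longrightarrow>
       0 \<le> \<eta> \<Longrightarrow> \<eta> \<le> \<eta>0 \<Longrightarrow> (\<And>l. l < p + q + 1 \<Longrightarrow> \<bar>v l - \<theta> l\<bar> \<le> \<eta> * \<theta> l) \<Longrightarrow>
       summable (\<lambda>i. c_coeff p q v i * x i) \<and>
       ((\<Sum>i. c_coeff p q \<theta> i * x i) / (\<Sum>i. c_coeff p q v i * x i)) powr \<kappa> \<le> C * (\<Sum>i. B ^ i * x i powr \<delta>) \<and>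
       \<bar>((\<Sum>i. c_coeff p q \<theta> i * x i) / (\<Sum>i. c_coeff p q v i * x i)) powr \<kappa> - 1
         + \<kappa> * (\<Sum>l<p + q + 1. (\<Sum>i. grad_c p q \<theta> i l * x i) / (\<Sum>i. c_coeff p q \<theta> i * x i) * (v l - \<theta> l))\<bar>
       \<le> C * \<eta>\<^sup>2 * (\<Sum>i. B ^ i * x i powr \<delta>)"
proof -
  define c where "c = c_coeff p q \<theta>"
  define b where "b = 1 - (\<Sum>j=1..q. \<theta> (p + j))"
  define L where "L = 4 / b"
  have b: "0 < b" using S by (simp add: b_def)
  have L: "0 < L" using b by (simp add: L_def)
  have cpos: "0 < c i" for i unfolding c_def by (rule c_coeff_pos[OF pq \<theta> S])
  obtain K r where K: "0 < K" and r: "0 < r" "r < 1" and cK: "\<And>i. c i \<le> K * r ^ i"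
    using c_coeff_geometric[OF pq(2) less_imp_le[OF \<theta>] S] unfolding c_def by metis
  \<comment> \<open>The decay \<open>r\<^sup>\<delta> = s\<^sup>4\<close> of the weights is spent as follows: one factor \<open>s\<close> absorbs the growth of
    the ratios of the coefficients, one the polynomial factor, and two remain in \<open>B\<close>.\<close>
  define s where "s = r powr (\<delta> / 4)"
  have s: "0 < s" "s < 1"
    using r \<delta> powr_less_mono'[of r 0 "\<delta> / 4"] by (simp_all add: s_def)
  have s4: "r powr \<delta> = s ^ 4" using r by (simp add: s_def powr_powr flip: powr_realpow)
  have rs: "0 < r / s" "r / s < 1"
  proof -
    have "r powr 1 < r powr (\<delta> / 4)" using r \<delta> by (intro powr_less_mono') simp_all
    then show "0 < r / s" "r / s < 1" using r s by (simp_all add: s_def)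
  qed
  \<comment> \<open>The second entry makes \<open>B\<^bsup>1/\<delta>\<^esup>\<close> dominate the decay \<open>r/s\<close> of the perturbed coefficients.\<close>
  define B where "B = max (s\<^sup>2) ((r / s) powr \<delta>)"
  have "s\<^sup>2 < 1" using s by (simp add: power_less_one_iff abs_square_less_1)
  moreover have "(r / s) powr \<delta> < 1" using rs \<delta> powr_less_mono2[of \<delta> "r / s" 1] by simp
  ultimately have B: "0 < B" "B < 1" "s\<^sup>2 \<le> B" "(r / s) powr \<delta> \<le> B"
    using s by (auto simp: B_def max_def)
  have rsB: "r / s \<le> B powr (1 / \<delta>)"
  proof -
    have "((r / s) powr \<delta>) powr (1 / \<delta>) \<le> B powr (1 / \<delta>)" using B \<delta> by (intro powr_mono2) simp_all
    then show ?thesis using rs r s \<delta> by (simp add: powr_powr)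
  qed
  obtain P where P: "0 < P" "\<And>i. (real i + 1)\<^sup>2 * s ^ i \<le> P"
    using succ_square_le_geometric[OF s] by metis
  define \<eta>0 where "\<eta>0 = min (b / 2) (ln (1 / s) / ((\<kappa> + 1) * L))"
  have eta0: "0 < \<eta>0" using b L \<kappa> s by (simp add: \<eta>0_def)
  define z where "z \<eta> i = L * \<eta> * (real i + 1)" for \<eta> and i :: nat
  have ez: "exp ((\<kappa> + 1) * z \<eta> i) \<le> (1 / s) ^ Suc i" if "0 \<le> \<eta>" "\<eta> \<le> \<eta>0" for \<eta> i
  proof -
    have "\<eta> \<le> ln (1 / s) / ((\<kappa> + 1) * L)" using that by (simp add: \<eta>0_def)
    then have "(\<kappa> + 1) * L * \<eta> \<le> ln (1 / s)" using L \<kappa> by (simp add: pos_le_divide_eq mult.commute)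
    then have "real (Suc i) * ((\<kappa> + 1) * L * \<eta>) \<le> real (Suc i) * ln (1 / s)" by (intro mult_left_mono) simp_all
    then have "exp ((\<kappa> + 1) * z \<eta> i) \<le> exp (real (Suc i) * ln (1 / s))"
      by (simp add: z_def mult_ac add.commute)
    also have "\<dots> = (1 / s) ^ Suc i" using s by (subst exp_of_nat_mult) simp
    finally show ?thesis .
  qed
  have z0: "0 \<le> z \<eta> i" if "0 \<le> \<eta>" for \<eta> i using that L by (simp add: z_def)
  have ez1: "exp (z \<eta> i) \<le> (1 / s) ^ Suc i" if "0 \<le> \<eta>" "\<eta> \<le> \<eta>0" for \<eta> i
  proof -
    have "0 \<le> \<kappa> * z \<eta> i" using z0 that \<kappa> by simp
    then have "exp (z \<eta> i) \<le> exp ((\<kappa> + 1) * z \<eta> i)" by (simp add: distrib_right)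
    then show ?thesis using ez[OF that] by (rule order_trans)
  qed
  define K2 where "K2 = (K / c 0) powr \<delta> * P / s"
  have K2: "0 \<le> K2" using P s by (simp add: K2_def)
  define T where "T = (\<Sum>l<p + q + 1. 1 / \<theta> l)"
  have T: "1 / \<theta> l \<le> T" if "l < p + q + 1" for l
    unfolding T_def
  proof (intro member_le_sum)
    show "0 \<le> 1 / \<theta> l'" if "l' \<in> {..<p + q + 1} - {l}" for l'
      using \<theta>[of l'] that by simp
  qed (use that in simp_all)
  have T0: "0 \<le> T" 
  proof -
    have "0 \<le> 1 / \<theta> 0" using \<theta>[of 0] by simp
    then show "0 \<le> T" using T[of 0] by linarith
  qed
  define C where "C = K2 + (\<kappa>\<^sup>2 + 2 * \<kappa>) * L\<^sup>2 * K2 + L * T * K2 + K / s + 1 / (s * c 0)"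
  have C1: "0 \<le> (\<kappa>\<^sup>2 + 2 * \<kappa>) * L\<^sup>2 * K2" "0 \<le> L * T * K2" "0 < K / s" "0 < 1 / (s * c 0)"
    using \<kappa> K2 L T0 K s cpos by simp_all
  have C: "0 < C" "K2 \<le> C" "(\<kappa>\<^sup>2 + 2 * \<kappa>) * L\<^sup>2 * K2 \<le> C" "L * T * K2 \<le> C" "K / s \<le> C" "1 / (s * c 0) \<le> C"
    using C1 K2 unfolding C_def by linarith+
  have pert: "exp (- z \<eta> i) * c i \<le> c_coeff p q v i" "c_coeff p q v i \<le> exp (z \<eta> i) * c i"
      "\<bar>dir_c p q \<theta> (\<lambda>l. v l - \<theta> l) i\<bar> \<le> z \<eta> i * c i"
      "\<bar>c_coeff p q v i - c i - dir_c p q \<theta> (\<lambda>l. v l - \<theta> l) i\<bar> \<le> (z \<eta> i)\<^sup>2 * exp (z \<eta> i) * c i"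
    if "0 \<le> \<eta>" "\<eta> \<le> \<eta>0" "\<And>l. l < p + q + 1 \<Longrightarrow> \<bar>v l - \<theta> l\<bar> \<le> \<eta> * \<theta> l" for v \<eta> i
  proof -
    have e: "\<eta> \<le> b / 2" using that by (simp add: \<eta>0_def)
    have v: "v l = \<theta> l + (v l - \<theta> l)" for l by simp
    have zz: "z \<eta> i = 4 / b * \<eta> * (real i + 1)" by (simp add: z_def L_def)
    note * = c_coeff_perturbation[OF less_imp_le[OF \<theta>] b_def b that(1) e that(3) v zz]
    show "exp (- z \<eta> i) * c i \<le> c_coeff p q v i" unfolding c_def by (rule *(1))
    show "c_coeff p q v i \<le> exp (z \<eta> i) * c i" unfolding c_def by (rule *(2))
    show "\<bar>dir_c p q \<theta> (\<lambda>l. v l - \<theta> l) i\<bar> \<le> z \<eta> i * c i" unfolding c_def by (rule *(3))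
    show "\<bar>c_coeff p q v i - c i - dir_c p q \<theta> (\<lambda>l. v l - \<theta> l) i\<bar> \<le> (z \<eta> i)\<^sup>2 * exp (z \<eta> i) * c i"
      unfolding c_def by (rule *(4))
  qed
  have gradb: "\<bar>grad_c p q \<theta> i l\<bar> \<le> L * T * (real i + 1) * c i" if "l < p + q + 1" for i l
  proof -
    have "\<bar>grad_c p q \<theta> i l\<bar> \<le> 4 / (b * \<theta> l) * (real i + 1) * c i"
      unfolding c_def by (rule grad_c_bound[OF \<theta> b_def b that])
    also have "\<dots> = L * (real i + 1) * c i * (1 / \<theta> l)" by (simp add: L_def)
    also have "\<dots> \<le> L * (real i + 1) * c i * T"
      using L cpos[of i] by (intro mult_left_mono T that) simp
    finally show ?thesis by (simp add: mult_ac)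
  qed
  have coeff: "(\<forall>i. 0 \<le> c_coeff p q v i \<and> c_coeff p q v i \<le> C * (B powr (1 / \<delta>)) ^ i) \<and> 1 / C \<le> c_coeff p q v 0"
    if v: "0 \<le> \<eta>" "\<eta> \<le> \<eta>0" "\<And>l. l < p + q + 1 \<Longrightarrow> \<bar>v l - \<theta> l\<bar> \<le> \<eta> * \<theta> l" for v \<eta>
  proof (intro conjI allI)
    fix i
    have "0 \<le> exp (- z \<eta> i) * c i" using cpos[of i] by simp
    then show "0 \<le> c_coeff p q v i" using pert(1)[OF v, of i] by linarith
    have "c_coeff p q v i \<le> exp (z \<eta> i) * c i" by (rule pert(2)[OF v])
    also have "\<dots> \<le> (1 / s) ^ Suc i * (K * r ^ i)"
      using cpos[of i] s by (intro mult_mono ez1 v cK) simp_all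
    also have "\<dots> = K / s * (r / s) ^ i" using s by (simp add: power_divide)
    also have "\<dots> \<le> C * (B powr (1 / \<delta>)) ^ i"
      using C C1 rs rsB by (intro mult_mono power_mono) simp_all
    finally show "c_coeff p q v i \<le> C * (B powr (1 / \<delta>)) ^ i" .
  next
    have "1 / C \<le> 1 / (1 / (s * c 0))" using C C1 by (intro divide_left_mono) simp_all
    also have "\<dots> = s * c 0" by simp
    also have "\<dots> \<le> exp (- z \<eta> 0) * c 0"
    proof (intro mult_right_mono)
      have "s * exp (z \<eta> 0) \<le> s * (1 / s) ^ Suc 0" using s by (intro mult_left_mono ez1 v) simp
      then show "s \<le> exp (- z \<eta> 0)" using s by (simp add: exp_minus field_simps)
    qed (use cpos[of 0] in simp)
    also have "\<dots> \<le> c_coeff p q v 0" by (rule pert(1)[OF v])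
    finally show "1 / C \<le> c_coeff p q v 0" .
  qed
  have path: "summable (\<lambda>i. (B powr (1 / \<delta>)) ^ i * x i) \<and> summable (\<lambda>i. c i * x i) \<and> c 0 \<le> (\<Sum>i. c i * x i) \<and>
      (\<forall>i. c i * x i / (\<Sum>i. c i * x i) * ((real i + 1)\<^sup>2 * (1 / s) ^ Suc i) \<le> K2 * (B ^ i * x i powr \<delta>))"
    if x: "\<And>i. 0 \<le> x i" "x 0 = 1" "summable (\<lambda>i. B ^ i * x i powr \<delta>)" for x
  proof -
    have e: "B ^ i * x i powr \<delta> = ((B powr (1 / \<delta>)) ^ i * x i) powr \<delta>" for i
    proof -
      have "((B powr (1 / \<delta>)) ^ i) powr \<delta> = ((B powr (1 / \<delta>)) powr \<delta>) ^ i"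
        using B by (intro power_powr_swap) simp
      also have "(B powr (1 / \<delta>)) powr \<delta> = B" using B \<delta> by (simp add: powr_powr)
      finally show ?thesis using x(1)[of i] by (simp add: powr_mult)
    qed
    have sum1: "summable (\<lambda>i. (B powr (1 / \<delta>)) ^ i * x i)"
      using x(3) unfolding e by (rule summable_of_summable_powr[OF _ \<delta>, rotated]) (simp add: x(1))
    have "norm (c i * x i) \<le> K * ((B powr (1 / \<delta>)) ^ i * x i)" for i
    proof -
      have "r \<le> r / s" using r s by (simp add: field_simps)
      then have "c i \<le> K * (B powr (1 / \<delta>)) ^ i"
        using K r rsB by (intro order_trans[OF cK mult_left_mono] power_mono) simp_all
      from mult_right_mono[OF this x(1)[of i]] show ?thesis using cpos[of i] x(1)[of i] by (simp add: mult.assoc)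
    qed
    then have sum2: "summable (\<lambda>i. c i * x i)"
      by (intro summable_comparison_test'[OF summable_mult[OF sum1], of 0])
    let ?S = "\<Sum>i. c i * x i"
    have termle: "c i * x i \<le> ?S" for i
      using sum_le_suminf[OF sum2, of "{i}"] less_imp_le[OF cpos] x(1) by simp
    have S0: "c 0 \<le> ?S" using termle[of 0] x(2) by simp
    have "c i * x i / ?S * ((real i + 1)\<^sup>2 * (1 / s) ^ Suc i) \<le> K2 * (B ^ i * x i powr \<delta>)" for i
    proof -
      have Spos: "0 < ?S" using S0 cpos[of 0] by linarith
      have cx: "0 \<le> c i * x i" using cpos[of i] x(1)[of i] by simp
      have "c i * x i / ?S \<le> (K / c 0 * (r ^ i * x i)) powr \<delta>"
      proof (rule le_powr_of_le_one[OF _ _ _ \<delta>])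
        show "0 \<le> c i * x i / ?S" "c i * x i / ?S \<le> 1" using cx Spos termle[of i] by simp_all
        have "c i * x i / ?S \<le> c i * x i / c 0"
          using cx S0 cpos[of 0] Spos by (intro divide_left_mono) simp_all
        also have "\<dots> \<le> K * r ^ i * x i / c 0"
          using cpos[of 0] x(1)[of i] by (intro divide_right_mono mult_right_mono cK) simp_all
        finally show "c i * x i / ?S \<le> K / c 0 * (r ^ i * x i)" by simp
      qed
      also have "\<dots> = (K / c 0) powr \<delta> * ((s ^ 4) ^ i * x i powr \<delta>)"
      proof -
        have "(K / c 0 * (r ^ i * x i)) powr \<delta> = (K / c 0) powr \<delta> * ((r ^ i) powr \<delta> * x i powr \<delta>)"
          using K cpos[of 0] r x(1)[of i] by (simp only: powr_mult)
        then show ?thesis using r by (simp only: s4[symmetric] power_powr_swap)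
      qed
      finally have "c i * x i / ?S * ((real i + 1)\<^sup>2 * (1 / s) ^ Suc i)
          \<le> (K / c 0) powr \<delta> * ((s ^ 4) ^ i * x i powr \<delta>) * ((real i + 1)\<^sup>2 * (1 / s) ^ Suc i)"
        using s by (intro mult_right_mono) simp_all
      also have "\<dots> = (K / c 0) powr \<delta> / s * (((real i + 1)\<^sup>2 * s ^ i) * ((s\<^sup>2) ^ i * x i powr \<delta>))"
      proof -
        have "(s ^ 4) ^ i = s ^ i * s ^ i * (s\<^sup>2) ^ i"
          by (simp flip: power_mult power_add power_mult_distrib)
        then show ?thesis using s by (simp add: power_divide)
      qed
      also have "\<dots> \<le> (K / c 0) powr \<delta> / s * (P * (B ^ i * x i powr \<delta>))"
        using s P B by (intro mult_left_mono mult_mono mult_right_mono power_mono) simp_all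
      finally show ?thesis by (simp add: K2_def mult_ac)
    qed
    then show ?thesis using sum1 sum2 S0 by blast
  qed
  show thesis
  proof (rule that[OF eta0 B(1,2) C(1)])
    fix x :: "nat \<Rightarrow> real"
    assume x: "\<And>i. 0 \<le> x i" "x 0 = 1" "summable (\<lambda>i. B ^ i * x i powr \<delta>)"
    note p = path[OF x]
    let ?S = "\<Sum>i. c i * x i"
    let ?V = "\<Sum>i. B ^ i * x i powr \<delta>"
    have Spos: "0 < ?S" using p cpos[of 0] by linarith
    have V: "0 \<le> ?V" using B by (intro suminf_nonneg x(3)) simp
    have "summable (\<lambda>i. grad_c p q \<theta> i l * x i) \<and> \<bar>(\<Sum>i. grad_c p q \<theta> i l * x i) / ?S\<bar> \<le> C * ?V"
      if l: "l < p + q + 1" for l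
    proof -
      have le: "\<bar>grad_c p q \<theta> i l * x i / ?S\<bar> \<le> L * T * K2 * (B ^ i * x i powr \<delta>)" for i
      proof -
        have w: "0 \<le> c i * x i / ?S" using Spos cpos[of i] x(1)[of i] by simp
        have "\<bar>grad_c p q \<theta> i l * x i / ?S\<bar> = \<bar>grad_c p q \<theta> i l\<bar> * (x i / ?S)"
          using Spos x(1)[of i] by (simp add: abs_mult)
        also have "\<dots> \<le> L * T * (real i + 1) * c i * (x i / ?S)"
          using Spos x(1)[of i] by (intro mult_right_mono gradb l) simp
        also have "\<dots> = L * T * (c i * x i / ?S * (real i + 1))" by simp
        also have "\<dots> \<le> L * T * (c i * x i / ?S * ((real i + 1)\<^sup>2 * (1 / s) ^ Suc i))"
        proof (intro mult_left_mono w)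
          have "1 * 1 * (real i + 1) \<le> (1 / s) ^ Suc i * (real i + 1) * (real i + 1)"
            using s by (intro mult_mono one_le_power) simp_all
          then show "real i + 1 \<le> (real i + 1)\<^sup>2 * (1 / s) ^ Suc i"
            by (simp add: power2_eq_square mult_ac del: power_Suc)
        qed (use L T0 in simp)
        also have "\<dots> \<le> L * T * (K2 * (B ^ i * x i powr \<delta>))"
          using p L T0 by (intro mult_left_mono) simp_all
        finally show ?thesis by simp
      qed
      have sr: "summable (\<lambda>i. L * T * K2 * (B ^ i * x i powr \<delta>))" by (intro summable_mult x(3))
      have sg: "summable (\<lambda>i. \<bar>grad_c p q \<theta> i l * x i / ?S\<bar>)"
        by (rule summable_comparison_test'[OF sr, of 0]) (use le in simp)
      have sg': "summable (\<lambda>i. grad_c p q \<theta> i l * x i)"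
        using summable_mult[OF summable_rabs_cancel[OF sg], of ?S] Spos by simp
      have "\<bar>(\<Sum>i. grad_c p q \<theta> i l * x i) / ?S\<bar> \<le> (\<Sum>i. \<bar>grad_c p q \<theta> i l * x i / ?S\<bar>)"
        using summable_rabs[OF sg] by (simp only: suminf_divide[OF sg'])
      also have "\<dots> \<le> (\<Sum>i. L * T * K2 * (B ^ i * x i powr \<delta>))" by (rule suminf_le[OF le sg sr])
      also have "\<dots> = L * T * K2 * ?V" by (rule suminf_mult[OF x(3)])
      also have "\<dots> \<le> C * ?V" by (intro mult_right_mono C V)
      finally show ?thesis using sg' by blast
    qed
    then show "summable (\<lambda>i. (B powr (1 / \<delta>)) ^ i * x i) \<and>
       summable (\<lambda>i. c_coeff p q \<theta> i * x i) \<and> c_coeff p q \<theta> 0 \<le> (\<Sum>i. c_coeff p q \<theta> i * x i) \<and>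
       (\<forall>l<p + q + 1. summable (\<lambda>i. grad_c p q \<theta> i l * x i) \<and>
          \<bar>(\<Sum>i. grad_c p q \<theta> i l * x i) / (\<Sum>i. c_coeff p q \<theta> i * x i)\<bar> \<le> C * ?V)"
      using p unfolding c_def by blast
  next
    fix v \<eta>
    assume "0 \<le> \<eta>" "\<eta> \<le> \<eta>0" "\<And>l. l < p + q + 1 \<Longrightarrow> \<bar>v l - \<theta> l\<bar> \<le> \<eta> * \<theta> l"
    then show "(\<forall>i. 0 \<le> c_coeff p q v i \<and> c_coeff p q v i \<le> C * (B powr (1 / \<delta>)) ^ i) \<and> 1 / C \<le> c_coeff p q v 0"
      by (rule coeff)
  next
    fix x :: "nat \<Rightarrow> real" and v \<eta>
    assume x: "\<And>i. 0 \<le> x i" "x 0 = 1" "summable (\<lambda>i. B ^ i * x i powr \<delta>)"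
      and v: "0 \<le> \<eta>" "\<eta> \<le> \<eta>0" "\<And>l. l < p + q + 1 \<Longrightarrow> \<bar>v l - \<theta> l\<bar> \<le> \<eta> * \<theta> l"
    note p = path[OF x]
    let ?S = "\<Sum>i. c i * x i"
    let ?V = "\<Sum>i. B ^ i * x i powr \<delta>"
    let ?g = "dir_c p q \<theta> (\<lambda>l. v l - \<theta> l)"
    define w where "w i = c i * x i / ?S" for i
    define y where "y i = c_coeff p q v i / c i" for i
    have Spos: "0 < ?S" using p cpos[of 0] by linarith
    have V: "0 \<le> ?V" using B by (intro suminf_nonneg x(3)) simp
    have w0: "0 \<le> w i" for i using Spos cpos[of i] x(1)[of i] by (simp add: w_def)
    have "w sums (?S / ?S)" unfolding w_def by (intro sums_divide summable_sums) (use p in blast)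
    then have w1: "w sums 1" using Spos by simp
    have wb: "w i * ((real i + 1)\<^sup>2 * (1 / s) ^ Suc i) \<le> K2 * (B ^ i * x i powr \<delta>)" for i
      using p unfolding w_def by blast
    have one: "1 \<le> (1 / s) ^ Suc i" "1 \<le> (real i + 1)\<^sup>2" "real i + 1 \<le> (real i + 1)\<^sup>2" for i
    proof -
      show "1 \<le> (1 / s) ^ Suc i" using s by (intro one_le_power) simp
      show "1 \<le> (real i + 1)\<^sup>2" by (intro one_le_power) simp
      have "(real i + 1) * 1 \<le> (real i + 1) * (real i + 1)" by (intro mult_left_mono) simp_all
      then show "real i + 1 \<le> (real i + 1)\<^sup>2" by (simp only: power2_eq_square mult_1_right)
    qed
    have b1: "w i * exp ((\<kappa> + 1) * z \<eta> i) \<le> K2 * (B ^ i * x i powr \<delta>)" for i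
    proof -
      have "1 * exp ((\<kappa> + 1) * z \<eta> i) \<le> (real i + 1)\<^sup>2 * (1 / s) ^ Suc i"
        by (intro mult_mono ez v one) simp_all
      then show ?thesis using mult_left_mono[OF _ w0[of i]] wb[of i] by fastforce
    qed
    have b2: "w i * ((z \<eta> i)\<^sup>2 * exp ((\<kappa> + 1) * z \<eta> i)) \<le> (L\<^sup>2 * \<eta>\<^sup>2) * (K2 * (B ^ i * x i powr \<delta>))" for i
    proof -
      have "w i * ((z \<eta> i)\<^sup>2 * exp ((\<kappa> + 1) * z \<eta> i)) = L\<^sup>2 * \<eta>\<^sup>2 * (w i * ((real i + 1)\<^sup>2 * exp ((\<kappa> + 1) * z \<eta> i)))"
        by (simp add: z_def power_mult_distrib)
      also have "\<dots> \<le> L\<^sup>2 * \<eta>\<^sup>2 * (w i * ((real i + 1)\<^sup>2 * (1 / s) ^ Suc i))"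
        by (intro mult_left_mono ez v w0) simp_all
      also have "\<dots> \<le> L\<^sup>2 * \<eta>\<^sup>2 * (K2 * (B ^ i * x i powr \<delta>))" by (intro mult_left_mono wb) simp
      finally show ?thesis .
    qed
    have b3: "\<bar>w i * (?g i / c i)\<bar> \<le> (L * \<eta>) * (K2 * (B ^ i * x i powr \<delta>))" for i
    proof -
      have "\<bar>?g i / c i\<bar> \<le> z \<eta> i" using pert(3)[OF v, of i] cpos[of i] by (simp add: pos_divide_le_eq)
      then have "\<bar>w i * (?g i / c i)\<bar> \<le> w i * z \<eta> i"
        unfolding abs_mult[of "w i"] abs_of_nonneg[OF w0] by (intro mult_left_mono w0)
      also have "\<dots> = L * \<eta> * (w i * ((real i + 1) * 1))" by (simp add: z_def)
      also have "\<dots> \<le> L * \<eta> * (w i * ((real i + 1)\<^sup>2 * (1 / s) ^ Suc i))"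
        using L v(1) by (intro mult_left_mono[of _ _ "L * \<eta>"] mult_left_mono[OF _ w0] mult_mono one) simp_all
      also have "\<dots> \<le> L * \<eta> * (K2 * (B ^ i * x i powr \<delta>))" using L v(1) by (intro mult_left_mono wb) simp
      finally show ?thesis .
    qed
    have r1: "summable (\<lambda>i. K2 * (B ^ i * x i powr \<delta>))" by (intro summable_mult x(3))
    have s1: "summable (\<lambda>i. w i * exp ((\<kappa> + 1) * z \<eta> i))"
      by (rule summable_comparison_test'[OF r1, of 0]) (use b1 w0 in simp)
    have s2: "summable (\<lambda>i. w i * ((z \<eta> i)\<^sup>2 * exp ((\<kappa> + 1) * z \<eta> i)))"
      by (rule summable_comparison_test'[OF summable_mult[OF r1, of "L\<^sup>2 * \<eta>\<^sup>2"], of 0]) (use b2 w0 in simp)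
    have s3: "summable (\<lambda>i. w i * (?g i / c i))"
      by (rule summable_comparison_test'[OF summable_mult[OF r1, of "L * \<eta>"], of 0]) (use b3 in simp)
    have y1: "exp (- z \<eta> i) \<le> y i" "y i \<le> exp (z \<eta> i)" for i
      using pert(1,2)[OF v, of i] cpos[of i] by (simp_all add: y_def pos_le_divide_eq pos_divide_le_eq)
    have yg: "\<bar>y i - 1 - ?g i / c i\<bar> \<le> (z \<eta> i)\<^sup>2 * exp (z \<eta> i)" for i
    proof -
      have "y i - 1 - ?g i / c i = (c_coeff p q v i - c i - ?g i) / c i"
        using cpos[of i] by (simp add: y_def diff_divide_distrib)
      then show ?thesis using pert(4)[OF v, of i] cpos[of i] by (simp add: pos_divide_le_eq)
    qed
    note E = powr_weighted_mean_expansion[OF \<kappa> w0 w1 y1 yg s1 s2 s3]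
    have wy: "w i * y i = c_coeff p q v i * x i / ?S" for i
      using cpos[of i] by (simp add: w_def y_def)
    have sv: "summable (\<lambda>i. c_coeff p q v i * x i)"
      using summable_mult[OF E(1), of ?S] Spos by (simp add: wy)
    let ?Sv = "\<Sum>i. c_coeff p q v i * x i"
    have Y: "(\<Sum>i. w i * y i) = ?Sv / ?S" unfolding wy by (rule suminf_divide[OF sv])
    have Svpos: "0 < ?Sv" using E(2) Spos unfolding Y by (simp add: zero_less_divide_iff)
    have Yk: "(\<Sum>i. w i * y i) powr (- \<kappa>) = (?S / ?Sv) powr \<kappa>"
      unfolding Y using Spos Svpos by (simp add: powr_minus powr_divide)
    have lin: "(\<Sum>i. w i * (?g i / c i)) = (\<Sum>l<p + q + 1. (\<Sum>i. grad_c p q \<theta> i l * x i) / ?S * (v l - \<theta> l))"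
    proof -
      have gs: "summable (\<lambda>i. grad_c p q \<theta> i l * x i)" if l: "l < p + q + 1" for l
      proof -
        have "norm (grad_c p q \<theta> i l * x i) \<le> ?S * (L * T * (K2 * (B ^ i * x i powr \<delta>)))" for i
        proof -
          have "norm (grad_c p q \<theta> i l * x i) = \<bar>grad_c p q \<theta> i l\<bar> * x i" using x(1)[of i] by (simp add: abs_mult)
          also have "\<dots> \<le> L * T * (real i + 1) * c i * x i"
            by (intro mult_right_mono gradb l x(1))
          also have "\<dots> = ?S * (L * T * (w i * ((real i + 1) * 1)))" using Spos by (simp add: w_def)
          also have "\<dots> \<le> ?S * (L * T * (w i * ((real i + 1)\<^sup>2 * (1 / s) ^ Suc i)))"
            using Spos L T0
            by (intro mult_left_mono[of _ _ ?S] mult_left_mono[of _ _ "L * T"] mult_left_mono[OF _ w0] mult_mono one) simp_all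
          also have "\<dots> \<le> ?S * (L * T * (K2 * (B ^ i * x i powr \<delta>)))"
            using Spos L T0 by (intro mult_left_mono wb) simp_all
          finally show ?thesis .
        qed
        then show ?thesis
          by (intro summable_comparison_test'[OF summable_mult[OF summable_mult[OF r1, of "L * T"], of ?S], of 0])
      qed
      have "w i * (?g i / c i) = (\<Sum>l<p + q + 1. grad_c p q \<theta> i l * x i / ?S * (v l - \<theta> l))" for i
        using cpos[of i] unfolding w_def dir_c_def sum_divide_distrib sum_distrib_left
        by (intro sum.cong refl) simp
      then have "(\<Sum>i. w i * (?g i / c i)) = (\<Sum>i. \<Sum>l<p + q + 1. grad_c p q \<theta> i l * x i / ?S * (v l - \<theta> l))"
        by simp
      also have "\<dots> = (\<Sum>l<p + q + 1. \<Sum>i. grad_c p q \<theta> i l * x i / ?S * (v l - \<theta> l))"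
        using gs by (intro suminf_sum summable_mult2 summable_divide) simp
      also have "\<dots> = (\<Sum>l<p + q + 1. (\<Sum>i. grad_c p q \<theta> i l * x i) / ?S * (v l - \<theta> l))"
      proof (intro sum.cong refl)
        fix l assume "l \<in> {..<p + q + 1}"
        then have g: "summable (\<lambda>i. grad_c p q \<theta> i l * x i)" by (intro gs) simp
        show "(\<Sum>i. grad_c p q \<theta> i l * x i / ?S * (v l - \<theta> l)) = (\<Sum>i. grad_c p q \<theta> i l * x i) / ?S * (v l - \<theta> l)"
          using suminf_mult2[OF summable_divide[OF g, of ?S], of "v l - \<theta> l"] suminf_divide[OF g, of ?S] by simp
      qed
      finally show ?thesis .
    qed
    have "(?S / ?Sv) powr \<kappa> \<le> C * ?V"
    proof -
      have "(\<Sum>i. w i * exp ((\<kappa> + 1) * z \<eta> i)) \<le> (\<Sum>i. K2 * (B ^ i * x i powr \<delta>))" by (rule suminf_le[OF b1 s1 r1])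
      also have "\<dots> = K2 * ?V" by (rule suminf_mult[OF x(3)])
      also have "\<dots> \<le> C * ?V" by (intro mult_right_mono C V)
      finally show ?thesis using E(3) unfolding Yk by linarith
    qed
    moreover have "\<bar>(?S / ?Sv) powr \<kappa> - 1 + \<kappa> * (\<Sum>l<p + q + 1. (\<Sum>i. grad_c p q \<theta> i l * x i) / ?S * (v l - \<theta> l))\<bar> \<le> C * \<eta>\<^sup>2 * ?V"
    proof -
      have "(\<Sum>i. w i * ((z \<eta> i)\<^sup>2 * exp ((\<kappa> + 1) * z \<eta> i))) \<le> (\<Sum>i. (L\<^sup>2 * \<eta>\<^sup>2) * (K2 * (B ^ i * x i powr \<delta>)))"
        by (rule suminf_le[OF b2 s2 summable_mult[OF r1]])
      also have "\<dots> = (L\<^sup>2 * \<eta>\<^sup>2) * (K2 * ?V)"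
        by (simp only: suminf_mult[OF r1] suminf_mult[OF x(3)])
      finally have "(\<kappa>\<^sup>2 + 2 * \<kappa>) * (\<Sum>i. w i * ((z \<eta> i)\<^sup>2 * exp ((\<kappa> + 1) * z \<eta> i))) \<le> (\<kappa>\<^sup>2 + 2 * \<kappa>) * ((L\<^sup>2 * \<eta>\<^sup>2) * (K2 * ?V))"
        using \<kappa> by (intro mult_left_mono) simp_all
      also have "\<dots> = ((\<kappa>\<^sup>2 + 2 * \<kappa>) * L\<^sup>2 * K2) * (\<eta>\<^sup>2 * ?V)" by simp
      also have "\<dots> \<le> C * (\<eta>\<^sup>2 * ?V)" using V by (intro mult_right_mono C) simp
      finally show ?thesis using E(4) unfolding Yk lin by (simp add: mult.assoc)
    qed
    ultimately show "summable (\<lambda>i. c_coeff p q v i * x i) \<and>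
       ((\<Sum>i. c_coeff p q \<theta> i * x i) / (\<Sum>i. c_coeff p q v i * x i)) powr \<kappa> \<le> C * ?V \<and>
       \<bar>((\<Sum>i. c_coeff p q \<theta> i * x i) / (\<Sum>i. c_coeff p q v i * x i)) powr \<kappa> - 1
         + \<kappa> * (\<Sum>l<p + q + 1. (\<Sum>i. grad_c p q \<theta> i l * x i) / (\<Sum>i. c_coeff p q \<theta> i * x i) * (v l - \<theta> l))\<bar>
       \<le> C * \<eta>\<^sup>2 * ?V"
      using sv unfolding c_def by blast
  qed
qed

section \<open>The path of an i.i.d. sequence and the mean ergodic theorem\<close>

locale iid_sequence = prob_space M for M :: "'a measure" +
  fixes \<epsilon> :: "int \<Rightarrow> 'a \<Rightarrow> real"
  assumes indep: "indep_vars (\<lambda>_. borel) \<epsilon> UNIV"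
    and ident: "\<And>t. distr M borel (\<epsilon> t) = distr M borel (\<epsilon> 0)"
begin

abbreviation paths :: "(nat \<Rightarrow> real) measure" where
  "paths \<equiv> Pi\<^sub>M UNIV (\<lambda>_. borel)"

definition past :: "int \<Rightarrow> 'a \<Rightarrow> nat \<Rightarrow> real" where
  "past t \<omega> = (\<lambda>m. \<epsilon> (t - int m) \<omega>)"

lemma eps_measurable: "\<epsilon> t \<in> borel_measurable M"
  using indep by (auto simp: indep_vars_def)

lemma past_measurable: "past t \<in> measurable M paths"
  unfolding past_def by (rule measurable_PiM_single') (auto simp: eps_measurable space_PiM)

lemma measurable_past: "f \<in> borel_measurable paths \<Longrightarrow> (\<lambda>\<omega>. f (past t \<omega>)) \<in> borel_measurable M"
  for f :: "_ \<Rightarrow> 'b :: topological_space"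
  by (rule measurable_compose[OF past_measurable])

lemma distr_past: "distr M paths (past t) = Pi\<^sub>M UNIV (\<lambda>_. distr M borel (\<epsilon> 0))"
proof -
  let ?P = "Pi\<^sub>M UNIV (\<lambda>s. distr M borel (\<epsilon> s))"
  have joint: "distr M (Pi\<^sub>M UNIV (\<lambda>_. borel)) (\<lambda>\<omega>. \<lambda>s\<in>UNIV. \<epsilon> s \<omega>) = ?P"
    using indep by (subst (asm) indep_vars_iff_distr_eq_PiM) (auto simp: eps_measurable)
  have m1: "(\<lambda>\<omega>. \<lambda>s\<in>UNIV. \<epsilon> s \<omega>) \<in> measurable M (Pi\<^sub>M UNIV (\<lambda>_. borel))"
    by (intro measurable_restrict eps_measurable)
  have m2: "(\<lambda>e. \<lambda>m\<in>UNIV. e (t - int m)) \<in> measurable (Pi\<^sub>M UNIV (\<lambda>_. borel)) paths"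
    by (intro measurable_restrict measurable_component_singleton) simp
  have "distr ?P (Pi\<^sub>M UNIV (\<lambda>m::nat. distr M borel (\<epsilon> (t - int m)))) (\<lambda>e. \<lambda>m\<in>UNIV. e (t - int m))
      = Pi\<^sub>M UNIV (\<lambda>m::nat. distr M borel (\<epsilon> (t - int m)))"
    by (intro distr_PiM_reindex prob_space_distr eps_measurable) (auto simp: inj_on_def)
  also have "distr ?P (Pi\<^sub>M UNIV (\<lambda>m::nat. distr M borel (\<epsilon> (t - int m)))) (\<lambda>e. \<lambda>m\<in>UNIV. e (t - int m))
      = distr ?P paths (\<lambda>e. \<lambda>m\<in>UNIV. e (t - int m))"
    by (intro distr_cong refl sets_PiM_cong) simp_all
  finally have "distr M paths (\<lambda>\<omega>. \<lambda>m\<in>UNIV. \<epsilon> (t - int m) \<omega>)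
      = Pi\<^sub>M UNIV (\<lambda>m::nat. distr M borel (\<epsilon> (t - int m)))"
    unfolding joint[symmetric] distr_distr[OF m2 m1] by (simp add: comp_def)
  moreover have "(\<lambda>m::nat. distr M borel (\<epsilon> (t - int m))) = (\<lambda>_. distr M borel (\<epsilon> 0))"
    using ident by blast
  moreover have "(\<lambda>\<omega>. \<lambda>m\<in>UNIV. \<epsilon> (t - int m) \<omega>) = past t"
    by (simp add: past_def fun_eq_iff)
  ultimately show ?thesis by simp
qed

lemma integral_past:
  fixes f :: "(nat \<Rightarrow> real) \<Rightarrow> real"
  assumes "f \<in> borel_measurable paths"
  shows "(\<integral>\<omega>. f (past t \<omega>) \<partial>M) = (\<integral>\<omega>. f (past s \<omega>) \<partial>M)"
  by (metis assms integral_distr[OF past_measurable] distr_past)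

lemma integrable_past:
  fixes f :: "(nat \<Rightarrow> real) \<Rightarrow> real"
  assumes "f \<in> borel_measurable paths"
  shows "integrable M (\<lambda>\<omega>. f (past t \<omega>)) \<longleftrightarrow> integrable M (\<lambda>\<omega>. f (past s \<omega>))"
  by (metis assms integrable_distr_eq[OF past_measurable] distr_past)

text \<open>Independence over disjoint sets of time points; the functionals are evaluated at arguments
  whose other coordinates are \<open>undefined\<close>.\<close>

lemma indep_var_disjoint_times:
  fixes f :: "(int \<Rightarrow> real) \<Rightarrow> real" and g :: "(int \<Rightarrow> real) \<Rightarrow> real"
  assumes "A \<inter> B = {}"
    and f: "f \<in> borel_measurable (Pi\<^sub>M A (\<lambda>_. borel))" and g: "g \<in> borel_measurable (Pi\<^sub>M B (\<lambda>_. borel))"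
  shows "indep_var borel (\<lambda>\<omega>. f (\<lambda>i\<in>A. \<epsilon> i \<omega>)) borel (\<lambda>\<omega>. g (\<lambda>i\<in>B. \<epsilon> i \<omega>))"
proof -
  have "indep_var (Pi\<^sub>M A (\<lambda>_. borel)) (\<lambda>\<omega>. \<lambda>i\<in>A. \<epsilon> i \<omega>) (Pi\<^sub>M B (\<lambda>_. borel)) (\<lambda>\<omega>. \<lambda>i\<in>B. \<epsilon> i \<omega>)"
    using assms(1) by (intro indep_var_restrict[OF indep]) auto
  from indep_var_compose[OF this f g] show ?thesis by (simp add: comp_def)
qed

lemma indep_var_past:
  fixes f :: "(int \<Rightarrow> real) \<Rightarrow> real" and g :: "(nat \<Rightarrow> real) \<Rightarrow> real"
  assumes "A \<inter> {..a} = {}"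
    and f: "f \<in> borel_measurable (Pi\<^sub>M A (\<lambda>_. borel))" and g: "g \<in> borel_measurable paths"
  shows "indep_var borel (\<lambda>\<omega>. f (\<lambda>i\<in>A. \<epsilon> i \<omega>)) borel (\<lambda>\<omega>. g (past a \<omega>))"
proof -
  have m: "(\<lambda>e m. e (a - int m)) \<in> measurable (Pi\<^sub>M {..a} (\<lambda>_. borel)) paths"
  proof (rule measurable_PiM_single')
    fix m :: nat
    show "(\<lambda>e. e (a - int m)) \<in> borel_measurable (Pi\<^sub>M {..a} (\<lambda>_. borel :: real measure))"
      by (rule measurable_component_singleton) simp
  qed (auto simp: space_PiM)
  have "(\<lambda>e. g (\<lambda>m. e (a - int m))) \<in> borel_measurable (Pi\<^sub>M {..a} (\<lambda>_. borel))"
    using measurable_compose[OF m g] by simp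
  from indep_var_disjoint_times[OF assms(1) f this] show ?thesis
    by (simp add: past_def)
qed

subsection \<open>Convergence of averages\<close>

text \<open>The distance in mean between the average of a functional along the path and its expectation.\<close>

definition avg_error :: "((nat \<Rightarrow> real) \<Rightarrow> real) \<Rightarrow> nat \<Rightarrow> real" where
  "avg_error f n = (\<integral>\<omega>. \<bar>(\<Sum>t=1..n. f (past (int t) \<omega>)) / real n - (\<integral>\<omega>. f (past 0 \<omega>) \<partial>M)\<bar> \<partial>M)"

lemma avg_error_nonneg: "0 \<le> avg_error f n"
  unfolding avg_error_def by simp

lemma avg_error_le:
  assumes f: "f \<in> borel_measurable paths" "integrable M (\<lambda>\<omega>. f (past 0 \<omega>))"
    and g: "g \<in> borel_measurable paths" "integrable M (\<lambda>\<omega>. g (past 0 \<omega>))"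
    and n: "1 \<le> n"
  shows "avg_error f n \<le> avg_error g n + 2 * (\<integral>\<omega>. \<bar>f (past 0 \<omega>) - g (past 0 \<omega>)\<bar> \<partial>M)"
proof -
  let ?d = "\<lambda>t \<omega>. \<bar>f (past t \<omega>) - g (past t \<omega>)\<bar>"
  have If: "integrable M (\<lambda>\<omega>. f (past t \<omega>))" and Ig: "integrable M (\<lambda>\<omega>. g (past t \<omega>))" for t
    using f g integrable_past by blast+
  have Id: "integrable M (?d t)" for t using If Ig by (intro integrable_abs Bochner_Integration.integrable_diff)
  have E: "(\<integral>\<omega>. ?d (int t) \<omega> \<partial>M) = (\<integral>\<omega>. ?d 0 \<omega> \<partial>M)" for t
    by (rule integral_past) (intro borel_measurable_abs borel_measurable_diff f g)
  let ?F = "\<integral>\<omega>. f (past 0 \<omega>) \<partial>M" and ?G = "\<integral>\<omega>. g (past 0 \<omega>) \<partial>M"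
  have FG: "\<bar>?F - ?G\<bar> \<le> (\<integral>\<omega>. ?d 0 \<omega> \<partial>M)"
    using integral_abs_bound[of M "\<lambda>\<omega>. f (past 0 \<omega>) - g (past 0 \<omega>)"] If[of 0] Ig[of 0] by simp
  have le: "\<bar>(\<Sum>t=1..n. f (past (int t) \<omega>)) / real n - ?F\<bar>
      \<le> \<bar>(\<Sum>t=1..n. g (past (int t) \<omega>)) / real n - ?G\<bar> + ((\<Sum>t=1..n. ?d (int t) \<omega>) / real n + \<bar>?F - ?G\<bar>)" for \<omega>
  proof -
    have "\<bar>(\<Sum>t=1..n. f (past (int t) \<omega>)) - (\<Sum>t=1..n. g (past (int t) \<omega>))\<bar> \<le> (\<Sum>t=1..n. ?d (int t) \<omega>)"
      unfolding sum_subtractf[symmetric] by (rule sum_abs)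
    then have "\<bar>(\<Sum>t=1..n. f (past (int t) \<omega>)) / real n - (\<Sum>t=1..n. g (past (int t) \<omega>)) / real n\<bar>
        \<le> (\<Sum>t=1..n. ?d (int t) \<omega>) / real n"
      unfolding diff_divide_distrib[symmetric] by (simp add: divide_right_mono)
    then show ?thesis by linarith
  qed
  have "avg_error f n \<le> (\<integral>\<omega>. \<bar>(\<Sum>t=1..n. g (past (int t) \<omega>)) / real n - ?G\<bar>
      + ((\<Sum>t=1..n. ?d (int t) \<omega>) / real n + \<bar>?F - ?G\<bar>) \<partial>M)"
    unfolding avg_error_def using If Ig Id
    by (intro integral_mono le Bochner_Integration.integrable_add integrable_abs Bochner_Integration.integrable_diff
        Bochner_Integration.integrable_divide Bochner_Integration.integrable_sum integrable_const)
  moreover have "(\<integral>\<omega>. \<bar>(\<Sum>t=1..n. g (past (int t) \<omega>)) / real n - ?G\<bar>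
      + ((\<Sum>t=1..n. ?d (int t) \<omega>) / real n + \<bar>?F - ?G\<bar>) \<partial>M) = avg_error g n + (\<integral>\<omega>. (\<Sum>t=1..n. ?d (int t) \<omega>) / real n + \<bar>?F - ?G\<bar> \<partial>M)"
    unfolding avg_error_def using If Ig Id
    by (intro Bochner_Integration.integral_add Bochner_Integration.integrable_add integrable_abs Bochner_Integration.integrable_diff
        Bochner_Integration.integrable_divide Bochner_Integration.integrable_sum integrable_const)
  moreover have "(\<integral>\<omega>. (\<Sum>t=1..n. ?d (int t) \<omega>) / real n + \<bar>?F - ?G\<bar> \<partial>M)
      = (\<Sum>t=1..n. (\<integral>\<omega>. ?d (int t) \<omega> \<partial>M)) / real n + \<bar>?F - ?G\<bar>"
    using Id by (subst Bochner_Integration.integral_add)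
      (auto intro!: Bochner_Integration.integrable_divide Bochner_Integration.integrable_sum simp: prob_space)
  moreover have "(\<Sum>t=1..n. (\<integral>\<omega>. ?d (int t) \<omega> \<partial>M)) / real n + \<bar>?F - ?G\<bar> \<le> 2 * (\<integral>\<omega>. ?d 0 \<omega> \<partial>M)"
    unfolding E using FG n by simp
  ultimately show ?thesis by linarith
qed

lemma avg_error_tendsto_limit:
  assumes f: "f \<in> borel_measurable paths" "integrable M (\<lambda>\<omega>. f (past 0 \<omega>))"
    and g: "\<And>i. g i \<in> borel_measurable paths" "\<And>i. integrable M (\<lambda>\<omega>. g i (past 0 \<omega>))"
    and conv: "\<And>i. (\<lambda>n. avg_error (g i) n) \<longlonglongrightarrow> 0"
    and lim: "(\<lambda>i. \<integral>\<omega>. \<bar>f (past 0 \<omega>) - g i (past 0 \<omega>)\<bar> \<partial>M) \<longlonglongrightarrow> 0"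
  shows "(\<lambda>n. avg_error f n) \<longlonglongrightarrow> 0"
proof (rule LIMSEQ_I)
  fix r :: real assume r: "0 < r"
  then have "\<forall>\<^sub>F i in sequentially. (\<integral>\<omega>. \<bar>f (past 0 \<omega>) - g i (past 0 \<omega>)\<bar> \<partial>M) < r / 4"
    by (intro order_tendstoD(2)[OF lim]) simp
  then obtain i where i: "(\<integral>\<omega>. \<bar>f (past 0 \<omega>) - g i (past 0 \<omega>)\<bar> \<partial>M) < r / 4"
    by (meson eventually_happens' sequentially_bot)
  have "\<forall>\<^sub>F n in sequentially. avg_error (g i) n < r / 2"
    using r by (intro order_tendstoD(2)[OF conv]) simp
  then obtain N where N: "\<And>n. n \<ge> N \<Longrightarrow> avg_error (g i) n < r / 2" by (auto simp: eventually_sequentially)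
  have "norm (avg_error f n - 0) < r" if "n \<ge> max N 1" for n
    using avg_error_le[OF f g(1,2), of n i] N[of n] i that avg_error_nonneg[of f n] by simp
  then show "\<exists>no. \<forall>n\<ge>no. norm (avg_error f n - 0) < r" by blast
qed

lemma avg_error_add:
  assumes f: "f \<in> borel_measurable paths" "integrable M (\<lambda>\<omega>. f (past 0 \<omega>))"
    and g: "g \<in> borel_measurable paths" "integrable M (\<lambda>\<omega>. g (past 0 \<omega>))"
  shows "avg_error (\<lambda>x. f x + g x) n \<le> avg_error f n + avg_error g n"
proof -
  have If: "integrable M (\<lambda>\<omega>. f (past t \<omega>))" and Ig: "integrable M (\<lambda>\<omega>. g (past t \<omega>))" for t
    using f g integrable_past by blast+
  let ?F = "\<integral>\<omega>. f (past 0 \<omega>) \<partial>M" and ?G = "\<integral>\<omega>. g (past 0 \<omega>) \<partial>M"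
  let ?A = "\<lambda>f \<omega>. (\<Sum>t=1..n. f (past (int t) \<omega>)) / real n"
  have ii: "integrable M (\<lambda>\<omega>. \<bar>?A h \<omega> - e\<bar>)" if "\<And>t. integrable M (\<lambda>\<omega>. h (past t \<omega>))" for h e
    using that by (intro integrable_abs Bochner_Integration.integrable_diff
        Bochner_Integration.integrable_divide Bochner_Integration.integrable_sum integrable_const)
  note i = ii[OF If] ii[OF Ig]
  have FG: "(\<integral>\<omega>. f (past 0 \<omega>) + g (past 0 \<omega>) \<partial>M) = ?F + ?G"
    using f g by (intro Bochner_Integration.integral_add)
  have "avg_error (\<lambda>x. f x + g x) n \<le> (\<integral>\<omega>. \<bar>?A f \<omega> - ?F\<bar> + \<bar>?A g \<omega> - ?G\<bar> \<partial>M)"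
    unfolding avg_error_def FG
  proof (rule integral_mono)
    show "integrable M (\<lambda>\<omega>. \<bar>(\<Sum>t=1..n. f (past (int t) \<omega>) + g (past (int t) \<omega>)) / real n - (?F + ?G)\<bar>)"
      using If Ig by (intro integrable_abs Bochner_Integration.integrable_diff Bochner_Integration.integrable_add
        Bochner_Integration.integrable_divide Bochner_Integration.integrable_sum integrable_const)
    show "integrable M (\<lambda>\<omega>. \<bar>?A f \<omega> - ?F\<bar> + \<bar>?A g \<omega> - ?G\<bar>)" by (intro Bochner_Integration.integrable_add i)
    show "\<bar>(\<Sum>t=1..n. f (past (int t) \<omega>) + g (past (int t) \<omega>)) / real n - (?F + ?G)\<bar> \<le> \<bar>?A f \<omega> - ?F\<bar> + \<bar>?A g \<omega> - ?G\<bar>" for \<omega>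
      unfolding sum.distrib add_divide_distrib by linarith
  qed
  also have "\<dots> = avg_error f n + avg_error g n"
    unfolding avg_error_def using i by (rule Bochner_Integration.integral_add)
  finally show ?thesis .
qed

lemma avg_error_scale: "avg_error (\<lambda>x. c * f x) n = \<bar>c\<bar> * avg_error f n"
proof -
  have "\<bar>(\<Sum>t=1..n. c * f (past (int t) \<omega>)) / real n - c * E\<bar> = \<bar>c\<bar> * \<bar>(\<Sum>t=1..n. f (past (int t) \<omega>)) / real n - E\<bar>" for E \<omega>
    unfolding sum_distrib_left[symmetric] times_divide_eq_right[symmetric] right_diff_distrib[symmetric] abs_mult ..
  then show ?thesis unfolding avg_error_def by simp
qed

end

context iid_sequence
begin

text \<open>For functionals of finitely many innovations, terms at distant times are uncorrelated, so the
  second moment of the centred sum grows only linearly.\<close>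

lemma avg_error_local:
  fixes J :: "nat set"
  assumes J: "finite J" and F: "F \<in> borel_measurable (Pi\<^sub>M J (\<lambda>_. borel))"
    and bd: "\<And>x. \<bar>F x\<bar> \<le> (1::real)"
  shows "(\<lambda>n. avg_error (\<lambda>x. F (restrict x J)) n) \<longlonglongrightarrow> 0"
proof -
  define f where "f = (\<lambda>x::nat \<Rightarrow> real. F (restrict x J))"
  have rm: "(\<lambda>x. restrict x J) \<in> measurable paths (Pi\<^sub>M J (\<lambda>_. borel))"
    by (rule measurable_restrict_subset) simp
  have f: "f \<in> borel_measurable paths" unfolding f_def by (rule measurable_compose[OF rm F])
  define mu where "mu = (\<integral>\<omega>. f (past 0 \<omega>) \<partial>M)"
  define Y where "Y t \<omega> = f (past (int t) \<omega>) - mu" for t :: nat and \<omega>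
  have If: "integrable M (\<lambda>\<omega>. f (past t \<omega>))" for t
    by (rule integrable_const_bound[of _ 1]) (use bd measurable_past[OF f] in \<open>auto simp: f_def\<close>)
  have Ef: "(\<integral>\<omega>. f (past t \<omega>) \<partial>M) = mu" for t unfolding mu_def by (rule integral_past[OF f])
  have fb: "\<bar>f x\<bar> \<le> 1" for x unfolding f_def by (rule bd)
  have "\<bar>mu\<bar> \<le> (\<integral>\<omega>. \<bar>f (past 0 \<omega>)\<bar> \<partial>M)" unfolding mu_def by (rule integral_abs_bound)
  also have "\<dots> \<le> (\<integral>\<omega>. 1 \<partial>M)" by (intro integral_mono integrable_abs If integrable_const fb)
  finally have mub: "\<bar>mu\<bar> \<le> 1" by (simp add: prob_space)
  have Ym: "Y t \<in> borel_measurable M" for t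
    unfolding Y_def[abs_def] using measurable_past[OF f] by (intro borel_measurable_diff) simp_all
  have Yb: "\<bar>Y t \<omega>\<bar> \<le> 2" for t \<omega> using fb[of "past (int t) \<omega>"] mub by (simp add: Y_def)
  have YYb: "\<bar>Y t \<omega> * Y s \<omega>\<bar> \<le> 4" for t s \<omega>
  proof -
    have "\<bar>Y t \<omega>\<bar> * \<bar>Y s \<omega>\<bar> \<le> 2 * 2" by (intro mult_mono Yb) simp_all
    then show ?thesis by (simp add: abs_mult)
  qed
  have IYY: "integrable M (\<lambda>\<omega>. Y t \<omega> * Y s \<omega>)" for t s
    by (rule integrable_const_bound[of _ 4]) (use YYb in \<open>auto intro!: borel_measurable_times Ym\<close>)
  have IY: "integrable M (Y t)" for t
    by (rule integrable_const_bound[of _ 2]) (use Yb Ym in auto)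
  obtain N where N: "\<And>j. j \<in> J \<Longrightarrow> j < N" using J by (metis finite_nat_set_iff_bounded)
  have uncor: "(\<integral>\<omega>. Y t \<omega> * Y s \<omega> \<partial>M) = 0" if far: "N < \<bar>int t - int s\<bar>" for t s
  proof -
    let ?A = "\<lambda>t::nat. (\<lambda>j. int t - int j) ` J"
    let ?g = "\<lambda>(t::nat) e. F (\<lambda>j\<in>J. e (int t - int j)) - mu"
    have disj: "?A t \<inter> ?A s = {}"
    proof (rule ccontr)
      assume "?A t \<inter> ?A s \<noteq> {}"
      then obtain j j' where "j \<in> J" "j' \<in> J" "int t - int j = int s - int j'" by auto
      with N[of j] N[of j'] far show False by linarith
    qed
    have gm: "?g t \<in> borel_measurable (Pi\<^sub>M (?A t) (\<lambda>_. borel))" for t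
    proof -
      have "(\<lambda>e. \<lambda>j\<in>J. e (int t - int j)) \<in> measurable (Pi\<^sub>M (?A t) (\<lambda>_. borel)) (Pi\<^sub>M J (\<lambda>_. borel))"
        by (intro measurable_restrict measurable_component_singleton) auto
      from measurable_compose[OF this F] show ?thesis by (intro borel_measurable_diff borel_measurable_const) (simp add: comp_def)
    qed
    have "indep_var borel (\<lambda>\<omega>. ?g t (\<lambda>i\<in>?A t. \<epsilon> i \<omega>)) borel (\<lambda>\<omega>. ?g s (\<lambda>i\<in>?A s. \<epsilon> i \<omega>))"
      by (rule indep_var_disjoint_times[OF disj gm gm])
    moreover have "(\<lambda>\<omega>. ?g t (\<lambda>i\<in>?A t. \<epsilon> i \<omega>)) = Y t" for t
    proof
      fix \<omega>
      have "(\<lambda>j\<in>J. (\<lambda>i\<in>?A t. \<epsilon> i \<omega>) (int t - int j)) = restrict (past (int t) \<omega>) J"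
        by (auto simp: past_def restrict_def fun_eq_iff)
      then show "?g t (\<lambda>i\<in>?A t. \<epsilon> i \<omega>) = Y t \<omega>" by (simp add: Y_def f_def)
    qed
    ultimately have "indep_var borel (Y t) borel (Y s)" by simp
    then have "(\<integral>\<omega>. Y t \<omega> * Y s \<omega> \<partial>M) = (\<integral>\<omega>. Y t \<omega> \<partial>M) * (\<integral>\<omega>. Y s \<omega> \<partial>M)"
      by (intro indep_var_lebesgue_integral IY)
    moreover have "(\<integral>\<omega>. Y t \<omega> \<partial>M) = 0"
      unfolding Y_def using If Ef by (simp add: prob_space)
    ultimately show ?thesis by simp
  qed
  have second: "(\<integral>\<omega>. (\<Sum>t=1..n. Y t \<omega>)\<^sup>2 \<partial>M) \<le> real n * (4 * (2 * real N + 1))" for n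
  proof -
    have "(\<integral>\<omega>. (\<Sum>t=1..n. Y t \<omega>)\<^sup>2 \<partial>M) = (\<integral>\<omega>. (\<Sum>t=1..n. \<Sum>s=1..n. Y t \<omega> * Y s \<omega>) \<partial>M)"
      unfolding power2_eq_square sum_product ..
    also have "\<dots> = (\<Sum>t=1..n. \<Sum>s=1..n. (\<integral>\<omega>. Y t \<omega> * Y s \<omega> \<partial>M))"
      using IYY by (subst Bochner_Integration.integral_sum) (auto intro!: Bochner_Integration.integrable_sum sum.cong Bochner_Integration.integral_sum)
    also have "\<dots> \<le> (\<Sum>t=1..n. 4 * (2 * real N + 1))"
    proof (rule sum_mono)
      fix t assume "t \<in> {1..n}"
      define B where "B = {t - N..t + N}"
      have "(\<Sum>s=1..n. (\<integral>\<omega>. Y t \<omega> * Y s \<omega> \<partial>M)) \<le> (\<Sum>s=1..n. if s \<in> B then 4 else 0)"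
      proof (rule sum_mono)
        fix s assume "s \<in> {1..n}"
        show "(\<integral>\<omega>. Y t \<omega> * Y s \<omega> \<partial>M) \<le> (if s \<in> B then 4 else 0)"
        proof (cases "s \<in> B")
          case True
          have "(\<integral>\<omega>. Y t \<omega> * Y s \<omega> \<partial>M) \<le> (\<integral>\<omega>. 4 \<partial>M)"
            using YYb by (intro integral_mono IYY) (auto simp: abs_le_iff)
          then show ?thesis using True by (simp add: prob_space)
        next
          case False
          then have "N < \<bar>int t - int s\<bar>" by (auto simp: B_def)
          then show ?thesis using uncor False by simp
        qed
      qed
      also have "\<dots> = 4 * real (card ({1..n} \<inter> B))"
        by (simp flip: sum.inter_restrict)
      also have "\<dots> \<le> 4 * real (card B)"
        by (intro mult_left_mono of_nat_mono card_mono) (auto simp: B_def)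
      also have "\<dots> \<le> 4 * (2 * real N + 1)" by (intro mult_left_mono) (auto simp: B_def)
      finally show "(\<Sum>s=1..n. (\<integral>\<omega>. Y t \<omega> * Y s \<omega> \<partial>M)) \<le> 4 * (2 * real N + 1)" .
    qed
    also have "\<dots> = real n * (4 * (2 * real N + 1))" by simp
    finally show ?thesis .
  qed
  have bound: "avg_error f n \<le> (4 * (2 * real N + 1) + 1) * (1 / sqrt (real n))" if n: "1 \<le> n" for n
  proof -
    have sq: "0 < sqrt (real n)" using n by simp
    have e: "(\<Sum>t=1..n. f (past (int t) \<omega>)) / real n - mu = (\<Sum>t=1..n. Y t \<omega>) / real n" for \<omega>
      using n by (simp add: Y_def sum_subtractf diff_divide_distrib)
    \<comment> \<open>The first moment through the second, by the inequality \<open>2ab \<le> a\<^sup>2 + b\<^sup>2\<close>.\<close>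
    have pw: "\<bar>z\<bar> / real n \<le> (1 / (real n * sqrt (real n))) * z\<^sup>2 + 1 / sqrt (real n)" for z :: real
    proof -
      have "2 * (\<bar>z\<bar> * sqrt (real n)) \<le> z\<^sup>2 + real n"
        using sum_squares_bound[of "\<bar>z\<bar>" "sqrt (real n)"] by (simp add: mult.assoc)
      moreover have "0 \<le> \<bar>z\<bar> * sqrt (real n)" by simp
      ultimately have "\<bar>z\<bar> * sqrt (real n) \<le> z\<^sup>2 + real n" by linarith
      then have "\<bar>z\<bar> * sqrt (real n) / (real n * sqrt (real n)) \<le> (z\<^sup>2 + real n) / (real n * sqrt (real n))"
        using n by (intro divide_right_mono) simp_all
      then show ?thesis using n sq by (simp add: add_divide_distrib)
    qed
    have IS: "integrable M (\<lambda>\<omega>. (\<Sum>t=1..n. Y t \<omega>)\<^sup>2)"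
      unfolding power2_eq_square sum_product by (intro Bochner_Integration.integrable_sum IYY)
    have "avg_error f n = (\<integral>\<omega>. \<bar>\<Sum>t=1..n. Y t \<omega>\<bar> / real n \<partial>M)"
      unfolding avg_error_def mu_def[symmetric] e by simp
    also have "\<dots> \<le> (\<integral>\<omega>. (1 / (real n * sqrt (real n))) * (\<Sum>t=1..n. Y t \<omega>)\<^sup>2 + 1 / sqrt (real n) \<partial>M)"
      by (intro integral_mono pw Bochner_Integration.integrable_add Bochner_Integration.integrable_divide
          integrable_abs Bochner_Integration.integrable_sum IY integrable_mult_right IS integrable_const)
    also have "\<dots> = (1 / (real n * sqrt (real n))) * (\<integral>\<omega>. (\<Sum>t=1..n. Y t \<omega>)\<^sup>2 \<partial>M) + 1 / sqrt (real n)"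
      using IS by (subst Bochner_Integration.integral_add) (auto simp: prob_space)
    also have "\<dots> \<le> (1 / (real n * sqrt (real n))) * (real n * (4 * (2 * real N + 1))) + 1 / sqrt (real n)"
      using second[of n] by (intro add_right_mono mult_left_mono) simp_all
    also have "\<dots> = (4 * (2 * real N + 1) + 1) * (1 / sqrt (real n))"
      using n by (simp add: add_divide_distrib)
    finally show ?thesis .
  qed
  have "(\<lambda>n. (4 * (2 * real N + 1) + 1) * (1 / sqrt (real n))) \<longlonglongrightarrow> (4 * (2 * real N + 1) + 1) * 0"
    by (intro tendsto_mult_left tendsto_divide_0[OF tendsto_const] filterlim_at_top_imp_at_infinity
        filterlim_compose[OF sqrt_at_top filterlim_real_sequentially])
  then have "(\<lambda>n. (4 * (2 * real N + 1) + 1) * (1 / sqrt (real n))) \<longlonglongrightarrow> 0" by simp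
  moreover have "\<forall>\<^sub>F n in sequentially. norm (avg_error f n) \<le> (4 * (2 * real N + 1) + 1) * (1 / sqrt (real n))"
    using bound avg_error_nonneg[of f] by (intro eventually_sequentiallyI[of 1]) simp
  ultimately have "(\<lambda>n. avg_error f n) \<longlonglongrightarrow> 0" by (rule Lim_null_comparison[rotated])
  then show ?thesis by (simp add: f_def)
qed

lemma avg_error_const: "1 \<le> n \<Longrightarrow> avg_error (\<lambda>_. c) n = 0"
  unfolding avg_error_def by (simp add: prob_space)

lemma avg_error_tendsto_add:
  assumes f: "f \<in> borel_measurable paths" "integrable M (\<lambda>\<omega>. f (past 0 \<omega>))" "(\<lambda>n. avg_error f n) \<longlonglongrightarrow> 0"
    and g: "g \<in> borel_measurable paths" "integrable M (\<lambda>\<omega>. g (past 0 \<omega>))" "(\<lambda>n. avg_error g n) \<longlonglongrightarrow> 0"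
  shows "(\<lambda>n. avg_error (\<lambda>x. f x + g x) n) \<longlonglongrightarrow> 0"
proof (rule tendsto_sandwich[where f="\<lambda>_. 0" and h="\<lambda>n. avg_error f n + avg_error g n"])
  show "\<forall>\<^sub>F n in sequentially. avg_error (\<lambda>x. f x + g x) n \<le> avg_error f n + avg_error g n"
    by (intro always_eventually allI avg_error_add f g)
  show "(\<lambda>n. avg_error f n + avg_error g n) \<longlonglongrightarrow> 0" using tendsto_add[OF f(3) g(3)] by simp
  show "\<forall>\<^sub>F n in sequentially. 0 \<le> avg_error (\<lambda>x. f x + g x) n"
    by (intro always_eventually allI avg_error_nonneg)
qed (rule tendsto_const)

lemma integrable_indicator_past:
  "A \<in> sets paths \<Longrightarrow> integrable M (\<lambda>\<omega>. indicator A (past t \<omega>) :: real)"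
  by (rule integrable_const_bound[of _ 1])
    (auto intro!: measurable_past borel_measurable_indicator simp: indicator_def)

lemma avg_error_indicator:
  assumes "A \<in> sets paths"
  shows "(\<lambda>n. avg_error (indicator A) n) \<longlonglongrightarrow> 0"
proof -
  let ?G = "prod_algebra (UNIV :: nat set) (\<lambda>_. borel :: real measure)"
  have sp: "(\<Pi>\<^sub>E i\<in>(UNIV :: nat set). space (borel :: real measure)) = UNIV" by (auto simp: PiE_def extensional_def)
  have gen: "sets paths = sigma_sets UNIV ?G" unfolding sets_PiM sp ..
  have Ain: "A \<in> sigma_sets UNIV ?G" using assms unfolding gen .
  have closed: "?G \<subseteq> Pow UNIV" by simp
  from Int_stable_prod_algebra closed Ain show ?thesis
  proof (induction rule: sigma_sets_induct_disjoint)
    case (basic A)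
    from prod_algebraE[OF this] obtain J E where A: "A = prod_emb UNIV (\<lambda>_. borel) J (Pi\<^sub>E J E)"
      and J: "finite J" and E: "\<And>i. i \<in> J \<Longrightarrow> E i \<in> sets borel" by metis
    have "(\<lambda>n. avg_error (\<lambda>x. indicator (Pi\<^sub>E J E) (restrict x J)) n) \<longlonglongrightarrow> 0"
      using E J by (intro avg_error_local borel_measurable_indicator sets_PiM_I_finite) (auto simp: indicator_def)
    moreover have "(\<lambda>x. indicator (Pi\<^sub>E J E) (restrict x J)) = (indicator A :: (nat \<Rightarrow> real) \<Rightarrow> real)"
      unfolding A by (auto simp: indicator_def prod_emb_def fun_eq_iff)
    ultimately show ?case by simp
  next
    case empty
    have "(\<lambda>n. 0 :: real) \<longlonglongrightarrow> 0" by simp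
    moreover have "\<forall>\<^sub>F n in sequentially. avg_error (\<lambda>_. 0) n = 0"
      using avg_error_const by (intro eventually_sequentiallyI[of 1]) simp
    ultimately show ?case by (simp add: tendsto_cong)
  next
    case (compl A)
    have A: "A \<in> sets paths" using compl(1) unfolding gen .
    have c: "(\<lambda>n. avg_error (\<lambda>_. 1) n) \<longlonglongrightarrow> 0"
      using avg_error_const by (intro tendsto_eventually eventually_sequentiallyI[of 1]) simp
    have "(\<lambda>n. avg_error (\<lambda>x. - 1 * indicator A x) n) \<longlonglongrightarrow> 0"
      unfolding avg_error_scale using compl(2) by simp
    then have "(\<lambda>n. avg_error (\<lambda>x. 1 + - 1 * indicator A x) n) \<longlonglongrightarrow> 0"
      using A by (intro avg_error_tendsto_add c) (auto intro!: integrable_indicator_past)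
    moreover have "(\<lambda>x. 1 + - 1 * indicator A x) = (indicator (UNIV - A) :: (nat \<Rightarrow> real) \<Rightarrow> real)"
      by (auto simp: indicator_def fun_eq_iff)
    ultimately show ?case by simp
  next
    case (union A)
    have A: "A i \<in> sets paths" for i using union(2) unfolding gen by blast
    have U: "(\<Union>i<k. A i) \<in> sets paths" "(\<Union>i. A i) \<in> sets paths" for k :: nat using A by auto
    have fin: "(\<lambda>n. avg_error (indicator (\<Union>i<k. A i)) n) \<longlonglongrightarrow> 0" for k :: nat
    proof (induction k)
      case 0
      have "(\<lambda>n. avg_error (\<lambda>_. 0) n) \<longlonglongrightarrow> 0"
        using avg_error_const by (intro tendsto_eventually eventually_sequentiallyI[of 1]) simp
      then show ?case by simp
    next
      case (Suc k)
      have "(indicator (\<Union>i<Suc k. A i) :: (nat \<Rightarrow> real) \<Rightarrow> real) = (\<lambda>x. indicator (\<Union>i<k. A i) x + indicator (A k) x)"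
      proof
        fix x
        show "(indicator (\<Union>i<Suc k. A i) x :: real) = indicator (\<Union>i<k. A i) x + indicator (A k) x"
        proof (cases "x \<in> A k")
          case True
          moreover have "A i \<inter> A k = {}" if "i < k" for i
            using union(1) that by (intro disjoint_family_onD) auto
          ultimately have "x \<notin> A i" if "i < k" for i using that by blast
          then show ?thesis using True by (auto simp: indicator_def lessThan_Suc)
        qed (auto simp: indicator_def lessThan_Suc)
      qed
      then show ?case
        using Suc union(3)[of k] A U by (auto intro!: avg_error_tendsto_add integrable_indicator_past)
    qed
    have "(\<lambda>k. \<integral>\<omega>. \<bar>indicator (\<Union>i. A i) (past 0 \<omega>) - indicator (\<Union>i<k. A i) (past 0 \<omega>)\<bar> \<partial>M)
        \<longlonglongrightarrow> (\<integral>\<omega>. 0 \<partial>M :: real)"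
    proof (rule integral_dominated_convergence[where w="\<lambda>_. 1"])
      show "(\<lambda>\<omega>. \<bar>indicator (\<Union>i. A i) (past 0 \<omega>) - indicator (\<Union>i<k. A i) (past 0 \<omega>)\<bar> :: real) \<in> borel_measurable M" for k
        by (intro borel_measurable_abs borel_measurable_diff measurable_past borel_measurable_indicator U)
      show "AE \<omega> in M. (\<lambda>k. \<bar>indicator (\<Union>i. A i) (past 0 \<omega>) - indicator (\<Union>i<k. A i) (past 0 \<omega>)\<bar>) \<longlonglongrightarrow> (0 :: real)"
      proof (rule AE_I2)
        fix \<omega>
        have "(\<lambda>k. \<bar>indicator (\<Union>i. A i) (past 0 \<omega>) - indicator (\<Union>i<k. A i) (past 0 \<omega>)\<bar>) \<longlonglongrightarrow>
            \<bar>indicator (\<Union>i. A i) (past 0 \<omega>) - indicator (\<Union>i. A i) (past 0 \<omega>) :: real\<bar>"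
          by (intro tendsto_rabs tendsto_diff tendsto_const LIMSEQ_indicator_UN)
        then show "(\<lambda>k. \<bar>indicator (\<Union>i. A i) (past 0 \<omega>) - indicator (\<Union>i<k. A i) (past 0 \<omega>)\<bar>) \<longlonglongrightarrow> (0 :: real)"
          by simp
      qed
      show "AE \<omega> in M. norm \<bar>indicator (\<Union>i. A i) (past 0 \<omega>) - indicator (\<Union>i<k. A i) (past 0 \<omega>) :: real\<bar> \<le> 1" for k
        by (rule AE_I2) (simp add: indicator_def)
    qed simp_all
    then show ?case
      by (intro avg_error_tendsto_limit[OF borel_measurable_indicator[OF U(2)] integrable_indicator_past[OF U(2)]
            borel_measurable_indicator[OF U(1)] integrable_indicator_past[OF U(1)] fin]) simp
  qed
qed

text \<open>The mean ergodic theorem for functionals of an i.i.d. sequence: the class of functionals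
  whose averages converge in mean contains the cylinder sets, and it is closed under all operations
  that build integrable functions from them.\<close>

theorem mean_ergodic:
  assumes f: "f \<in> borel_measurable paths" and int: "integrable M (\<lambda>\<omega>. f (past 0 \<omega>))"
  shows "(\<lambda>n. avg_error f n) \<longlonglongrightarrow> 0"
proof -
  let ?P = "distr M paths (past 0)"
  have P: "integrable ?P h \<longleftrightarrow> integrable M (\<lambda>\<omega>. h (past 0 \<omega>))" if "h \<in> borel_measurable paths" for h :: "_ \<Rightarrow> real"
    by (rule integrable_distr_eq[OF past_measurable that])
  have m: "h \<in> borel_measurable paths" if "integrable ?P h" for h :: "_ \<Rightarrow> real"
    using borel_measurable_integrable[OF that] by simp
  have "integrable ?P f" using P[OF f] int by simp
  then show ?thesis
  proof (induction rule: integrable_induct)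
    case (base A c)
    have "(\<lambda>n. avg_error (\<lambda>x. c * indicator A x) n) \<longlonglongrightarrow> 0"
      unfolding avg_error_scale using tendsto_mult_right_zero[OF avg_error_indicator[of A]] base by simp
    then show ?case by (simp add: mult.commute)
  next
    case (add f g)
    then show ?case using m P by (intro avg_error_tendsto_add) blast+
  next
    case (lim f s)
    have fm: "f \<in> borel_measurable paths" and sm: "\<And>i. s i \<in> borel_measurable paths" using lim m by blast+
    have fi: "integrable M (\<lambda>\<omega>. f (past 0 \<omega>))" and si: "\<And>i. integrable M (\<lambda>\<omega>. s i (past 0 \<omega>))"
      using lim m P by blast+
    have lc: "(\<lambda>i. s i x) \<longlonglongrightarrow> f x" and lb: "norm (s i x) \<le> 2 * norm (f x)" for x i
      using lim by (simp_all add: space_PiM)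
    have lp: "(\<lambda>n. avg_error (s i) n) \<longlonglongrightarrow> 0" for i using lim by blast
    have "(\<lambda>i. \<integral>\<omega>. \<bar>f (past 0 \<omega>) - s i (past 0 \<omega>)\<bar> \<partial>M) \<longlonglongrightarrow> (\<integral>\<omega>. 0 \<partial>M)"
    proof (rule integral_dominated_convergence[where w="\<lambda>\<omega>. 3 * \<bar>f (past 0 \<omega>)\<bar>"])
      show "(\<lambda>\<omega>. \<bar>f (past 0 \<omega>) - s i (past 0 \<omega>)\<bar>) \<in> borel_measurable M" for i
        by (intro borel_measurable_abs borel_measurable_diff measurable_past fm sm)
      show "integrable M (\<lambda>\<omega>. 3 * \<bar>f (past 0 \<omega>)\<bar>)" using fi by (intro integrable_mult_right integrable_abs)
      show "AE \<omega> in M. (\<lambda>i. \<bar>f (past 0 \<omega>) - s i (past 0 \<omega>)\<bar>) \<longlonglongrightarrow> 0"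
      proof (rule AE_I2)
        fix \<omega>
        have "(\<lambda>i. s i (past 0 \<omega>)) \<longlonglongrightarrow> f (past 0 \<omega>)" by (rule lc)
        then have "(\<lambda>i. \<bar>f (past 0 \<omega>) - s i (past 0 \<omega>)\<bar>) \<longlonglongrightarrow> \<bar>f (past 0 \<omega>) - f (past 0 \<omega>)\<bar>"
          by (intro tendsto_rabs tendsto_diff tendsto_const)
        then show "(\<lambda>i. \<bar>f (past 0 \<omega>) - s i (past 0 \<omega>)\<bar>) \<longlonglongrightarrow> 0" by simp
      qed
      show "AE \<omega> in M. norm \<bar>f (past 0 \<omega>) - s i (past 0 \<omega>)\<bar> \<le> 3 * \<bar>f (past 0 \<omega>)\<bar>" for i
      proof (rule AE_I2)
        fix \<omega>
        have "norm (s i (past 0 \<omega>)) \<le> 2 * norm (f (past 0 \<omega>))" by (rule lb)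
        then show "norm \<bar>f (past 0 \<omega>) - s i (past 0 \<omega>)\<bar> \<le> 3 * \<bar>f (past 0 \<omega>)\<bar>" by simp
      qed
    qed simp
    then show ?case by (intro avg_error_tendsto_limit[OF fm fi sm si lp]) simp
  qed
qed

end

section \<open>A fractional moment from a negative Lyapunov exponent\<close>

lemma powr_le_weighted_mean:
  fixes x d :: real
  assumes "0 \<le> x" "0 < d" "d \<le> 1"
  shows "x powr d \<le> 1 + d * (x - 1)"
proof (cases "x = 0")
  case False
  define y where "y = d * ln x"
  have x: "0 < x" using assms False by simp
  have "1 + (ln x - y) \<le> exp (ln x - y)" "1 + (- y) \<le> exp (- y)" by (rule exp_ge_add_one_self)+
  then have "d * (1 + (ln x - y)) + (1 - d) * (1 + (- y)) \<le> d * exp (ln x - y) + (1 - d) * exp (- y)"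
    using assms by (intro add_mono mult_left_mono) simp_all
  also have "d * (1 + (ln x - y)) + (1 - d) * (1 + (- y)) = 1" by (simp add: y_def algebra_simps)
  finally have "exp y * 1 \<le> exp y * (d * exp (ln x - y) + (1 - d) * exp (- y))" by (intro mult_left_mono) simp_all
  also have "\<dots> = d * x + (1 - d)" using x by (simp add: exp_diff exp_minus field_simps)
  finally show ?thesis using x by (simp add: powr_def y_def algebra_simps)
qed (use assms in simp)

lemma powr_sub_one_div_le:
  fixes x d :: real
  assumes "0 \<le> x" "0 < d" "d \<le> 1"
  shows "(x powr d - 1) / d \<le> x - 1"
proof -
  have "x powr d - 1 \<le> d * (x - 1)" using powr_le_weighted_mean[OF assms] by linarith
  then show ?thesis using assms by (simp add: pos_divide_le_eq mult.commute)
qed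

text \<open>The quotient \<open>(x\<^sup>d - 1) / d\<close> decreases to \<open>ln x\<close> as \<open>d\<close> tends to \<open>0\<close>.\<close>

lemma liminf_powr_excess:
  fixes x :: real
  assumes "0 \<le> x"
  shows "ennreal x + e2ennreal (- log_ereal x)
     \<le> liminf (\<lambda>m. ennreal (x - 1 - (x powr (1 / real (Suc m)) - 1) / (1 / real (Suc m)))) + e2ennreal (log_ereal x) + 1"
proof (cases "x = 0")
  case True
  have "(\<lambda>m. ennreal (real m)) \<longlonglongrightarrow> \<infinity>"
    using of_nat_tendsto_top_ennreal by (simp add: ennreal_of_nat_eq_real_of_nat infinity_ennreal_def)
  then have "liminf (\<lambda>m. ennreal (real m)) = \<infinity>" by (intro lim_imp_Liminf) simp_all
  then show ?thesis using True by (simp add: log_ereal_def)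
next
  case False
  with assms have x: "0 < x" by simp
  define l where "l = ln x"
  have lim: "(\<lambda>m. ennreal (x - 1 - l * x powr (1 / real (Suc m)))) \<longlonglongrightarrow> ennreal (x - 1 - l * x powr 0)"
    using x by (intro tendsto_ennrealI tendsto_diff tendsto_mult tendsto_powr tendsto_const LIMSEQ_Suc[OF lim_1_over_n]) simp
  have "ennreal (x - 1 - l) = liminf (\<lambda>m. ennreal (x - 1 - l * x powr (1 / real (Suc m))))"
    using lim_imp_Liminf[OF _ lim] x by simp
  also have "\<dots> \<le> liminf (\<lambda>m. ennreal (x - 1 - (x powr (1 / real (Suc m)) - 1) / (1 / real (Suc m))))"
  proof (intro Liminf_mono always_eventually allI ennreal_leI)
    fix m
    define d where "d = 1 / real (Suc m)"
    have d: "0 < d" by (simp add: d_def)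
    have xd: "x powr d = exp (d * l)" using x by (simp add: powr_def l_def)
    have "1 + (- (d * l)) \<le> exp (- (d * l))" by (rule exp_ge_add_one_self)
    then have "exp (d * l) * (1 + (- (d * l))) \<le> exp (d * l) * exp (- (d * l))" by (intro mult_left_mono) simp_all
    also have "\<dots> = 1" by (simp flip: exp_add)
    finally have "exp (d * l) - 1 \<le> l * exp (d * l) * d" by (simp add: algebra_simps)
    then have "(x powr d - 1) / d \<le> l * x powr d" unfolding xd using d by (simp add: pos_divide_le_eq)
    then show "x - 1 - l * x powr (1 / real (Suc m)) \<le> x - 1 - (x powr (1 / real (Suc m)) - 1) / (1 / real (Suc m))"
      unfolding d_def by linarith
  qed
  finally have le: "ennreal (x - 1 - l) \<le> liminf (\<lambda>m. ennreal (x - 1 - (x powr (1 / real (Suc m)) - 1) / (1 / real (Suc m))))" .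
  have "l \<le> x - 1" unfolding l_def using x by (rule ln_le_minus_one)
  then have "ennreal x + ennreal (- l) = ennreal (x - 1 - l) + ennreal l + 1"
    using x by (cases "0 \<le> l") (simp_all add: ennreal_neg flip: ennreal_plus ennreal_1)
  also have "\<dots> \<le> liminf (\<lambda>m. ennreal (x - 1 - (x powr (1 / real (Suc m)) - 1) / (1 / real (Suc m)))) + ennreal l + 1"
    by (intro add_mono le order_refl)
  finally show ?thesis using x by (simp add: log_ereal_def l_def)
qed

context prob_space
begin

lemma integrable_powr_of_integrable:
  fixes P :: "'a \<Rightarrow> real"
  assumes "integrable M P" "\<And>\<omega>. 0 \<le> P \<omega>" "0 < d" "d \<le> 1"
  shows "integrable M (\<lambda>\<omega>. P \<omega> powr d)"
proof (rule Bochner_Integration.integrable_bound)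
  show "integrable M (\<lambda>\<omega>. 1 + d * (P \<omega> - 1))"
    using assms by (intro Bochner_Integration.integrable_add integrable_mult_right Bochner_Integration.integrable_diff integrable_const)
  show "(\<lambda>\<omega>. P \<omega> powr d) \<in> borel_measurable M"
    using borel_measurable_integrable[OF assms(1)] by measurable
  show "AE \<omega> in M. norm (P \<omega> powr d) \<le> norm (1 + d * (P \<omega> - 1))"
    using order_trans[OF powr_le_weighted_mean[OF assms(2,3,4)] abs_ge_self] by (intro AE_I2) simp
qed

text \<open>If the mean logarithm of \<open>P\<close> is negative then some fractional moment of \<open>P\<close> is below
  \<open>1\<close>: the derivative of \<open>d \<mapsto> E P\<^sup>d\<close> at \<open>0\<close> is that mean. The case \<open>- \<infinity>\<close> is included, which is why
  Fatou's lemma is used instead of a differentiation under the integral.\<close>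

lemma fractional_moment_contraction:
  fixes P :: "'a \<Rightarrow> real"
  assumes P: "integrable M P" "\<And>\<omega>. 0 \<le> P \<omega>"
    and neg: "ereal_expectation M (\<lambda>\<omega>. log_ereal (P \<omega>)) < 0"
  obtains d where "0 < d" "d \<le> 1" "(\<integral>\<omega>. P \<omega> powr d \<partial>M) < 1"
proof (rule ccontr)
  assume "\<not> thesis"
  then have ge: "1 \<le> (\<integral>\<omega>. P \<omega> powr d \<partial>M)" if "0 < d" "d \<le> 1" for d
    using that \<open>\<And>d. 0 < d \<Longrightarrow> d \<le> 1 \<Longrightarrow> (\<integral>\<omega>. P \<omega> powr d \<partial>M) < 1 \<Longrightarrow> thesis\<close> by (meson not_le)
  have Pm: "P \<in> borel_measurable M" using P(1) by (rule borel_measurable_integrable)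
  define D where "D m = 1 / real (Suc m)" for m
  have D: "0 < D m" "D m \<le> 1" for m by (auto simp: D_def)
  \<comment> \<open>Nonnegative, so that Fatou's lemma applies; if no fractional moment were below \<open>1\<close>, the means of
    all \<open>F m\<close> would be at most \<open>E P - 1\<close>.\<close>
  define F where "F m \<omega> = P \<omega> - 1 - (P \<omega> powr D m - 1) / D m" for m \<omega>
  have Fnn: "0 \<le> F m \<omega>" for m \<omega> using powr_sub_one_div_le[OF P(2) D, of \<omega> m] by (simp add: F_def)
  have Fm: "F m \<in> borel_measurable M" for m unfolding F_def[abs_def] using Pm by measurable
  define a where "a = (\<integral>\<^sup>+\<omega>. e2ennreal (log_ereal (P \<omega>)) \<partial>M)"
  define b where "b = (\<integral>\<^sup>+\<omega>. e2ennreal (- log_ereal (P \<omega>)) \<partial>M)"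
  have logm: "(\<lambda>\<omega>. log_ereal (P \<omega>)) \<in> borel_measurable M"
    unfolding log_ereal_def using Pm by measurable
  have EP: "(\<integral>\<^sup>+\<omega>. ennreal (P \<omega>) \<partial>M) = ennreal (\<integral>\<omega>. P \<omega> \<partial>M)"
    using P by (intro nn_integral_eq_integral) simp_all
  have Fint: "(\<integral>\<^sup>+\<omega>. ennreal (F m \<omega>) \<partial>M) \<le> ennreal ((\<integral>\<omega>. P \<omega> \<partial>M) - 1)" for m
  proof -
    have IP: "integrable M (\<lambda>\<omega>. P \<omega> powr D m)" by (rule integrable_powr_of_integrable[OF P D])
    have IF: "integrable M (F m)" unfolding F_def[abs_def] using P(1) IP
      by (intro Bochner_Integration.integrable_diff Bochner_Integration.integrable_divide integrable_const)
    have "(\<integral>\<omega>. F m \<omega> \<partial>M) = (\<integral>\<omega>. P \<omega> \<partial>M) - 1 - ((\<integral>\<omega>. P \<omega> powr D m \<partial>M) - 1) / D m"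
      unfolding F_def[abs_def] using P(1) IP by (simp add: prob_space)
    also have "\<dots> \<le> (\<integral>\<omega>. P \<omega> \<partial>M) - 1" using ge[OF D, of m] D[of m] by simp
    finally show ?thesis using nn_integral_eq_integral[OF IF] Fnn by (simp add: ennreal_leI)
  qed
  have EP1: "1 \<le> (\<integral>\<omega>. P \<omega> \<partial>M)" using ge[of 1] P by simp
  have "(\<integral>\<^sup>+\<omega>. ennreal (P \<omega>) \<partial>M) + b
      \<le> (\<integral>\<^sup>+\<omega>. liminf (\<lambda>m. ennreal (F m \<omega>)) + e2ennreal (log_ereal (P \<omega>)) + 1 \<partial>M)"
  proof -
    have "(\<integral>\<^sup>+\<omega>. ennreal (P \<omega>) \<partial>M) + b = (\<integral>\<^sup>+\<omega>. ennreal (P \<omega>) + e2ennreal (- log_ereal (P \<omega>)) \<partial>M)"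
      unfolding b_def using Pm logm by (intro nn_integral_add[symmetric]) simp_all
    also have "\<dots> \<le> (\<integral>\<^sup>+\<omega>. liminf (\<lambda>m. ennreal (F m \<omega>)) + e2ennreal (log_ereal (P \<omega>)) + 1 \<partial>M)"
      unfolding F_def D_def by (intro nn_integral_mono liminf_powr_excess P(2))
    finally show ?thesis .
  qed
  also have "\<dots> = (\<integral>\<^sup>+\<omega>. liminf (\<lambda>m. ennreal (F m \<omega>)) \<partial>M) + a + 1"
    unfolding a_def using Fm logm by (subst nn_integral_add, (simp; fail), (simp; fail), subst nn_integral_add) (simp_all add: emeasure_space_1)
  also have "\<dots> \<le> liminf (\<lambda>m. \<integral>\<^sup>+\<omega>. ennreal (F m \<omega>) \<partial>M) + a + 1"
    using Fm by (intro add_mono order_refl nn_integral_liminf) simp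
  also have "\<dots> \<le> ennreal ((\<integral>\<omega>. P \<omega> \<partial>M) - 1) + a + 1"
  proof (intro add_mono order_refl)
    have "liminf (\<lambda>m. \<integral>\<^sup>+\<omega>. ennreal (F m \<omega>) \<partial>M) \<le> limsup (\<lambda>m. \<integral>\<^sup>+\<omega>. ennreal (F m \<omega>) \<partial>M)"
      by (rule Liminf_le_Limsup) simp
    also have "\<dots> \<le> ennreal ((\<integral>\<omega>. P \<omega> \<partial>M) - 1)"
      by (intro Limsup_bounded always_eventually allI Fint)
    finally show "liminf (\<lambda>m. \<integral>\<^sup>+\<omega>. ennreal (F m \<omega>) \<partial>M) \<le> ennreal ((\<integral>\<omega>. P \<omega> \<partial>M) - 1)" .
  qed
  also have "\<dots> = ennreal (\<integral>\<omega>. P \<omega> \<partial>M) + a"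
  proof -
    have "ennreal ((\<integral>\<omega>. P \<omega> \<partial>M) - 1) + 1 = ennreal (\<integral>\<omega>. P \<omega> \<partial>M)"
      using EP1 by (simp flip: ennreal_plus ennreal_1)
    then show ?thesis by (metis add.assoc add.commute)
  qed
  finally have ba: "b \<le> a" unfolding EP by (simp add: ennreal_add_left_cancel_le)
  have "a \<le> (\<integral>\<^sup>+\<omega>. ennreal (P \<omega>) \<partial>M)"
    unfolding a_def
  proof (rule nn_integral_mono)
    fix \<omega>
    show "e2ennreal (log_ereal (P \<omega>)) \<le> ennreal (P \<omega>)"
      using ln_le_minus_one[of "P \<omega>"] by (auto simp: log_ereal_def e2ennreal_neg ennreal_leI not_le)
  qed
  then have "a < \<infinity>" unfolding EP by (simp add: le_less_trans)
  moreover from this ba have "b < \<infinity>" by (rule le_less_trans[rotated])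
  ultimately obtain ra rb where "a = ennreal ra" "0 \<le> ra" "b = ennreal rb" "0 \<le> rb"
    by (metis ennreal_cases infinity_ennreal_def less_irrefl)
  then have "0 \<le> enn2ereal a - enn2ereal b" using ba by simp
  then show False using neg unfolding ereal_expectation_def a_def[symmetric] b_def[symmetric]
    by (simp add: not_less[symmetric])
qed

text \<open>A stationary nonnegative sequence that is dominated by an affine recursion with a
  contracting independent factor has a finite mean. Iterating \<open>E min (U, L)\<close> shows it, without
  assuming the mean finite beforehand, because after \<open>i\<close> steps with contraction
  rate \<open>c\<close> the unknown mean enters only through \<open>E min (c\<^sup>i U, L)\<close>, which tends to \<open>0\<close>.\<close>

lemma integrable_of_stochastic_recursion:
  fixes U V \<xi> s :: "'a \<Rightarrow> real"
  assumes U: "U \<in> borel_measurable M" "\<And>\<omega>. 0 \<le> U \<omega>"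
    and V: "V \<in> borel_measurable M" "\<And>\<omega>. 0 \<le> V \<omega>" and law: "distr M borel U = distr M borel V"
    and \<xi>: "integrable M \<xi>" "\<And>\<omega>. 0 \<le> \<xi> \<omega>" "(\<integral>\<omega>. \<xi> \<omega> \<partial>M) < 1" and ind: "indep_var borel \<xi> borel V"
    and s: "integrable M s" "\<And>\<omega>. 0 \<le> s \<omega>"
    and rec: "AE \<omega> in M. U \<omega> \<le> \<xi> \<omega> * V \<omega> + s \<omega>"
  shows "integrable M U"
proof -
  \<comment> \<open>The lower bound \<open>1/2\<close> only ensures that \<open>c\<close> can be divided by.\<close>
  define c where "c = max (\<integral>\<omega>. \<xi> \<omega> \<partial>M) (1 / 2)"
  have c: "0 < c" "c < 1" "(\<integral>\<omega>. \<xi> \<omega> \<partial>M) \<le> c" using \<xi>(3) by (auto simp: c_def)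
  define sb where "sb = (\<integral>\<omega>. s \<omega> \<partial>M)"
  have sb: "0 \<le> sb" using s by (simp add: sb_def)
  define phi where "phi L = (\<integral>\<omega>. min (U \<omega>) L \<partial>M)" for L
  have minm: "(\<lambda>x. min (a * x) L) \<in> borel_measurable borel" for a L :: real by measurable
  have Imin: "integrable M (\<lambda>\<omega>. min (a * W \<omega>) L)"
    if "W \<in> borel_measurable M" "\<And>\<omega>. 0 \<le> W \<omega>" "0 \<le> a" "0 \<le> L" for W :: "'a \<Rightarrow> real" and a L :: real
    by (rule integrable_const_bound[of _ L]) (use that in auto)
  have scale: "(\<integral>\<omega>. min (a * U \<omega>) L \<partial>M) = a * phi (L / a)" if "0 < a" for a L
  proof -
    have "min (a * U \<omega>) L = a * min (U \<omega>) (L / a)" for \<omega> using that by (simp add: min_mult_distrib_left)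
    then show ?thesis by (simp add: phi_def)
  qed
  have UV: "(\<integral>\<omega>. min (a * V \<omega>) L \<partial>M) = (\<integral>\<omega>. min (a * U \<omega>) L \<partial>M)" for a L
    using integral_distr[OF V(1) minm] integral_distr[OF U(1) minm] law by metis
  have \<xi>m: "\<xi> \<in> borel_measurable M" using \<xi>(1) by (rule borel_measurable_integrable)
  \<comment> \<open>Jensen's inequality for the concave function \<open>x \<mapsto> min (x v) L\<close>, with \<open>V\<close> held fixed.\<close>
  have contr: "(\<integral>\<omega>. min (\<xi> \<omega> * V \<omega>) L \<partial>M) \<le> (\<integral>\<omega>. min (c * V \<omega>) L \<partial>M)" if L: "0 \<le> L" for L
  proof -
    interpret X: prob_space "distr M borel \<xi>" by (rule prob_space_distr[OF \<xi>m])
    interpret Y: prob_space "distr M borel V" by (rule prob_space_distr[OF V(1)])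
    interpret XY: pair_prob_space "distr M borel \<xi>" "distr M borel V" ..
    have joint: "distr M (borel \<Otimes>\<^sub>M borel) (\<lambda>\<omega>. (\<xi> \<omega>, V \<omega>)) = distr M borel \<xi> \<Otimes>\<^sub>M distr M borel V"
      using ind by (simp add: indep_var_distribution_eq)
    have hm: "(\<lambda>(x, v). ennreal (min (x * v) L)) \<in> borel_measurable (borel \<Otimes>\<^sub>M borel)" by measurable
    have "(\<integral>\<^sup>+\<omega>. ennreal (min (\<xi> \<omega> * V \<omega>) L) \<partial>M)
        = (\<integral>\<^sup>+z. (\<lambda>(x, v). ennreal (min (x * v) L)) z \<partial>distr M (borel \<Otimes>\<^sub>M borel) (\<lambda>\<omega>. (\<xi> \<omega>, V \<omega>)))"
      using V(1) \<xi>m by (subst nn_integral_distr) simp_all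
    also have "\<dots> = (\<integral>\<^sup>+v. \<integral>\<^sup>+x. ennreal (min (x * v) L) \<partial>distr M borel \<xi> \<partial>distr M borel V)"
      unfolding joint by (subst XY.nn_integral_snd[symmetric]) simp_all
    also have "\<dots> \<le> (\<integral>\<^sup>+v. ennreal (min (c * v) L) \<partial>distr M borel V)"
    proof (rule nn_integral_mono_AE)
      have "(\<integral>\<^sup>+x. ennreal (min (x * v) L) \<partial>distr M borel \<xi>) \<le> ennreal (min (c * v) L)" if v: "0 \<le> v" for v
      proof -
        have "(\<integral>\<^sup>+x. ennreal (min (x * v) L) \<partial>distr M borel \<xi>) = (\<integral>\<^sup>+\<omega>. ennreal (min (v * \<xi> \<omega>) L) \<partial>M)"
          using \<xi>m by (subst nn_integral_distr) (simp_all add: mult.commute)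
        also have "\<dots> = ennreal (\<integral>\<omega>. min (v * \<xi> \<omega>) L \<partial>M)"
          using v L \<xi>(2) by (intro nn_integral_eq_integral Imin \<xi>m) simp_all
        also have "\<dots> \<le> ennreal (min (c * v) L)"
        proof (intro ennreal_leI min.boundedI)
          have "(\<integral>\<omega>. min (v * \<xi> \<omega>) L \<partial>M) \<le> (\<integral>\<omega>. v * \<xi> \<omega> \<partial>M)"
            using v L \<xi> by (intro integral_mono Imin \<xi>m integrable_mult_right) simp_all
          also have "\<dots> = (\<integral>\<omega>. \<xi> \<omega> \<partial>M) * v" by simp
          also have "\<dots> \<le> c * v" using c v by (intro mult_right_mono)
          finally show "(\<integral>\<omega>. min (v * \<xi> \<omega>) L \<partial>M) \<le> c * v" .
          have "(\<integral>\<omega>. min (v * \<xi> \<omega>) L \<partial>M) \<le> (\<integral>\<omega>. L \<partial>M)"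
            using v L \<xi>(2) by (intro integral_mono Imin \<xi>m) simp_all
          then show "(\<integral>\<omega>. min (v * \<xi> \<omega>) L \<partial>M) \<le> L" by (simp add: prob_space)
        qed
        finally show ?thesis .
      qed
      then show "AE v in distr M borel V. (\<integral>\<^sup>+x. ennreal (min (x * v) L) \<partial>distr M borel \<xi>) \<le> ennreal (min (c * v) L)"
        using V by (subst AE_distr_iff) (auto intro!: AE_I2)
    qed
    also have "\<dots> = (\<integral>\<^sup>+\<omega>. ennreal (min (c * V \<omega>) L) \<partial>M)"
      using V(1) by (subst nn_integral_distr) simp_all
    finally have "(\<integral>\<^sup>+\<omega>. ennreal (min (\<xi> \<omega> * V \<omega>) L) \<partial>M) \<le> (\<integral>\<^sup>+\<omega>. ennreal (min (c * V \<omega>) L) \<partial>M)" .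
    moreover have "(\<integral>\<^sup>+\<omega>. ennreal (min (c * V \<omega>) L) \<partial>M) = ennreal (\<integral>\<omega>. min (c * V \<omega>) L \<partial>M)"
      using V L c by (intro nn_integral_eq_integral Imin) simp_all
    moreover have "(\<integral>\<^sup>+\<omega>. ennreal (min (\<xi> \<omega> * V \<omega>) L) \<partial>M) = ennreal (\<integral>\<omega>. min (\<xi> \<omega> * V \<omega>) L \<partial>M)"
      using V \<xi> \<xi>m L Imin[of "\<lambda>\<omega>. \<xi> \<omega> * V \<omega>" 1 L] by (intro nn_integral_eq_integral) simp_all
    moreover have "0 \<le> (\<integral>\<omega>. min (c * V \<omega>) L \<partial>M)"
      using V L c by (intro Bochner_Integration.integral_nonneg) simp
    ultimately show ?thesis by (simp add: ennreal_le_iff)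
  qed
  have step: "phi L \<le> sb + c * phi (L / c)" if L: "0 \<le> L" for L
  proof -
    have IV: "integrable M (\<lambda>\<omega>. min (\<xi> \<omega> * V \<omega>) L)"
      using V \<xi> \<xi>m L Imin[of "\<lambda>\<omega>. \<xi> \<omega> * V \<omega>" 1 L] by simp
    have "phi L \<le> (\<integral>\<omega>. s \<omega> + min (\<xi> \<omega> * V \<omega>) L \<partial>M)"
      unfolding phi_def
    proof (rule integral_mono_AE)
      show "integrable M (\<lambda>\<omega>. min (U \<omega>) L)" using Imin[of U 1 L] U L by simp
      show "integrable M (\<lambda>\<omega>. s \<omega> + min (\<xi> \<omega> * V \<omega>) L)" using s IV by simp
      show "AE \<omega> in M. min (U \<omega>) L \<le> s \<omega> + min (\<xi> \<omega> * V \<omega>) L"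
        using rec
      proof eventually_elim
        case (elim \<omega>)
        then show ?case using s(2)[of \<omega>] by (auto simp: min_def)
      qed
    qed
    also have "\<dots> = sb + (\<integral>\<omega>. min (\<xi> \<omega> * V \<omega>) L \<partial>M)" using s IV by (simp add: sb_def)
    also have "\<dots> \<le> sb + (\<integral>\<omega>. min (c * V \<omega>) L \<partial>M)" using contr[OF L] by simp
    also have "\<dots> = sb + c * phi (L / c)" using UV scale[OF c(1)] by simp
    finally show ?thesis .
  qed
  have iter: "phi L \<le> sb / (1 - c) * (1 - c ^ k) + c ^ k * phi (L / c ^ k)" if L: "0 \<le> L" for L k
  proof (induction k)
    case (Suc k)
    have "c ^ k * phi (L / c ^ k) \<le> c ^ k * (sb + c * phi (L / c ^ k / c))"
      using c L by (intro mult_left_mono step) simp_all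
    moreover have "sb / (1 - c) * (1 - c ^ k) + c ^ k * sb = sb / (1 - c) * (1 - c ^ Suc k)"
      using c by (simp add: field_simps)
    ultimately show ?case using Suc by (simp add: algebra_simps)
  qed simp
  have bound: "phi L \<le> sb / (1 - c)" if L: "0 \<le> L" for L
  proof -
    have "(\<lambda>k. \<integral>\<omega>. min (c ^ k * U \<omega>) L \<partial>M) \<longlonglongrightarrow> (\<integral>\<omega>. min 0 L \<partial>M)"
    proof (rule integral_dominated_convergence[where w="\<lambda>_. L"])
      show "AE \<omega> in M. (\<lambda>k. min (c ^ k * U \<omega>) L) \<longlonglongrightarrow> min 0 L"
        using c by (intro AE_I2 tendsto_min tendsto_const tendsto_mult_left_zero LIMSEQ_power_zero) simp
      show "AE \<omega> in M. norm (min (c ^ k * U \<omega>) L) \<le> L" for k using U(2) L c by (intro AE_I2) (simp add: min_def)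
    qed (use U in simp_all)
    moreover have "(\<integral>\<omega>. min (c ^ k * U \<omega>) L \<partial>M) = c ^ k * phi (L / c ^ k)" for k
      using c by (intro scale) simp
    ultimately have l1: "(\<lambda>k. c ^ k * phi (L / c ^ k)) \<longlonglongrightarrow> 0" using L by (simp add: min_def)
    have "(\<lambda>k. sb / (1 - c) * (1 - c ^ k) + c ^ k * phi (L / c ^ k)) \<longlonglongrightarrow> sb / (1 - c) * (1 - 0) + 0"
      using c by (intro tendsto_add l1 tendsto_mult tendsto_diff tendsto_const LIMSEQ_power_zero) simp
    then show ?thesis using iter[OF L] by (intro LIMSEQ_le_const) auto
  qed
  have "(\<integral>\<^sup>+\<omega>. ennreal (U \<omega>) \<partial>M) \<le> (\<integral>\<^sup>+\<omega>. liminf (\<lambda>n. ennreal (min (U \<omega>) (real n))) \<partial>M)"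
  proof (rule nn_integral_mono)
    fix \<omega>
    have "\<forall>\<^sub>F n in sequentially. ennreal (min (U \<omega>) (real n)) = ennreal (U \<omega>)"
    proof -
      obtain N :: nat where "U \<omega> \<le> real N" using real_arch_simple by blast
      then show ?thesis by (intro eventually_sequentiallyI[of N]) (simp add: min_def)
    qed
    then have "(\<lambda>n. ennreal (min (U \<omega>) (real n))) \<longlonglongrightarrow> ennreal (U \<omega>)" by (rule tendsto_eventually)
    then show "ennreal (U \<omega>) \<le> liminf (\<lambda>n. ennreal (min (U \<omega>) (real n)))"
      by (simp add: lim_imp_Liminf)
  qed
  also have "\<dots> \<le> liminf (\<lambda>n. \<integral>\<^sup>+\<omega>. ennreal (min (U \<omega>) (real n)) \<partial>M)"
    using U(1) by (intro nn_integral_liminf) simp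
  also have "\<dots> \<le> ennreal (sb / (1 - c))"
  proof -
    have "(\<integral>\<^sup>+\<omega>. ennreal (min (U \<omega>) (real n)) \<partial>M) \<le> ennreal (sb / (1 - c))" for n
    proof -
      have "(\<integral>\<^sup>+\<omega>. ennreal (min (U \<omega>) (real n)) \<partial>M) = ennreal (phi (real n))"
        unfolding phi_def using U Imin[of U 1 "real n"] by (intro nn_integral_eq_integral) simp_all
      then show ?thesis using bound[of "real n"] by (simp add: ennreal_leI)
    qed
    then have "limsup (\<lambda>n. \<integral>\<^sup>+\<omega>. ennreal (min (U \<omega>) (real n)) \<partial>M) \<le> ennreal (sb / (1 - c))"
      by (intro Limsup_bounded always_eventually allI)
    then show ?thesis by (rule order_trans[OF Liminf_le_Limsup, rotated]) simp
  qed
  finally have "(\<integral>\<^sup>+\<omega>. ennreal (U \<omega>) \<partial>M) < \<infinity>" by (simp add: le_less_trans)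
  then show ?thesis using U by (intro integrableI_nonneg) simp_all
qed

end

subsection \<open>The operator norm of a nonnegative matrix\<close>

definition row_norm :: "nat \<Rightarrow> real mat \<Rightarrow> real" where
  "row_norm d A = Max ((\<lambda>i. \<Sum>j<d. A $$ (i, j)) ` {..<d})"

lemma mult_mat_vec_index:
  assumes "A \<in> carrier_mat d d" "v \<in> carrier_vec d" "i < d"
  shows "(A *\<^sub>v v) $ i = (\<Sum>j<d. A $$ (i, j) * v $ j)"
  using assms by (auto simp: scalar_prod_def atLeast0LessThan intro!: sum.cong)

lemma mult_mat_index:
  assumes "A \<in> carrier_mat d d" "B \<in> carrier_mat d d" "i < d" "j < d"
  shows "(A * B) $$ (i, j) = (\<Sum>k<d. A $$ (i, k) * B $$ (k, j))"
  using assms by (auto simp: scalar_prod_def atLeast0LessThan intro!: sum.cong)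

lemma max_norm_ge: "i < d \<Longrightarrow> \<bar>v i\<bar> \<le> max_norm d v"
  unfolding max_norm_def by (intro Max_ge) auto

lemma max_norm_le: "0 < d \<Longrightarrow> (\<And>i. i < d \<Longrightarrow> \<bar>v i\<bar> \<le> b) \<Longrightarrow> max_norm d v \<le> b"
  unfolding max_norm_def by (subst Max_le_iff) auto

lemma row_sum_le_row_norm: "i < d \<Longrightarrow> (\<Sum>j<d. A $$ (i, j)) \<le> row_norm d A"
  unfolding row_norm_def by (intro Max_ge) auto

text \<open>For nonnegative matrices the supremum that defines the operator norm is attained at the
  vector of ones.\<close>

lemma op_norm_nonneg_matrix:
  assumes d: "0 < d" and A: "A \<in> carrier_mat d d" and nn: "\<And>i j. i < d \<Longrightarrow> j < d \<Longrightarrow> 0 \<le> A $$ (i, j)"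
  shows "op_norm d A = row_norm d A"
proof -
  let ?q = "\<lambda>x. max_norm d (vec_index (A *\<^sub>v x)) / max_norm d (vec_index x)"
  have le: "?q x \<le> row_norm d A" if x: "x \<in> carrier_vec d - {0\<^sub>v d}" for x
  proof -
    from x obtain i where i: "i < d" "x $ i \<noteq> 0" by (metis DiffE carrier_vecD eq_vecI index_zero_vec insertI1)
    have pos: "0 < max_norm d (vec_index x)" using max_norm_ge[of i d "vec_index x"] i by linarith
    have "max_norm d (vec_index (A *\<^sub>v x)) \<le> row_norm d A * max_norm d (vec_index x)"
    proof (rule max_norm_le[OF d])
      fix i assume i: "i < d"
      have "\<bar>(A *\<^sub>v x) $ i\<bar> \<le> (\<Sum>j<d. \<bar>A $$ (i, j) * x $ j\<bar>)"
        using mult_mat_vec_index[OF A _ i, of x] x by simp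
      also have "\<dots> \<le> (\<Sum>j<d. A $$ (i, j) * max_norm d (vec_index x))"
        using nn i max_norm_ge[of _ d "vec_index x"] by (intro sum_mono) (simp add: abs_mult mult_left_mono)
      also have "\<dots> = (\<Sum>j<d. A $$ (i, j)) * max_norm d (vec_index x)" by (simp add: sum_distrib_right)
      also have "\<dots> \<le> row_norm d A * max_norm d (vec_index x)"
        using pos i by (intro mult_right_mono row_sum_le_row_norm) simp_all
      finally show "\<bar>(A *\<^sub>v x) $ i\<bar> \<le> row_norm d A * max_norm d (vec_index x)" .
    qed
    then show ?thesis using pos by (simp add: pos_divide_le_eq)
  qed
  define e :: "real vec" where "e = vec d (\<lambda>_. 1)"
  have e: "e \<in> carrier_vec d - {0\<^sub>v d}" 
  proof -
    have "vec_index e 0 \<noteq> vec_index (0\<^sub>v d) 0" using d by (simp add: e_def)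
    then have "e \<noteq> 0\<^sub>v d" by metis
    then show ?thesis by (simp add: e_def)
  qed
  have ne: "max_norm d (vec_index e) = 1"
    using max_norm_le[OF d, of "vec_index e" 1] max_norm_ge[of 0 d "vec_index e"] d by (simp add: e_def)
  show ?thesis unfolding op_norm_def
  proof (rule antisym)
    show "(SUP x\<in>carrier_vec d - {0\<^sub>v d}. ?q x) \<le> row_norm d A"
      using e le by (intro cSUP_least) auto
    have "row_norm d A \<le> ?q e"
      unfolding row_norm_def ne
    proof (subst Max_le_iff)
      show "\<forall>a\<in>(\<lambda>i. \<Sum>j<d. A $$ (i, j)) ` {..<d}. a \<le> max_norm d (vec_index (A *\<^sub>v e)) / 1"
      proof (intro ballI, elim imageE)
        fix a i assume "a = (\<Sum>j<d. A $$ (i, j))" "i \<in> {..<d}"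
        moreover have "(A *\<^sub>v e) $ i = (\<Sum>j<d. A $$ (i, j))" if "i < d"
          using mult_mat_vec_index[OF A _ that, of e] by (simp add: e_def)
        ultimately show "a \<le> max_norm d (vec_index (A *\<^sub>v e)) / 1"
          using max_norm_ge[of i d "vec_index (A *\<^sub>v e)"] by simp
      qed
    qed (use d in auto)
    also have "\<dots> \<le> (SUP x\<in>carrier_vec d - {0\<^sub>v d}. ?q x)"
      using e le by (intro cSUP_upper bdd_aboveI2[where M="row_norm d A"]) auto
    finally show "row_norm d A \<le> (SUP x\<in>carrier_vec d - {0\<^sub>v d}. ?q x)" .
  qed
qed

subsection \<open>Products of the companion matrices\<close>

context
  fixes p q :: nat and \<theta> :: "nat \<Rightarrow> real"
  assumes pq: "1 \<le> p" "1 \<le> q" and \<theta>: "\<And>l. l < p + q + 1 \<Longrightarrow> 0 \<le> \<theta> l"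
begin

lemma bp_matrix_carrier: "bp_matrix p q \<theta> e \<in> carrier_mat (p + q - 1) (p + q - 1)"
  by (simp add: bp_matrix_def)

lemma bp_product_carrier: "bp_product p q \<theta> e n \<in> carrier_mat (p + q - 1) (p + q - 1)"
proof (induction n)
  case (Suc n)
  then show ?case unfolding bp_product.simps by (rule mult_carrier_mat[OF _ bp_matrix_carrier])
qed simp

lemma bp_matrix_affine:
  assumes "i < p + q - 1" "j < p + q - 1"
  obtains a b where "0 \<le> a" "0 \<le> b" "\<And>e. bp_matrix p q \<theta> e $$ (i, j) = a + b * e\<^sup>2"
proof -
  define b where "b = (if i = 0 then (if j = 0 then \<theta> 1 else 0) else if i = q then (if j = 0 then 1 else 0) else 0)"
  define a where "a = bp_matrix p q \<theta> 0 $$ (i, j)"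
  have "0 \<le> a" "0 \<le> b" using assms pq by (auto simp: a_def b_def bp_matrix_def intro!: \<theta>)
  moreover have "bp_matrix p q \<theta> e $$ (i, j) = a + b * e\<^sup>2" for e
    using assms by (auto simp: a_def b_def bp_matrix_def)
  ultimately show ?thesis using that by blast
qed

lemma bp_matrix_nonneg: "i < p + q - 1 \<Longrightarrow> j < p + q - 1 \<Longrightarrow> 0 \<le> bp_matrix p q \<theta> e $$ (i, j)"
  by (rule bp_matrix_affine[of i j]) auto

lemma bp_product_Suc_index:
  assumes "i < p + q - 1" "j < p + q - 1"
  shows "bp_product p q \<theta> e (Suc n) $$ (i, j)
     = (\<Sum>k<p + q - 1. bp_product p q \<theta> e n $$ (i, k) * bp_matrix p q \<theta> (e (- int n)) $$ (k, j))"
  unfolding bp_product.simps using assms by (intro mult_mat_index bp_product_carrier bp_matrix_carrier)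

lemma bp_product_nonneg: "i < p + q - 1 \<Longrightarrow> j < p + q - 1 \<Longrightarrow> 0 \<le> bp_product p q \<theta> e n $$ (i, j)"
proof (induction n arbitrary: j)
  case (Suc n)
  then show ?case
    unfolding bp_product_Suc_index[OF Suc.prems]
    by (intro sum_nonneg mult_nonneg_nonneg Suc.IH bp_matrix_nonneg) auto
qed simp

lemma bp_product_local:
  assumes "\<And>m. m < n \<Longrightarrow> e (- int m) = e' (- int m)"
  shows "bp_product p q \<theta> e n = bp_product p q \<theta> e' n"
  using assms by (induction n) auto

lemma bp_product_measurable:
  assumes "i < p + q - 1" "j < p + q - 1" "{- int n<..0} \<subseteq> A"
  shows "(\<lambda>e. bp_product p q \<theta> e n $$ (i, j)) \<in> borel_measurable (Pi\<^sub>M A (\<lambda>_. borel))"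
  using assms
proof (induction n arbitrary: j)
  case (Suc n)
  have "(\<lambda>e. bp_matrix p q \<theta> (e (- int n)) $$ (k, j)) \<in> borel_measurable (Pi\<^sub>M A (\<lambda>_. borel))" if k: "k < p + q - 1" for k
  proof -
    obtain a b where ab: "\<And>e. bp_matrix p q \<theta> e $$ (k, j) = a + b * e\<^sup>2"
      using bp_matrix_affine[OF k Suc.prems(2)] by metis
    have "(\<lambda>e. e (- int n)) \<in> borel_measurable (Pi\<^sub>M A (\<lambda>_. borel :: real measure))"
      using Suc.prems(3) by (intro measurable_component_singleton) auto
    then show ?thesis unfolding ab by measurable
  qed
  moreover have "(\<lambda>e. bp_product p q \<theta> e n $$ (i, k)) \<in> borel_measurable (Pi\<^sub>M A (\<lambda>_. borel))" if "k < p + q - 1" for k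
    using Suc.prems that by (intro Suc.IH) auto
  ultimately show ?case
    unfolding bp_product_Suc_index[OF Suc.prems(1,2)]
    by (intro borel_measurable_sum borel_measurable_times) auto
qed simp

lemma affine_recursion_unroll:
  fixes z :: "int \<Rightarrow> nat \<Rightarrow> real"
  assumes rec: "\<And>t i. i < p + q - 1 \<Longrightarrow>
      z t i = (\<Sum>j<p + q - 1. bp_matrix p q \<theta> (e t) $$ (i, j) * z (t - 1) j) + (if i = 0 then a else 0)"
    and i: "i < p + q - 1"
  shows "z 0 i = (\<Sum>j<p + q - 1. bp_product p q \<theta> e n $$ (i, j) * z (- int n) j)
     + a * (\<Sum>m<n. bp_product p q \<theta> e m $$ (i, 0))"
proof (induction n)
  case 0
  have "(\<Sum>j<p + q - 1. (1\<^sub>m (p + q - 1)) $$ (i, j) * z 0 j) = (\<Sum>j<p + q - 1. if j = i then z 0 i else 0)"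
    using i by (intro sum.cong) auto
  then show ?case using i by simp
next
  case (Suc n)
  let ?d = "p + q - 1" and ?P = "\<lambda>n i j. bp_product p q \<theta> e n $$ (i, j)"
  let ?A = "\<lambda>k j. bp_matrix p q \<theta> (e (- int n)) $$ (k, j)"
  have d: "0 < ?d" using pq by simp
  have "(\<Sum>k<?d. ?P n i k * z (- int n) k)
      = (\<Sum>k<?d. ?P n i k * (\<Sum>j<?d. ?A k j * z (- int n - 1) j)) + (\<Sum>k<?d. ?P n i k * (if k = 0 then a else 0))"
    unfolding sum.distrib[symmetric] distrib_left[symmetric] by (intro sum.cong refl arg_cong2[where f="(*)"] rec) simp
  also have "(\<Sum>k<?d. ?P n i k * (if k = 0 then a else 0)) = (\<Sum>k<?d. if k = 0 then a * ?P n i 0 else 0)"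
    by (intro sum.cong) auto
  also have "\<dots> = a * ?P n i 0" using d by simp
  also have "(\<Sum>k<?d. ?P n i k * (\<Sum>j<?d. ?A k j * z (- int n - 1) j))
      = (\<Sum>j<?d. (\<Sum>k<?d. ?P n i k * ?A k j) * z (- int n - 1) j)"
    unfolding sum_distrib_left sum_distrib_right by (subst sum.swap) (simp add: mult.assoc)
  also have "\<dots> = (\<Sum>j<?d. ?P (Suc n) i j * z (- int n - 1) j)"
    using i by (intro sum.cong) (simp_all add: bp_product_Suc_index algebra_simps del: bp_product.simps)
  finally have *: "(\<Sum>k<?d. ?P n i k * z (- int n) k)
      = (\<Sum>j<?d. ?P (Suc n) i j * z (- int n - 1) j) + a * ?P n i 0" .
  have "- int (Suc n) = - int n - 1" by simp
  then show ?case unfolding Suc * by (simp only: sum.lessThan_Suc distrib_left add.assoc add.commute)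
qed

lemma row_norm_bp_product:
  "op_norm (p + q - 1) (bp_product p q \<theta> e n) = row_norm (p + q - 1) (bp_product p q \<theta> e n)"
  using pq bp_product_nonneg by (intro op_norm_nonneg_matrix bp_product_carrier) auto

lemma row_norm_nonneg: "0 \<le> row_norm (p + q - 1) (bp_product p q \<theta> e n)"
proof -
  have "0 \<le> (\<Sum>j<p + q - 1. bp_product p q \<theta> e n $$ (0, j))"
    using pq by (intro sum_nonneg bp_product_nonneg) auto
  also have "\<dots> \<le> row_norm (p + q - 1) (bp_product p q \<theta> e n)"
    using pq by (intro row_sum_le_row_norm) simp
  finally show ?thesis .
qed

end

context iid_sequence
begin

lemma integrable_bp_product:
  assumes pq: "1 \<le> p" "1 \<le> q" and \<theta>: "\<And>l. l < p + q + 1 \<Longrightarrow> 0 \<le> \<theta> l"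
    and sq: "integrable M (\<lambda>\<omega>. (\<epsilon> 0 \<omega>)\<^sup>2)" and ij: "i < p + q - 1" "j < p + q - 1"
  shows "integrable M (\<lambda>\<omega>. bp_product p q \<theta> (\<lambda>t. \<epsilon> t \<omega>) n $$ (i, j))"
  using ij(2)
proof (induction n arbitrary: j)
  case (Suc n)
  have sqt: "integrable M (\<lambda>\<omega>. (\<epsilon> t \<omega>)\<^sup>2)" for t
  proof -
    have m: "(\<lambda>x::real. x\<^sup>2) \<in> borel_measurable borel" by measurable
    show ?thesis
      using sq integrable_distr_eq[OF eps_measurable m, of t] integrable_distr_eq[OF eps_measurable m, of 0]
      unfolding ident[of t] by blast
  qed
  have prodI: "integrable M (\<lambda>\<omega>. bp_product p q \<theta> (\<lambda>t. \<epsilon> t \<omega>) n $$ (i, k) * bp_matrix p q \<theta> (\<epsilon> (- int n) \<omega>) $$ (k, j))"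
    if k: "k < p + q - 1" for k
  proof -
    obtain a b where ab: "\<And>e. bp_matrix p q \<theta> e $$ (k, j) = a + b * e\<^sup>2"
      using bp_matrix_affine[of p q \<theta> k j] pq \<theta> k Suc.prems by metis
    let ?A = "{- int n<..0}" and ?B = "{- int n}"
    have "indep_var borel (\<lambda>\<omega>. bp_product p q \<theta> (\<lambda>t\<in>?A. \<epsilon> t \<omega>) n $$ (i, k))
        borel (\<lambda>\<omega>. a + b * ((\<lambda>t\<in>?B. \<epsilon> t \<omega>) (- int n))\<^sup>2)"
    proof (rule indep_var_disjoint_times)
      show "(\<lambda>e. bp_product p q \<theta> e n $$ (i, k)) \<in> borel_measurable (Pi\<^sub>M ?A (\<lambda>_. borel))"
        by (rule bp_product_measurable[OF pq \<theta> ij(1) k]) simp_all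
      have "(\<lambda>e. e (- int n)) \<in> borel_measurable (Pi\<^sub>M ?B (\<lambda>_. borel :: real measure))"
        by (rule measurable_component_singleton) simp
      then show "(\<lambda>e. a + b * (e (- int n))\<^sup>2) \<in> borel_measurable (Pi\<^sub>M ?B (\<lambda>_. borel))"
        by measurable
    qed auto
    moreover have "bp_product p q \<theta> (\<lambda>t\<in>?A. \<epsilon> t \<omega>) n = bp_product p q \<theta> (\<lambda>t. \<epsilon> t \<omega>) n" for \<omega>
      by (rule bp_product_local[OF pq \<theta>]) simp_all
    ultimately have "indep_var borel (\<lambda>\<omega>. bp_product p q \<theta> (\<lambda>t. \<epsilon> t \<omega>) n $$ (i, k))
        borel (\<lambda>\<omega>. bp_matrix p q \<theta> (\<epsilon> (- int n) \<omega>) $$ (k, j))"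
      by (simp add: ab)
    then show ?thesis
      using Suc.IH[OF k] sqt by (intro indep_var_integrable) (simp_all add: ab)
  qed
  have Sucn: "bp_product p q \<theta> e (Suc n) $$ (i, j)
     = (\<Sum>k<p + q - 1. bp_product p q \<theta> e n $$ (i, k) * bp_matrix p q \<theta> (e (- int n)) $$ (k, j))" for e
    by (rule bp_product_Suc_index[OF pq \<theta> ij(1) Suc.prems])
  show ?case unfolding Sucn by (intro Bochner_Integration.integrable_sum prodI) simp
qed simp

end

section \<open>Moments of the GARCH sequence\<close>

text \<open>The vector \<open>(\<sigma>\<^sup>2\<^bsub>t+1\<^esub>, \<dots>, \<sigma>\<^sup>2\<^bsub>t-q+2\<^esub>, X\<^sup>2\<^sub>t, \<dots>, X\<^sup>2\<^bsub>t-p+2\<^esub>)\<close> of the Markovian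
  representation.\<close>

definition companion_state :: "nat \<Rightarrow> (int \<Rightarrow> real) \<Rightarrow> (int \<Rightarrow> real) \<Rightarrow> int \<Rightarrow> nat \<Rightarrow> real" where
  "companion_state q s x t i = (if i < q then (s (t + 1 - int i))\<^sup>2 else (x (t - int (i - q)))\<^sup>2)"

lemma companion_recursion:
  fixes s x e :: "int \<Rightarrow> real"
  assumes pq: "1 \<le> p" "1 \<le> q"
    and x: "\<And>t. x t = s t * e t"
    and s: "\<And>t. (s t)\<^sup>2 = \<theta> 0 + (\<Sum>i=1..p. \<theta> i * (x (t - int i))\<^sup>2) + (\<Sum>j=1..q. \<theta> (p + j) * (s (t - int j))\<^sup>2)"
    and i: "i < p + q - 1"
  shows "companion_state q s x t i = (\<Sum>j<p + q - 1. bp_matrix p q \<theta> (e t) $$ (i, j) * companion_state q s x (t - 1) j)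
     + (if i = 0 then \<theta> 0 else 0)"
proof -
  let ?d = "p + q - 1" and ?Z = "companion_state q s x" and ?A = "\<lambda>i j. bp_matrix p q \<theta> (e t) $$ (i, j)"
  have A: "?A i j = (if i = 0 then
       (if j = 0 then \<theta> (p + 1) + \<theta> 1 * (e t)\<^sup>2
        else if j < q then \<theta> (p + (j + 1))
        else \<theta> (j - q + 2))
     else if i = q then (if j = 0 then (e t)\<^sup>2 else 0)
     else (if j = i - 1 then 1 else 0))" if "j < ?d" for j
    using that i by (simp add: bp_matrix_def)
  have d: "0 < ?d" using pq by simp
  have Z0: "?Z (t - 1) 0 = (s t)\<^sup>2" using pq by (simp add: companion_state_def)
  consider "i = 0" | "i = q" "i \<noteq> 0" | "i \<noteq> 0" "i \<noteq> q" by blast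
  then show ?thesis
  proof cases
    case 1
    have split: "{..<?d} = insert 0 ({1..<q} \<union> {q..<?d})" using pq by auto
    have "(\<Sum>j<?d. ?A i j * ?Z (t - 1) j) = ?A i 0 * ?Z (t - 1) 0
        + ((\<Sum>j\<in>{1..<q}. ?A i j * ?Z (t - 1) j) + (\<Sum>j\<in>{q..<?d}. ?A i j * ?Z (t - 1) j))"
      unfolding split using pq by (subst sum.insert) (auto simp: sum.union_disjoint ivl_disj_int)
    also have "?A i 0 * ?Z (t - 1) 0 = \<theta> (p + 1) * (s t)\<^sup>2 + \<theta> 1 * (x t)\<^sup>2"
      unfolding A[OF d] Z0 using 1 by (simp add: x algebra_simps power_mult_distrib)
    also have "(\<Sum>j\<in>{1..<q}. ?A i j * ?Z (t - 1) j) = (\<Sum>j\<in>{2..q}. \<theta> (p + j) * (s (t + 1 - int j))\<^sup>2)"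
      using 1 pq A by (intro sum.reindex_bij_witness[of _ "\<lambda>j. j - 1" "\<lambda>j. j + 1"])
        (auto simp: companion_state_def of_nat_diff algebra_simps)
    also have "(\<Sum>j\<in>{q..<?d}. ?A i j * ?Z (t - 1) j) = (\<Sum>j\<in>{2..p}. \<theta> j * (x (t + 1 - int j))\<^sup>2)"
      using 1 pq A by (intro sum.reindex_bij_witness[of _ "\<lambda>j. j + q - 2" "\<lambda>j. j - q + 2"])
        (auto simp: companion_state_def of_nat_diff algebra_simps)
    finally have sum: "(\<Sum>j<?d. ?A i j * ?Z (t - 1) j) = \<theta> (p + 1) * (s t)\<^sup>2 + \<theta> 1 * (x t)\<^sup>2
       + ((\<Sum>j\<in>{2..q}. \<theta> (p + j) * (s (t + 1 - int j))\<^sup>2) + (\<Sum>j\<in>{2..p}. \<theta> j * (x (t + 1 - int j))\<^sup>2))" .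
    have h: "(\<Sum>j=1..m. f j) = f 1 + (\<Sum>j\<in>{2..m}. f j)" if "1 \<le> m" for m and f :: "nat \<Rightarrow> real"
      using that by (simp add: sum.atLeast_Suc_atMost numeral_2_eq_2)
    have "(s (t + 1))\<^sup>2 = \<theta> 0 + (\<theta> 1 * (x (t + 1 - int 1))\<^sup>2 + (\<Sum>j\<in>{2..p}. \<theta> j * (x (t + 1 - int j))\<^sup>2))
        + (\<theta> (p + 1) * (s (t + 1 - int 1))\<^sup>2 + (\<Sum>j\<in>{2..q}. \<theta> (p + j) * (s (t + 1 - int j))\<^sup>2))"
      using s[of "t + 1"] unfolding h[OF pq(1)] h[OF pq(2)] .
    then show ?thesis
      unfolding sum using 1 pq by (simp add: companion_state_def)
  next
    case 2
    have "(\<Sum>j<?d. ?A i j * ?Z (t - 1) j) = (\<Sum>j<?d. if j = 0 then (e t)\<^sup>2 * (s t)\<^sup>2 else 0)"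
      using 2 A Z0 by (intro sum.cong) auto
    also have "\<dots> = (x t)\<^sup>2" using d by (simp add: x power_mult_distrib)
    finally show ?thesis using 2 by (simp add: companion_state_def)
  next
    case 3
    have "(\<Sum>j<?d. ?A i j * ?Z (t - 1) j) = (\<Sum>j<?d. if j = i - 1 then ?Z (t - 1) (i - 1) else 0)"
      using 3 A by (intro sum.cong) auto
    also have "\<dots> = ?Z (t - 1) (i - 1)" using 3 i by simp
    also have "\<dots> = ?Z t i" using 3 by (auto simp: companion_state_def of_nat_diff algebra_simps)
    finally show ?thesis using 3 by simp
  qed
qed

lemma powr_subadditive:
  fixes a b d :: real
  assumes "0 \<le> a" "0 \<le> b" "0 < d" "d \<le> 1"
  shows "(a + b) powr d \<le> a powr d + b powr d"
proof (cases "a + b = 0")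
  case False
  then have ab: "0 < a + b" using assms by simp
  have "x / (a + b) \<le> (x / (a + b)) powr d" if "0 \<le> x" "x \<le> a + b" for x
    using that ab assms by (intro le_powr_of_le_one) simp_all
  from add_mono[OF this[of a] this[of b]]
  have "a / (a + b) + b / (a + b) \<le> (a powr d + b powr d) / (a + b) powr d"
    using assms by (simp add: powr_divide add_divide_distrib)
  moreover have "a / (a + b) + b / (a + b) = 1" using ab by (simp flip: add_divide_distrib)
  ultimately have "1 \<le> (a powr d + b powr d) / (a + b) powr d" by simp
  then show ?thesis using ab by (simp add: pos_le_divide_eq)
qed (use assms in \<open>simp add: add_nonneg_eq_0_iff\<close>)

sublocale garch \<subseteq> iid_sequence M \<epsilon>
  by unfold_locales (rule innov_indep, rule innov_ident)

context garch
begin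

lemma theta_nonneg: "l < p + q + 1 \<Longrightarrow> 0 \<le> \<theta> l"
proof -
  assume l: "l < p + q + 1"
  show ?thesis
  proof (cases "l \<le> p")
    case True
    then show ?thesis using alpha0 alpha[of l] by (cases "l = 0") auto
  next
    case False
    then have "l - p \<in> {1..q}" using l by auto
    from beta[OF this] False show ?thesis by simp
  qed
qed

text \<open>The volatility and the observation at time \<open>t\<close> as functionals of the innovations up to
  \<open>t - 1\<close> and up to \<open>t\<close>, listed backwards in time.\<close>

definition vol :: "(nat \<Rightarrow> real) \<Rightarrow> real" where
  "vol = (SOME g. g \<in> borel_measurable paths \<and> (\<forall>t. AE \<omega> in M. \<sigma> t \<omega> = g (past (t - 1) \<omega>)))"

lemma vol_measurable: "vol \<in> borel_measurable paths"
  and sigma_eq_vol: "AE \<omega> in M. \<sigma> t \<omega> = vol (past (t - 1) \<omega>)"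
proof -
  have "\<exists>g. g \<in> borel_measurable paths \<and> (\<forall>t. AE \<omega> in M. \<sigma> t \<omega> = g (past (t - 1) \<omega>))"
    using nonanticipative unfolding past_def by blast
  from someI_ex[OF this] show "vol \<in> borel_measurable paths" "AE \<omega> in M. \<sigma> t \<omega> = vol (past (t - 1) \<omega>)"
    unfolding vol_def by blast+
qed

definition shift :: "nat \<Rightarrow> (nat \<Rightarrow> real) \<Rightarrow> nat \<Rightarrow> real" where
  "shift i x = (\<lambda>m. x (m + i))"

lemma shift_measurable: "shift i \<in> measurable paths paths"
  unfolding shift_def
  by (rule measurable_PiM_single') (auto simp: space_PiM intro!: measurable_component_singleton)

lemma measurable_shift: "f \<in> borel_measurable paths \<Longrightarrow> (\<lambda>x. f (shift i x)) \<in> borel_measurable paths"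
  for f :: "_ \<Rightarrow> 'b :: topological_space"
  by (rule measurable_compose[OF shift_measurable])

lemma past_shift: "past (t - int i) \<omega> = shift i (past t \<omega>)"
  by (simp add: past_def shift_def algebra_simps)

lemma shift_0: "shift 0 x = x"
  by (simp add: shift_def)

definition obs :: "(nat \<Rightarrow> real) \<Rightarrow> real" where
  "obs x = vol (shift 1 x) * x 0"

lemma coordinate_measurable: "(\<lambda>x. x i) \<in> borel_measurable (paths :: (nat \<Rightarrow> real) measure)"
  by (rule measurable_component_singleton) simp

lemma obs_measurable: "obs \<in> borel_measurable paths"
  unfolding obs_def[abs_def] by (intro borel_measurable_times measurable_shift vol_measurable coordinate_measurable)

text \<open>All relations of the model hold simultaneously on one event of full probability.\<close>

lemma AE_model:
  "AE \<omega> in M. (\<forall>t. 0 \<le> \<sigma> t \<omega> \<and> \<sigma> t \<omega> = vol (past (t - 1) \<omega>) \<and> X t \<omega> = \<sigma> t \<omega> * \<epsilon> t \<omega> \<and> X t \<omega> = obs (past t \<omega>)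
      \<and> (\<sigma> t \<omega>)\<^sup>2 = \<theta> 0 + (\<Sum>i=1..p. \<theta> i * (X (t - int i) \<omega>)\<^sup>2) + (\<Sum>j=1..q. \<theta> (p + j) * (\<sigma> (t - int j) \<omega>)\<^sup>2))"
proof (subst AE_all_countable, intro allI)
  fix t
  show "AE \<omega> in M. 0 \<le> \<sigma> t \<omega> \<and> \<sigma> t \<omega> = vol (past (t - 1) \<omega>) \<and> X t \<omega> = \<sigma> t \<omega> * \<epsilon> t \<omega> \<and> X t \<omega> = obs (past t \<omega>)
      \<and> (\<sigma> t \<omega>)\<^sup>2 = \<theta> 0 + (\<Sum>i=1..p. \<theta> i * (X (t - int i) \<omega>)\<^sup>2) + (\<Sum>j=1..q. \<theta> (p + j) * (\<sigma> (t - int j) \<omega>)\<^sup>2)"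
    using sigma_nonneg[of t] sigma_eq_vol[of t] X_eq[of t] sigma_eq[of t]
  proof eventually_elim
    case (elim \<omega>)
    have "past (t - 1) \<omega> = shift 1 (past t \<omega>)" using past_shift[of t 1 \<omega>] by simp
    moreover have "past t \<omega> 0 = \<epsilon> t \<omega>" by (simp add: past_def)
    ultimately have "obs (past t \<omega>) = vol (past (t - 1) \<omega>) * \<epsilon> t \<omega>" by (simp add: obs_def)
    with elim show ?case by simp
  qed
qed

text \<open>The maximum norm of the companion state, as a functional of the path.\<close>

definition state_norm :: "(nat \<Rightarrow> real) \<Rightarrow> real" where
  "state_norm x = max_norm (p + q - 1)
     (\<lambda>i. if i < q then (vol (shift i x))\<^sup>2 else (obs (shift (i - q) x))\<^sup>2)"

lemma dim_pos: "0 < p + q - 1"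
  using orders by simp

lemma state_norm_measurable: "state_norm \<in> borel_measurable paths"
proof -
  have "(\<lambda>x. \<bar>if i < q then (vol (shift i x))\<^sup>2 else (obs (shift (i - q) x))\<^sup>2\<bar>) \<in> borel_measurable paths" for i
    using measurable_shift[OF vol_measurable, of i] measurable_shift[OF obs_measurable, of "i - q"]
    by (cases "i < q") simp_all
  then show ?thesis unfolding state_norm_def[abs_def] max_norm_def using dim_pos
    by (intro borel_measurable_Max) auto
qed

lemma state_norm_nonneg: "0 \<le> state_norm x"
  unfolding state_norm_def by (rule order_trans[OF abs_ge_zero max_norm_ge[OF dim_pos]])

text \<open>One of the logarithmic moments in the Lyapunov exponent is negative. The corresponding
  product contracts some fractional moment, and the unrolled companion recursion bounds that
  moment of the state.\<close>

lemma fractional_moment_vol: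
  obtains \<delta> where "0 < \<delta>" "\<delta> \<le> 1" "integrable M (\<lambda>\<omega>. ((vol (past 0 \<omega>))\<^sup>2) powr \<delta>)"
proof -
  let ?d = "p + q - 1"
  let ?P = "\<lambda>n \<omega>. bp_product p q \<theta> (\<lambda>t. \<epsilon> t \<omega>) n"
  have rn: "op_norm ?d (bp_product p q \<theta> e n) = row_norm ?d (bp_product p q \<theta> e n)" for e n
    by (rule row_norm_bp_product[OF orders theta_nonneg])
  have nn: "0 \<le> row_norm ?d (bp_product p q \<theta> e n)" for e n
    by (rule row_norm_nonneg[OF orders theta_nonneg])
  have Pnn: "0 \<le> bp_product p q \<theta> e n $$ (i, j)" if "i < ?d" "j < ?d" for e n i j
    by (rule bp_product_nonneg[OF orders theta_nonneg that])
  have PI: "integrable M (\<lambda>\<omega>. ?P n \<omega> $$ (i, j))" if "i < ?d" "j < ?d" for n i j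
    by (rule integrable_bp_product[OF orders theta_nonneg innov_integrable(2) that])
  obtain n where n: "1 \<le> n" and neg: "ereal_expectation M (\<lambda>\<omega>. log_ereal (op_norm ?d (?P n \<omega>))) / ereal (real n) < 0"
    using bp unfolding bougerol_picard_def top_lyapunov_def INF_less_iff by auto
  have neg': "ereal_expectation M (\<lambda>\<omega>. log_ereal (row_norm ?d (?P n \<omega>))) < 0"
  proof (rule ccontr)
    assume "\<not> ?thesis"
    then have "0 \<le> ereal_expectation M (\<lambda>\<omega>. log_ereal (row_norm ?d (?P n \<omega>))) / ereal (real n)"
      using n by (intro zero_le_divide_ereal) simp_all
    then show False using neg unfolding rn by simp
  qed
  have rm: "(\<lambda>e. row_norm ?d (bp_product p q \<theta> e n)) \<in> borel_measurable (Pi\<^sub>M A (\<lambda>_. borel))"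
    if "{- int n<..0} \<subseteq> A" for A
    unfolding row_norm_def using dim_pos
    by (intro borel_measurable_Max borel_measurable_sum bp_product_measurable[OF orders theta_nonneg]) (use that in auto)
  have PIn: "integrable M (\<lambda>\<omega>. row_norm ?d (?P n \<omega>))"
  proof (rule Bochner_Integration.integrable_bound)
    show "integrable M (\<lambda>\<omega>. \<Sum>i<?d. \<Sum>j<?d. ?P n \<omega> $$ (i, j))"
      by (intro Bochner_Integration.integrable_sum PI) simp_all
    have "(\<lambda>\<omega>. ?P n \<omega> $$ (i, j)) \<in> borel_measurable M" if "i < ?d" "j < ?d" for i j
      using PI[OF that] by (rule borel_measurable_integrable)
    then show "(\<lambda>\<omega>. row_norm ?d (?P n \<omega>)) \<in> borel_measurable M"
      unfolding row_norm_def using dim_pos by (intro borel_measurable_Max borel_measurable_sum) auto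
    have "row_norm ?d (?P n \<omega>) \<le> (\<Sum>i<?d. \<Sum>j<?d. ?P n \<omega> $$ (i, j))" for \<omega>
      unfolding row_norm_def
    proof (subst Max_le_iff)
      show "\<forall>a\<in>(\<lambda>i. \<Sum>j<?d. ?P n \<omega> $$ (i, j)) ` {..<?d}. a \<le> (\<Sum>i<?d. \<Sum>j<?d. ?P n \<omega> $$ (i, j))"
        by (intro ballI, elim imageE, hypsubst, intro member_le_sum sum_nonneg Pnn) simp_all
    qed (use dim_pos in \<open>simp_all add: lessThan_empty_iff\<close>)
    then show "AE \<omega> in M. norm (row_norm ?d (?P n \<omega>)) \<le> norm (\<Sum>i<?d. \<Sum>j<?d. ?P n \<omega> $$ (i, j))"
      using nn by (intro AE_I2) (simp add: order_trans[OF _ abs_ge_self])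
  qed
  obtain \<delta> where \<delta>: "0 < \<delta>" "\<delta> \<le> 1" and contr: "(\<integral>\<omega>. row_norm ?d (?P n \<omega>) powr \<delta> \<partial>M) < 1"
    using fractional_moment_contraction[OF PIn nn neg'] by blast
  define S where "S \<omega> = \<theta> 0 * (\<Sum>i<?d. \<Sum>m<n. ?P m \<omega> $$ (i, 0))" for \<omega>
  have S0: "0 \<le> S \<omega>" for \<omega>
    unfolding S_def using alpha0 dim_pos by (intro mult_nonneg_nonneg sum_nonneg Pnn) simp_all
  have SI: "integrable M S"
    unfolding S_def[abs_def] using dim_pos
    by (intro integrable_mult_right Bochner_Integration.integrable_sum PI) simp_all
  define U where "U t \<omega> = state_norm (past t \<omega>) powr \<delta>" for t \<omega>
  have pm: "(\<lambda>x. state_norm x powr \<delta>) \<in> borel_measurable paths"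
    using state_norm_measurable by measurable
  have Um: "U t \<in> borel_measurable M" for t unfolding U_def[abs_def] by (rule measurable_past[OF pm])
  have law: "distr M borel (U 0) = distr M borel (U (- int n))"
  proof -
    have "distr (distr M paths (past t)) borel (\<lambda>x. state_norm x powr \<delta>) = distr M borel (U t)" for t
      using distr_distr[OF pm past_measurable, of t] by (simp add: comp_def U_def[abs_def])
    then show ?thesis by (metis distr_past)
  qed
  have ind: "indep_var borel (\<lambda>\<omega>. row_norm ?d (?P n \<omega>) powr \<delta>) borel (U (- int n))"
  proof -
    let ?A = "{- int n<..0}"
    have "(\<lambda>e. row_norm ?d (bp_product p q \<theta> e n) powr \<delta>) \<in> borel_measurable (Pi\<^sub>M ?A (\<lambda>_. borel))"
      using rm[of ?A] by measurable
    then have "indep_var borel (\<lambda>\<omega>. row_norm ?d (bp_product p q \<theta> (\<lambda>t\<in>?A. \<epsilon> t \<omega>) n) powr \<delta>)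
        borel (\<lambda>\<omega>. state_norm (past (- int n) \<omega>) powr \<delta>)"
      by (intro indep_var_past pm) auto
    moreover have "bp_product p q \<theta> (\<lambda>t\<in>?A. \<epsilon> t \<omega>) n = ?P n \<omega>" for \<omega>
      by (rule bp_product_local[OF orders theta_nonneg]) simp_all
    ultimately show ?thesis by (simp add: U_def[abs_def])
  qed
  have rec: "AE \<omega> in M. U 0 \<omega> \<le> row_norm ?d (?P n \<omega>) powr \<delta> * U (- int n) \<omega> + S \<omega> powr \<delta>"
    using AE_model
  proof eventually_elim
    case (elim \<omega>)
    let ?Z = "companion_state q (\<lambda>t. \<sigma> t \<omega>) (\<lambda>t. X t \<omega>)"
    have Z: "?Z t i = (if i < q then (vol (shift i (past t \<omega>)))\<^sup>2 else (obs (shift (i - q) (past t \<omega>)))\<^sup>2)" for t i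
    proof -
      have "\<sigma> (t + 1 - int i) \<omega> = vol (past (t - int i) \<omega>)" using elim[rule_format, of "t + 1 - int i"] by (simp add: algebra_simps)
      moreover have "X (t - int (i - q)) \<omega> = obs (past (t - int (i - q)) \<omega>)" using elim by blast
      ultimately show ?thesis by (simp only: companion_state_def past_shift)
    qed
    have N: "state_norm (past t \<omega>) = max_norm ?d (?Z t)" for t
      unfolding state_norm_def by (rule arg_cong[where f="max_norm ?d"]) (simp add: Z fun_eq_iff)
    have Znn: "0 \<le> ?Z t i" for t i by (simp add: companion_state_def)
    have Zrec: "?Z t i = (\<Sum>j<?d. bp_matrix p q \<theta> (\<epsilon> t \<omega>) $$ (i, j) * ?Z (t - 1) j) + (if i = 0 then \<theta> 0 else 0)"
      if "i < ?d" for t i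
      by (rule companion_recursion[where s="\<lambda>t. \<sigma> t \<omega>" and x="\<lambda>t. X t \<omega>" and e="\<lambda>t. \<epsilon> t \<omega>", OF orders])
        (use elim that in blast)+
    have "max_norm ?d (?Z 0) \<le> row_norm ?d (?P n \<omega>) * max_norm ?d (?Z (- int n)) + S \<omega>"
    proof (rule max_norm_le[OF dim_pos])
      fix i assume i: "i < ?d"
      have "?Z 0 i = (\<Sum>j<?d. ?P n \<omega> $$ (i, j) * ?Z (- int n) j) + \<theta> 0 * (\<Sum>m<n. ?P m \<omega> $$ (i, 0))"
        by (rule affine_recursion_unroll[where z="?Z" and e="\<lambda>t. \<epsilon> t \<omega>" and a="\<theta> 0", OF orders theta_nonneg Zrec i])
      also have "\<dots> \<le> (\<Sum>j<?d. ?P n \<omega> $$ (i, j) * max_norm ?d (?Z (- int n))) + S \<omega>"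
      proof (intro add_mono sum_mono mult_left_mono)
        fix j assume j: "j \<in> {..<?d}"
        show "?Z (- int n) j \<le> max_norm ?d (?Z (- int n))"
          using max_norm_ge[of j ?d "?Z (- int n)"] j by simp
        show "0 \<le> ?P n \<omega> $$ (i, j)" using i j by (intro Pnn) simp_all
      next
        show "\<theta> 0 * (\<Sum>m<n. ?P m \<omega> $$ (i, 0)) \<le> S \<omega>"
          unfolding S_def using alpha0 i dim_pos
          by (intro mult_left_mono member_le_sum sum_nonneg Pnn) simp_all
      qed
      also have "\<dots> = (\<Sum>j<?d. ?P n \<omega> $$ (i, j)) * max_norm ?d (?Z (- int n)) + S \<omega>"
        by (simp add: sum_distrib_right)
      also have "\<dots> \<le> row_norm ?d (?P n \<omega>) * max_norm ?d (?Z (- int n)) + S \<omega>"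
        using max_norm_ge[OF dim_pos, of "?Z (- int n)"] i
        by (intro add_right_mono mult_right_mono row_sum_le_row_norm) simp_all
      finally show "\<bar>?Z 0 i\<bar> \<le> row_norm ?d (?P n \<omega>) * max_norm ?d (?Z (- int n)) + S \<omega>"
        using Znn by simp
    qed
    then have "state_norm (past 0 \<omega>) \<le> row_norm ?d (?P n \<omega>) * state_norm (past (- int n) \<omega>) + S \<omega>"
      by (simp only: N)
    then have "U 0 \<omega> \<le> (row_norm ?d (?P n \<omega>) * state_norm (past (- int n) \<omega>) + S \<omega>) powr \<delta>"
      unfolding U_def using \<delta> by (intro powr_mono2 state_norm_nonneg) simp_all
    also have "\<dots> \<le> (row_norm ?d (?P n \<omega>) * state_norm (past (- int n) \<omega>)) powr \<delta> + S \<omega> powr \<delta>"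
      using nn state_norm_nonneg S0 \<delta> by (intro powr_subadditive) simp_all
    finally show ?case by (simp add: powr_mult U_def)
  qed
  have UI: "integrable M (U 0)"
  proof (rule integrable_of_stochastic_recursion[OF Um _ Um _ law _ _ contr ind _ _ rec])
    show "integrable M (\<lambda>\<omega>. row_norm ?d (?P n \<omega>) powr \<delta>)"
      by (rule integrable_powr_of_integrable[OF PIn nn \<delta>])
    show "integrable M (\<lambda>\<omega>. S \<omega> powr \<delta>)"
      by (rule integrable_powr_of_integrable[OF SI S0 \<delta>])
  qed (simp_all add: U_def)
  have le: "norm (((vol (past 0 \<omega>))\<^sup>2) powr \<delta>) \<le> norm (U 0 \<omega>)" for \<omega>
  proof -
    have "(vol (past 0 \<omega>))\<^sup>2 \<le> state_norm (past 0 \<omega>)"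
    proof -
      let ?f = "\<lambda>i. if i < q then (vol (shift i (past 0 \<omega>)))\<^sup>2 else (obs (shift (i - q) (past 0 \<omega>)))\<^sup>2"
      have "?f 0 = (vol (past 0 \<omega>))\<^sup>2" using orders by (simp add: shift_0)
      then show ?thesis using max_norm_ge[OF dim_pos, of ?f] unfolding state_norm_def by linarith
    qed
    then show ?thesis unfolding U_def using \<delta> by (simp add: powr_mono2)
  qed
  have m: "(\<lambda>\<omega>. ((vol (past 0 \<omega>))\<^sup>2) powr \<delta>) \<in> borel_measurable M"
  proof (rule measurable_past)
    show "(\<lambda>x. ((vol x)\<^sup>2) powr \<delta>) \<in> borel_measurable paths" using vol_measurable by measurable
  qed
  have "integrable M (\<lambda>\<omega>. ((vol (past 0 \<omega>))\<^sup>2) powr \<delta>)"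
    by (rule Bochner_Integration.integrable_bound[OF UI m AE_I2[OF le]])
  with \<delta> show ?thesis using that by blast
qed

end

section \<open>The volatility as a series in the past observations\<close>

lemma (in prob_space) geometric_series_integrable:
  fixes f :: "nat \<Rightarrow> 'a \<Rightarrow> real"
  assumes f: "\<And>i. integrable M (f i)" "\<And>i \<omega>. 0 \<le> f i \<omega>" and m: "\<And>i. (\<integral>\<omega>. f i \<omega> \<partial>M) \<le> m"
    and B: "0 < B" "B < 1"
  shows "AE \<omega> in M. summable (\<lambda>i. B ^ i * f i \<omega>)" "integrable M (\<lambda>\<omega>. \<Sum>i. B ^ i * f i \<omega>)"
proof -
  have I: "integrable M (\<lambda>\<omega>. B ^ i * f i \<omega>)" for i using f(1) by simp
  have nI: "(\<integral>\<^sup>+\<omega>. ennreal (B ^ i * f i \<omega>) \<partial>M) = ennreal (B ^ i * (\<integral>\<omega>. f i \<omega> \<partial>M))" for i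
    using nn_integral_eq_integral[OF I] f(2) B by simp
  have le: "B ^ i * (\<integral>\<omega>. f i \<omega> \<partial>M) \<le> B ^ i * m" for i using m B by (intro mult_left_mono) simp_all
  have sg: "summable (\<lambda>i. B ^ i * m)" using B by (intro summable_mult2 summable_geometric) simp
  have nn: "0 \<le> (\<integral>\<omega>. f i \<omega> \<partial>M)" for i using f(2) by simp
  have s1: "summable (\<lambda>i. B ^ i * (\<integral>\<omega>. f i \<omega> \<partial>M))"
    by (rule summable_comparison_test'[OF sg, of 0]) (use le nn B in simp)
  have "(\<integral>\<^sup>+\<omega>. (\<Sum>i. ennreal (B ^ i * f i \<omega>)) \<partial>M) = (\<Sum>i. \<integral>\<^sup>+\<omega>. ennreal (B ^ i * f i \<omega>) \<partial>M)"
    using borel_measurable_integrable[OF I] by (intro nn_integral_suminf) simp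
  also have "\<dots> = ennreal (\<Sum>i. B ^ i * (\<integral>\<omega>. f i \<omega> \<partial>M))"
    unfolding nI using s1 nn B by (intro suminf_ennreal2) simp_all
  finally have "(\<integral>\<^sup>+\<omega>. (\<Sum>i. ennreal (B ^ i * f i \<omega>)) \<partial>M) \<noteq> \<infinity>" by simp
  then have "AE \<omega> in M. (\<Sum>i. ennreal (B ^ i * f i \<omega>)) \<noteq> \<infinity>"
    using borel_measurable_integrable[OF I] by (intro nn_integral_PInf_AE) simp_all
  then show ae: "AE \<omega> in M. summable (\<lambda>i. B ^ i * f i \<omega>)"
  proof eventually_elim
    case (elim \<omega>)
    then show ?case using f(2) B by (intro summable_suminf_not_top) (simp_all add: infinity_ennreal_def)
  qed
  show "integrable M (\<lambda>\<omega>. \<Sum>i. B ^ i * f i \<omega>)"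
  proof (rule integrable_suminf[OF I])
    show "AE \<omega> in M. summable (\<lambda>i. norm (B ^ i * f i \<omega>))" using ae f(2) B by (simp add: abs_mult)
    show "summable (\<lambda>i. \<integral>\<omega>. norm (B ^ i * f i \<omega>) \<partial>M)" using s1 f(2) B by (simp add: abs_mult)
  qed
qed

text \<open>In the supremum norm with weights \<open>\<lambda>\<^sup>m\<close> the recursion is a contraction, because it reaches back
  only \<open>q\<close> steps and so loses at most the factor \<open>\<lambda>\<^bsup>-q\<^esup>\<close>.\<close>

lemma homogeneous_recursion_zero:
  fixes D b :: "nat \<Rightarrow> real"
  assumes rec: "\<And>m. \<bar>D m\<bar> \<le> (\<Sum>j=1..q. b j * \<bar>D (m + j)\<bar>)"
    and b: "\<And>j. j \<in> {1..q} \<Longrightarrow> 0 \<le> b j"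
    and lam: "0 < lm" "lm \<le> 1" and small: "(\<Sum>j=1..q. b j) < lm ^ q"
    and bd: "\<And>m. lm ^ m * \<bar>D m\<bar> \<le> C"
  shows "D m = 0"
proof -
  define r where "r = (\<Sum>j=1..q. b j) / lm ^ q"
  have r: "0 \<le> r" "r < 1" using b small lam by (auto simp: r_def intro!: divide_nonneg_pos sum_nonneg)
  have C: "0 \<le> C" using bd[of 0] abs_ge_zero[of "D 0"] by simp
  have "lm ^ m * \<bar>D m\<bar> \<le> C * r ^ k" for k m
  proof (induction k arbitrary: m)
    case (Suc k)
    have "lm ^ m * \<bar>D m\<bar> \<le> lm ^ m * (\<Sum>j=1..q. b j * \<bar>D (m + j)\<bar>)" using lam by (intro mult_left_mono rec) simp
    also have "\<dots> = (\<Sum>j=1..q. b j * (lm ^ (m + j) * \<bar>D (m + j)\<bar>) / lm ^ j)"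
      using lam by (simp add: sum_distrib_left power_add mult_ac)
    also have "\<dots> \<le> (\<Sum>j=1..q. b j * (C * r ^ k) / lm ^ q)"
    proof (intro sum_mono frac_le mult_left_mono Suc.IH b mult_nonneg_nonneg)
      fix j assume "j \<in> {1..q}"
      then show "lm ^ q \<le> lm ^ j" using lam by (intro power_decreasing) simp_all
    qed (use C r lam in simp_all)
    also have "\<dots> = C * r ^ Suc k" by (simp add: r_def sum_distrib_right[symmetric] sum_divide_distrib[symmetric])
    finally show ?case .
  qed (use bd in simp)
  moreover have "(\<lambda>k. C * r ^ k) \<longlonglongrightarrow> C * 0" using r by (intro tendsto_mult_left LIMSEQ_power_zero) simp
  ultimately have "lm ^ m * \<bar>D m\<bar> \<le> 0" by (intro LIMSEQ_le_const[of "\<lambda>k. C * r ^ k"]) auto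
  then have "\<bar>D m\<bar> \<le> 0" using zero_less_power[OF lam(1), of m] by (simp add: mult_le_0_iff)
  then show ?thesis by simp
qed

text \<open>The recursion of the coefficients is exactly what makes the series solve the volatility
  equation.\<close>

lemma sigma2_recursion:
  fixes x :: "int \<Rightarrow> real"
  assumes q: "1 \<le> q" and S: "(\<Sum>j=1..q. u (p + j)) \<noteq> 1"
    and sm: "\<And>t. summable (\<lambda>m. c_coeff p q u (Suc m) * (x (t - int (Suc m)))\<^sup>2)"
  shows "sigma2 p q u x t = u 0 + (\<Sum>i=1..p. u i * (x (t - int i))\<^sup>2) + (\<Sum>j=1..q. u (p + j) * sigma2 p q u x (t - int j))"
proof -
  let ?c = "c_coeff p q u"
  let ?y = "\<lambda>i. (x (t - int i))\<^sup>2"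
  let ?b = "\<Sum>j=1..q. u (p + j)"
  let ?T = "\<lambda>s. \<Sum>m. ?c (Suc m) * (x (s - int (Suc m)))\<^sup>2"
  have c0: "?c 0 * (1 - ?b) = u 0" using S by simp
  have part1: "(\<lambda>m. if Suc m \<le> p then u (Suc m) * ?y (Suc m) else 0) sums (\<Sum>i=1..p. u i * ?y i)"
  proof -
    have "(\<lambda>m. if m \<in> {..<p} then u (Suc m) * ?y (Suc m) else 0) sums (\<Sum>m\<in>{..<p}. u (Suc m) * ?y (Suc m))"
      by (rule sums_If_finite_set) simp
    moreover have "(\<Sum>m\<in>{..<p}. u (Suc m) * ?y (Suc m)) = (\<Sum>i=1..p. u i * ?y i)"
      by (rule sum.reindex_bij_witness[of _ "\<lambda>i. i - 1" Suc]) auto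
    ultimately show ?thesis by (simp add: Suc_le_eq)
  qed
  have part2: "(\<lambda>m. if j \<le> m then ?c (Suc m - j) * ?y (Suc m) else 0) sums ?T (t - int j)" for j
  proof -
    have eq: "t - int j - int (Suc m) = t - int (Suc (m + j))" for m by simp
    have "(\<lambda>m. ?c (Suc m) * (x (t - int j - int (Suc m)))\<^sup>2) sums ?T (t - int j)"
      by (rule summable_sums[OF sm])
    then have "(\<lambda>m. ?c (Suc m) * ?y (Suc (m + j))) sums ?T (t - int j)" unfolding eq .
    then have "(\<lambda>m. (\<lambda>m. if j \<le> m then ?c (Suc m - j) * ?y (Suc m) else 0) (m + j)) sums ?T (t - int j)"
      by (simp add: Suc_diff_le)
    then show ?thesis by (subst (asm) sums_zero_iff_shift) simp_all
  qed
  have "(\<lambda>m. (if Suc m \<le> p then u (Suc m) * ?y (Suc m) else 0)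
        + (\<Sum>j=1..q. u (p + j) * (if j \<le> m then ?c (Suc m - j) * ?y (Suc m) else 0)))
      sums ((\<Sum>i=1..p. u i * ?y i) + (\<Sum>j=1..q. u (p + j) * ?T (t - int j)))"
    by (intro sums_add part1 sums_sum sums_mult part2)
  moreover have "(if Suc m \<le> p then u (Suc m) * ?y (Suc m) else 0)
        + (\<Sum>j=1..q. u (p + j) * (if j \<le> m then ?c (Suc m - j) * ?y (Suc m) else 0)) = ?c (Suc m) * ?y (Suc m)" for m
  proof -
    have "(\<Sum>j=1..q. u (p + j) * (if j \<le> m then ?c (Suc m - j) * ?y (Suc m) else 0))
        = (\<Sum>j=1..min m q. u (p + j) * (?c (Suc m - j) * ?y (Suc m)))"
      by (rule sum.mono_neutral_cong_right) auto
    then show ?thesis by (auto simp: c_coeff.simps(2) distrib_right sum_distrib_right mult.assoc)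
  qed
  ultimately have "?T t = (\<Sum>i=1..p. u i * ?y i) + (\<Sum>j=1..q. u (p + j) * ?T (t - int j))"
    by (simp add: sums_iff)
  moreover have "(\<Sum>j=1..q. u (p + j) * sigma2 p q u x (t - int j)) = ?b * ?c 0 + (\<Sum>j=1..q. u (p + j) * ?T (t - int j))"
    unfolding sigma2_def by (simp add: distrib_left sum.distrib sum_distrib_right del: c_coeff.simps)
  moreover have "?c 0 = u 0 + ?b * ?c 0" using c0 by (simp add: algebra_simps del: c_coeff.simps)
  ultimately show ?thesis unfolding sigma2_def by linarith
qed

context garch
begin

text \<open>A fractional moment excludes geometric growth towards the past: the weighted sum of the
  \<open>\<delta>\<close>-th powers has a finite mean, hence its terms are bounded.\<close>

lemma AE_geometric_growth:
  fixes h :: "(nat \<Rightarrow> real) \<Rightarrow> real" and \<delta> lm :: real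
  assumes h: "h \<in> borel_measurable paths" "\<And>x. 0 \<le> h x" and \<delta>: "0 < \<delta>"
    and int: "integrable M (\<lambda>\<omega>. h (past 0 \<omega>) powr \<delta>)" and lam: "0 < lm" "lm < 1"
  shows "AE \<omega> in M. \<forall>t. \<exists>C. \<forall>n. lm ^ n * h (past (t - int n) \<omega>) \<le> C"
proof (subst AE_all_countable, intro allI)
  fix t
  have hm: "(\<lambda>x. h x powr \<delta>) \<in> borel_measurable paths" using h(1) by measurable
  have "lm powr \<delta> < 1" using lam \<delta> powr_less_mono2[of \<delta> lm 1] by simp
  then have "AE \<omega> in M. summable (\<lambda>n. (lm powr \<delta>) ^ n * h (past (t - int n) \<omega>) powr \<delta>)"
    using lam int integrable_past[OF hm, of _ 0] integral_past[OF hm, of _ 0]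
    by (intro geometric_series_integrable[where m="\<integral>\<omega>. h (past 0 \<omega>) powr \<delta> \<partial>M"]) (simp_all add: order_eq_refl)
  then show "AE \<omega> in M. \<exists>C. \<forall>n. lm ^ n * h (past (t - int n) \<omega>) \<le> C"
  proof eventually_elim
    case (elim \<omega>)
    have e: "(lm powr \<delta>) ^ n * h (past (t - int n) \<omega>) powr \<delta> = (lm ^ n * h (past (t - int n) \<omega>)) powr \<delta>" for n
      using lam by (simp add: powr_mult power_powr_swap)
    let ?s = "\<Sum>n. (lm ^ n * h (past (t - int n) \<omega>)) powr \<delta>"
    have "lm ^ n * h (past (t - int n) \<omega>) \<le> ?s powr (1 / \<delta>)" for n
    proof -
      let ?a = "lm ^ n * h (past (t - int n) \<omega>)"
      have "?a powr \<delta> \<le> ?s"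
        using sum_le_suminf[OF elim[unfolded e], of "{n}"] by simp
      then have "(?a powr \<delta>) powr (1 / \<delta>) \<le> ?s powr (1 / \<delta>)" using \<delta> by (intro powr_mono2) simp_all
      moreover have "0 \<le> ?a" using lam h(2) by simp
      ultimately show ?thesis using \<delta> by (simp add: powr_powr)
    qed
    then show ?case by blast
  qed
qed

end

locale positive_garch = garch +
  assumes theta_pos: "\<And>l. l < p + q + 1 \<Longrightarrow> 0 < \<theta> l" and beta_sum: "(\<Sum>j=1..q. \<theta> (p + j)) < 1"
begin

lemma fractional_moments:
  obtains \<delta> where "0 < \<delta>" "\<delta> \<le> 1" "integrable M (\<lambda>\<omega>. ((vol (past 0 \<omega>))\<^sup>2) powr \<delta>)"
    "integrable M (\<lambda>\<omega>. ((obs (past 0 \<omega>))\<^sup>2) powr \<delta>)"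
proof -
  obtain \<delta> where \<delta>: "0 < \<delta>" "\<delta> \<le> 1" and I: "integrable M (\<lambda>\<omega>. ((vol (past 0 \<omega>))\<^sup>2) powr \<delta>)"
    by (rule fractional_moment_vol)
  have t1: "0 < \<theta> 1" using orders by (intro theta_pos) simp
  have "integrable M (\<lambda>\<omega>. ((obs (past 0 \<omega>))\<^sup>2) powr \<delta>)"
  proof (rule Bochner_Integration.integrable_bound)
    show "integrable M (\<lambda>\<omega>. (1 / \<theta> 1) powr \<delta> * ((vol (past 0 \<omega>))\<^sup>2) powr \<delta>)" using I by simp
    show "(\<lambda>\<omega>. ((obs (past 0 \<omega>))\<^sup>2) powr \<delta>) \<in> borel_measurable M"
    proof (rule measurable_past)
      show "(\<lambda>x. ((obs x)\<^sup>2) powr \<delta>) \<in> borel_measurable paths" using obs_measurable by measurable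
    qed
    show "AE \<omega> in M. norm (((obs (past 0 \<omega>))\<^sup>2) powr \<delta>) \<le> norm ((1 / \<theta> 1) powr \<delta> * ((vol (past 0 \<omega>))\<^sup>2) powr \<delta>)"
      using AE_model
    proof eventually_elim
      case (elim \<omega>)
      have "\<theta> 1 * (X (1 - int 1) \<omega>)\<^sup>2 \<le> (\<Sum>i=1..p. \<theta> i * (X (1 - int i) \<omega>)\<^sup>2)"
        using orders alpha by (intro member_le_sum) simp_all
      also have "\<dots> \<le> (\<sigma> 1 \<omega>)\<^sup>2"
      proof -
        have "0 \<le> (\<Sum>j=1..q. \<theta> (p + j) * (\<sigma> (1 - int j) \<omega>)\<^sup>2)" using beta by (intro sum_nonneg) simp
        then show ?thesis using elim[rule_format, of 1] alpha0 by linarith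
      qed
      finally have "(obs (past 0 \<omega>))\<^sup>2 \<le> 1 / \<theta> 1 * (vol (past 0 \<omega>))\<^sup>2"
      proof -
        have "\<sigma> 1 \<omega> = vol (past (1 - 1) \<omega>)" "X 0 \<omega> = obs (past 0 \<omega>)" using elim by blast+
        moreover assume "\<theta> 1 * (X (1 - int 1) \<omega>)\<^sup>2 \<le> (\<sigma> 1 \<omega>)\<^sup>2"
        ultimately have "\<theta> 1 * (obs (past 0 \<omega>))\<^sup>2 \<le> (vol (past 0 \<omega>))\<^sup>2" by simp
        then show ?thesis using t1 by (simp add: pos_le_divide_eq mult.commute)
      qed
      then have "((obs (past 0 \<omega>))\<^sup>2) powr \<delta> \<le> (1 / \<theta> 1 * (vol (past 0 \<omega>))\<^sup>2) powr \<delta>"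
        using \<delta> by (intro powr_mono2) simp_all
      then show ?case unfolding powr_mult by simp
    qed
  qed
  with \<delta> I show ?thesis using that by blast
qed

text \<open>The difference between the volatility and the series solves the homogeneous recursion, and
  the fractional moments limit its growth towards the past.\<close>

lemma sigma_eq_sigma2: "AE \<omega> in M. \<forall>t. (\<sigma> t \<omega>)\<^sup>2 = sigma2 p q \<theta> (\<lambda>s. X s \<omega>) t"
proof -
  obtain \<delta> where \<delta>: "0 < \<delta>" "\<delta> \<le> 1" and Iv: "integrable M (\<lambda>\<omega>. ((vol (past 0 \<omega>))\<^sup>2) powr \<delta>)"
    and Io: "integrable M (\<lambda>\<omega>. ((obs (past 0 \<omega>))\<^sup>2) powr \<delta>)" by (rule fractional_moments)
  let ?c = "c_coeff p q \<theta>" and ?b = "\<Sum>j=1..q. \<theta> (p + j)"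
  have cnn: "0 \<le> ?c i" for i by (rule c_coeff_nonneg[OF theta_nonneg beta_sum])
  obtain K r where K: "0 < K" and r: "0 < r" "r < 1" and cK: "\<And>i. ?c i \<le> K * r ^ i"
    using c_coeff_geometric[OF orders(2) theta_nonneg beta_sum] by metis
  \<comment> \<open>Close enough to \<open>1\<close> for the recursion to contract in the weighted norm and for the series to
    converge when the observations grow like the inverse powers.\<close>
  obtain lm where lam: "0 < lm" "lm < 1" "r < lm" "?b < lm ^ q"
  proof -
    define s where "s = max (max r (1 / 2)) (root q (max ?b 0))"
    have s: "r \<le> s" "0 < s" "root q (max ?b 0) \<le> s" "s < 1"
      using r beta_sum orders by (auto simp: s_def)
    define l where "l = (s + 1) / 2"
    have l: "s < l" "l < 1" "0 < l" using s by (auto simp: l_def)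
    have "max ?b 0 = root q (max ?b 0) ^ q" using orders by simp
    also have "\<dots> \<le> s ^ q" using s by (intro power_mono) (simp_all add: real_root_ge_zero)
    also have "\<dots> < l ^ q" using l s orders by (intro power_strict_mono) simp_all
    finally show ?thesis using that[of l] l s by simp
  qed
  have "AE \<omega> in M. \<forall>t. \<exists>C. \<forall>n. lm ^ n * (vol (past (t - int n) \<omega>))\<^sup>2 \<le> C"
    using vol_measurable by (intro AE_geometric_growth[OF _ _ \<delta>(1) Iv lam(1,2)]) simp_all
  moreover have "AE \<omega> in M. \<forall>t. \<exists>C. \<forall>n. lm ^ n * (obs (past (t - int n) \<omega>))\<^sup>2 \<le> C"
    using obs_measurable by (intro AE_geometric_growth[OF _ _ \<delta>(1) Io lam(1,2)]) simp_all
  ultimately show ?thesis using AE_model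
  proof eventually_elim
    case (elim \<omega>)
    let ?x = "\<lambda>s. X s \<omega>"
    let ?S = "sigma2 p q \<theta> ?x"
    have Xb: "\<exists>C. \<forall>n. lm ^ n * (?x (t - int n))\<^sup>2 \<le> C" for t using elim(2,3) by metis
    have sb: "\<exists>C. \<forall>n. lm ^ n * (\<sigma> (t - int n) \<omega>)\<^sup>2 \<le> C" for t
    proof -
      obtain C where "\<And>n. lm ^ n * (vol (past (t - 1 - int n) \<omega>))\<^sup>2 \<le> C" using elim(1) by metis
      moreover have "\<sigma> (t - int n) \<omega> = vol (past (t - 1 - int n) \<omega>)" for n
        using elim(3)[rule_format, of "t - int n"] by (simp add: algebra_simps)
      ultimately show ?thesis by metis
    qed
    have rl: "0 < r / lm" "r / lm < 1" using r lam by simp_all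
    have sg: "summable (\<lambda>m. (r / lm) ^ Suc m)" 
    proof -
      have "norm (r / lm) < 1" using rl by (simp only: real_norm_def abs_of_pos)
      from summable_geometric[OF this] show ?thesis by (subst summable_Suc_iff)
    qed
    have term_le: "lm ^ n * (?c (Suc m) * (?x (t - int n - int (Suc m)))\<^sup>2) \<le> K * C * (r / lm) ^ Suc m"
      if C: "\<And>n. lm ^ n * (?x (t - int n))\<^sup>2 \<le> C" for t C n m
    proof -
      have "lm ^ n * (?c (Suc m) * (?x (t - int n - int (Suc m)))\<^sup>2)
          = ?c (Suc m) * (lm ^ (n + Suc m) * (?x (t - int (n + Suc m)))\<^sup>2) / lm ^ Suc m"
        using lam(1) by (simp add: power_add algebra_simps)
      also have "\<dots> \<le> (K * r ^ Suc m) * C / lm ^ Suc m"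
        using lam(1) K r cnn by (intro divide_right_mono mult_mono cK C) simp_all
      finally show ?thesis by (simp add: power_divide mult_ac)
    qed
    have sm: "summable (\<lambda>m. ?c (Suc m) * (?x (t - int (Suc m)))\<^sup>2)" for t
    proof -
      obtain C where C: "\<And>n. lm ^ n * (?x (t - int n))\<^sup>2 \<le> C" using Xb by blast
      show ?thesis
        by (rule summable_comparison_test'[OF summable_mult[OF sg, of "K * C"], of 0])
          (use term_le[OF C, of 0] cnn in simp)
    qed
    have Sb: "\<exists>C. \<forall>n. lm ^ n * \<bar>?S (t - int n)\<bar> \<le> C" for t
    proof -
      obtain C where C: "\<And>n. lm ^ n * (?x (t - int n))\<^sup>2 \<le> C" using Xb by blast
      have "lm ^ n * \<bar>?S (t - int n)\<bar> \<le> ?c 0 + (\<Sum>m. K * C * (r / lm) ^ Suc m)" for n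
      proof -
        have "0 \<le> (\<Sum>m. ?c (Suc m) * (?x (t - int n - int (Suc m)))\<^sup>2)" using cnn by (intro suminf_nonneg sm) simp
        then have "lm ^ n * \<bar>?S (t - int n)\<bar> = lm ^ n * ?c 0 + lm ^ n * (\<Sum>m. ?c (Suc m) * (?x (t - int n - int (Suc m)))\<^sup>2)"
          unfolding sigma2_def using cnn[of 0] by (simp only: distrib_left abs_of_nonneg add_nonneg_nonneg)
        moreover have "lm ^ n * ?c 0 \<le> 1 * ?c 0" using cnn[of 0] lam by (intro mult_right_mono power_le_one) simp_all
        moreover have "lm ^ n * (\<Sum>m. ?c (Suc m) * (?x (t - int n - int (Suc m)))\<^sup>2)
            = (\<Sum>m. lm ^ n * (?c (Suc m) * (?x (t - int n - int (Suc m)))\<^sup>2))"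
          by (rule suminf_mult[OF sm, symmetric])
        moreover have "\<dots> \<le> (\<Sum>m. K * C * (r / lm) ^ Suc m)"
          by (intro suminf_le term_le[OF C] summable_mult sm sg)
        ultimately show ?thesis by linarith
      qed
      then show ?thesis by blast
    qed
    show ?case
    proof
      fix t
      define D where "D m = (\<sigma> (t - int m) \<omega>)\<^sup>2 - ?S (t - int m)" for m
      have Deq: "D m = (\<Sum>j=1..q. \<theta> (p + j) * D (m + j))" for m
      proof -
        have idx: "t - int (m + j) = t - int m - int j" for j by simp
        have "(\<sigma> (t - int m) \<omega>)\<^sup>2 = \<theta> 0 + (\<Sum>i=1..p. \<theta> i * (X (t - int m - int i) \<omega>)\<^sup>2)
            + (\<Sum>j=1..q. \<theta> (p + j) * (\<sigma> (t - int m - int j) \<omega>)\<^sup>2)"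
          using elim(3) by blast
        with sigma2_recursion[OF orders(2) less_imp_neq[OF beta_sum] sm, of "t - int m"]
        show ?thesis unfolding D_def idx right_diff_distrib sum_subtractf by linarith
      qed
      have rec: "\<bar>D m\<bar> \<le> (\<Sum>j=1..q. \<theta> (p + j) * \<bar>D (m + j)\<bar>)" for m
      proof -
        have "\<bar>D m\<bar> = \<bar>\<Sum>j=1..q. \<theta> (p + j) * D (m + j)\<bar>" by (simp only: Deq[symmetric])
        also have "\<dots> \<le> (\<Sum>j=1..q. \<bar>\<theta> (p + j) * D (m + j)\<bar>)" by (rule sum_abs)
        also have "\<dots> = (\<Sum>j=1..q. \<theta> (p + j) * \<bar>D (m + j)\<bar>)" using beta by (intro sum.cong) (simp_all add: abs_mult)
        finally show ?thesis .
      qed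
      obtain C1 where C1: "\<And>n. lm ^ n * (\<sigma> (t - int n) \<omega>)\<^sup>2 \<le> C1" using sb by blast
      obtain C2 where C2: "\<And>n. lm ^ n * \<bar>?S (t - int n)\<bar> \<le> C2" using Sb by blast
      have bd: "lm ^ m * \<bar>D m\<bar> \<le> C1 + C2" for m
      proof -
        have "\<bar>D m\<bar> \<le> (\<sigma> (t - int m) \<omega>)\<^sup>2 + \<bar>?S (t - int m)\<bar>" unfolding D_def by (rule order_trans[OF abs_triangle_ineq4]) simp
        then have "lm ^ m * \<bar>D m\<bar> \<le> lm ^ m * ((\<sigma> (t - int m) \<omega>)\<^sup>2 + \<bar>?S (t - int m)\<bar>)" using lam by (intro mult_left_mono) simp_all
        then show ?thesis using C1[of m] C2[of m] unfolding distrib_left by linarith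
      qed
      have "D 0 = 0"
        by (rule homogeneous_recursion_zero[OF rec _ lam(1) less_imp_le[OF lam(2)] lam(4) bd]) (rule beta)
      then show "(\<sigma> t \<omega>)\<^sup>2 = ?S t" by (simp add: D_def)
    qed
  qed
qed

end

section \<open>Expansion of the residuals\<close>

text \<open>The sequence \<open>1, X\<^sup>2\<^bsub>t-1\<^esub>, X\<^sup>2\<^bsub>t-2\<^esub>, \<dots>\<close>, so that a volatility is one series in its entries.\<close>

definition hist :: "(int \<Rightarrow> real) \<Rightarrow> int \<Rightarrow> nat \<Rightarrow> real" where
  "hist x t i = (if i = 0 then 1 else (x (t - int i))\<^sup>2)"

lemma hist_nonneg: "0 \<le> hist x t i" and hist_0: "hist x t 0 = 1"
  and hist_Suc: "hist x t (Suc m) = (x (t - int (Suc m)))\<^sup>2"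
  by (simp_all add: hist_def)

lemma sigma2_hist:
  assumes "summable (\<lambda>i. c_coeff p q u i * hist x t i)"
  shows "sigma2 p q u x t = (\<Sum>i. c_coeff p q u i * hist x t i)"
  using suminf_split_head[OF assms] unfolding sigma2_def hist_0 hist_Suc by simp

lemma grad_log_sigma2_hist:
  assumes "summable (\<lambda>i. grad_c p q u i l * hist x t i)" "summable (\<lambda>i. c_coeff p q u i * hist x t i)"
  shows "grad_log_sigma2 p q u x t l = (\<Sum>i. grad_c p q u i l * hist x t i) / (\<Sum>i. c_coeff p q u i * hist x t i)"
  using suminf_split_head[OF assms(1)] sigma2_hist[OF assms(2)]
  unfolding grad_log_sigma2_def hist_0 hist_Suc by simp

lemma sigma2_hat_hist: "sigma2_hat p q u x t = (\<Sum>i\<le>t. c_coeff p q u i * hist x (int t) i)"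
proof -
  have "(\<Sum>i\<le>t. c_coeff p q u i * hist x (int t) i) = c_coeff p q u 0 * hist x (int t) 0 + (\<Sum>i=1..t. c_coeff p q u i * hist x (int t) i)"
    by (simp only: atMost_atLeast0 sum.atLeast_Suc_atMost[OF le0] One_nat_def)
  also have "(\<Sum>i=1..t. c_coeff p q u i * hist x (int t) i) = (\<Sum>i=1..t. c_coeff p q u i * (x (int t - int i))\<^sup>2)"
    by (intro sum.cong) (auto simp: hist_def)
  finally show ?thesis by (simp only: sigma2_hat_def hist_0 mult_1_right)
qed

lemma one_plus_powr_le:
  fixes y Y \<kappa> :: real
  assumes "0 \<le> \<kappa>" "0 \<le> y" "y \<le> Y"
  shows "(1 + y) powr \<kappa> - 1 \<le> \<kappa> * y * (1 + Y) powr \<kappa>"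
proof -
  define a where "a = \<kappa> * ln (1 + y)"
  have "ln (1 + y) \<le> y" using assms by (intro ln_add_one_self_le_self)
  then have ay: "a \<le> \<kappa> * y" using assms by (auto simp: a_def intro!: mult_left_mono)
  have "1 + (- a) \<le> exp (- a)" by (rule exp_ge_add_one_self)
  then have "exp a * (1 + (- a)) \<le> exp a * exp (- a)" by (intro mult_left_mono) simp_all
  also have "\<dots> = 1" by (simp flip: exp_add)
  finally have "exp a - 1 \<le> a * exp a" by (simp add: algebra_simps)
  also have "\<dots> \<le> (\<kappa> * y) * exp a" using ay by (intro mult_right_mono) simp_all
  also have "exp a = (1 + y) powr \<kappa>" using assms by (simp add: a_def powr_def)
  finally have "(1 + y) powr \<kappa> - 1 \<le> (\<kappa> * y) * (1 + y) powr \<kappa>" .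
  also have "\<dots> \<le> (\<kappa> * y) * (1 + Y) powr \<kappa>" using assms by (intro mult_left_mono powr_mono2) simp_all
  finally show ?thesis .
qed

text \<open>The truncation of the volatility at the first observation changes it by a geometrically
  small amount, whose random factor is a function of the observations before time \<open>0\<close>. Only
  finiteness of that factor is needed, since it is the same for all \<open>t\<close>.\<close>

lemma residual_expansion:
  fixes \<theta> :: "nat \<Rightarrow> real" and \<delta> :: real and k :: nat
  assumes pq: "1 \<le> p" "1 \<le> q"
    and \<theta>: "\<And>l. l < p + q + 1 \<Longrightarrow> 0 < \<theta> l" and S: "(\<Sum>j=1..q. \<theta> (p + j)) < 1"
    and \<delta>: "0 < \<delta>" "\<delta> \<le> 1"
  obtains \<eta>0 B C where "0 < \<eta>0" "0 < B" "B < 1" "0 < C"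
    "\<And>x t l. summable (\<lambda>i. B ^ i * hist x t i powr \<delta>) \<Longrightarrow> l < p + q + 1 \<Longrightarrow>
       \<bar>grad_log_sigma2 p q \<theta> x t l\<bar> \<le> C * (\<Sum>i. B ^ i * hist x t i powr \<delta>)"
    "\<And>x t u \<eta> e. summable (\<lambda>i. B ^ i * hist x 0 i powr \<delta>) \<Longrightarrow> summable (\<lambda>i. B ^ i * hist x (int t) i powr \<delta>) \<Longrightarrow>
       0 \<le> \<eta> \<Longrightarrow> \<eta> \<le> \<eta>0 \<Longrightarrow> (\<And>l. l < p + q + 1 \<Longrightarrow> \<bar>u l - \<theta> l\<bar> \<le> \<eta> * \<theta> l) \<Longrightarrow>
       x (int t) = sqrt (sigma2 p q \<theta> x (int t)) * e \<Longrightarrow>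
       \<bar>\<bar>residual p q u x t ^ k - e ^ k\<bar>
          - real k / 2 * (\<bar>e\<bar> ^ k * \<bar>\<Sum>l<p + q + 1. grad_log_sigma2 p q \<theta> x (int t) l * (u l - \<theta> l)\<bar>)\<bar>
       \<le> \<bar>e\<bar> ^ k * (\<Sum>i. B ^ i * hist x (int t) i powr \<delta>)
           * (C * \<eta>\<^sup>2 + C * (C * (\<Sum>i. (B powr (1 / \<delta>)) ^ i * hist x 0 i)
                * (1 + C * (\<Sum>i. (B powr (1 / \<delta>)) ^ i * hist x 0 i)) powr (real k / 2)) * (B powr (1 / \<delta>)) ^ t)"
proof -
  define \<kappa> where "\<kappa> = real k / 2"
  have \<kappa>: "0 \<le> \<kappa>" by (simp add: \<kappa>_def)
  obtain \<eta>0 B C where c0: "0 < \<eta>0" "0 < B" "B < 1" "0 < C"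
    and P: "\<And>x. (\<And>i. 0 \<le> x i) \<Longrightarrow> x 0 = 1 \<Longrightarrow> summable (\<lambda>i. B ^ i * x i powr \<delta>) \<Longrightarrow>
       summable (\<lambda>i. (B powr (1 / \<delta>)) ^ i * x i) \<and>
       summable (\<lambda>i. c_coeff p q \<theta> i * x i) \<and> c_coeff p q \<theta> 0 \<le> (\<Sum>i. c_coeff p q \<theta> i * x i) \<and>
       (\<forall>l<p + q + 1. summable (\<lambda>i. grad_c p q \<theta> i l * x i) \<and>
          \<bar>(\<Sum>i. grad_c p q \<theta> i l * x i) / (\<Sum>i. c_coeff p q \<theta> i * x i)\<bar> \<le> C * (\<Sum>i. B ^ i * x i powr \<delta>))"
    and Q: "\<And>v \<eta>. 0 \<le> \<eta> \<Longrightarrow> \<eta> \<le> \<eta>0 \<Longrightarrow> (\<And>l. l < p + q + 1 \<Longrightarrow> \<bar>v l - \<theta> l\<bar> \<le> \<eta> * \<theta> l) \<Longrightarrow>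
       (\<forall>i. 0 \<le> c_coeff p q v i \<and> c_coeff p q v i \<le> C * (B powr (1 / \<delta>)) ^ i) \<and> 1 / C \<le> c_coeff p q v 0"
    and R: "\<And>x v \<eta>. (\<And>i. 0 \<le> x i) \<Longrightarrow> x 0 = 1 \<Longrightarrow> summable (\<lambda>i. B ^ i * x i powr \<delta>) \<Longrightarrow>
       0 \<le> \<eta> \<Longrightarrow> \<eta> \<le> \<eta>0 \<Longrightarrow> (\<And>l. l < p + q + 1 \<Longrightarrow> \<bar>v l - \<theta> l\<bar> \<le> \<eta> * \<theta> l) \<Longrightarrow>
       summable (\<lambda>i. c_coeff p q v i * x i) \<and>
       ((\<Sum>i. c_coeff p q \<theta> i * x i) / (\<Sum>i. c_coeff p q v i * x i)) powr \<kappa> \<le> C * (\<Sum>i. B ^ i * x i powr \<delta>) \<and>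
       \<bar>((\<Sum>i. c_coeff p q \<theta> i * x i) / (\<Sum>i. c_coeff p q v i * x i)) powr \<kappa> - 1
         + \<kappa> * (\<Sum>l<p + q + 1. (\<Sum>i. grad_c p q \<theta> i l * x i) / (\<Sum>i. c_coeff p q \<theta> i * x i) * (v l - \<theta> l))\<bar>
       \<le> C * \<eta>\<^sup>2 * (\<Sum>i. B ^ i * x i powr \<delta>)"
    by (rule volatility_expansion[where p=p and q=q and \<theta>=\<theta> and \<kappa>=\<kappa> and \<delta>=\<delta>, OF pq \<theta> S \<kappa> \<delta>]) blast+
  define rh where "rh = B powr (1 / \<delta>)"
  have rh: "0 < rh" "rh < 1" using c0 \<delta> powr_less_mono2[of "1 / \<delta>" B 1] by (simp_all add: rh_def)
  define C' where "C' = C + C\<^sup>2 + C * \<kappa>"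
  have C': "0 < C'" "C \<le> C'" "C\<^sup>2 \<le> C'" "C * \<kappa> \<le> C'" using c0 \<kappa> by (simp_all add: C'_def add_pos_nonneg)
  have c00: "0 < c_coeff p q \<theta> 0" by (rule c_coeff_pos[OF pq \<theta> S])
  show thesis
  proof (rule that[OF c0(1-3) C'(1)])
    fix x t l assume s: "summable (\<lambda>i. B ^ i * hist x t i powr \<delta>)" and l: "l < p + q + 1"
    note p = P[of "hist x t", OF hist_nonneg hist_0 s]
    have V: "0 \<le> (\<Sum>i. B ^ i * hist x t i powr \<delta>)" using c0 by (intro suminf_nonneg s) simp
    have "\<bar>grad_log_sigma2 p q \<theta> x t l\<bar> \<le> C * (\<Sum>i. B ^ i * hist x t i powr \<delta>)"
      using p l by (subst grad_log_sigma2_hist) blast+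
    also have "\<dots> \<le> C' * (\<Sum>i. B ^ i * hist x t i powr \<delta>)" by (intro mult_right_mono C' V)
    finally show "\<bar>grad_log_sigma2 p q \<theta> x t l\<bar> \<le> C' * (\<Sum>i. B ^ i * hist x t i powr \<delta>)" .
  next
    fix x t u \<eta> e
    assume s0: "summable (\<lambda>i. B ^ i * hist x 0 i powr \<delta>)" and st: "summable (\<lambda>i. B ^ i * hist x (int t) i powr \<delta>)"
      and eta: "0 \<le> \<eta>" "\<eta> \<le> \<eta>0" and u: "\<And>l. l < p + q + 1 \<Longrightarrow> \<bar>u l - \<theta> l\<bar> \<le> \<eta> * \<theta> l"
      and xt: "x (int t) = sqrt (sigma2 p q \<theta> x (int t)) * e"
    let ?h = "hist x (int t)"
    define V where "V = (\<Sum>i. B ^ i * ?h i powr \<delta>)"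
    define Qs where "Qs = (\<Sum>i. rh ^ i * hist x 0 i)"
    define S0 where "S0 = (\<Sum>i. c_coeff p q \<theta> i * ?h i)"
    define Su where "Su = (\<Sum>i. c_coeff p q u i * ?h i)"
    define H where "H = sigma2_hat p q u x t"
    define g where "g = (\<Sum>l<p + q + 1. grad_log_sigma2 p q \<theta> x (int t) l * (u l - \<theta> l))"
    note p = P[of ?h, OF hist_nonneg hist_0 st] and p0 = P[of "hist x 0", OF hist_nonneg hist_0 s0]
    note r = R[of ?h, OF hist_nonneg hist_0 st eta u] and cu = Q[OF eta u]
    have V0: "0 \<le> V" unfolding V_def using c0 by (intro suminf_nonneg st) simp
    have sq: "summable (\<lambda>i. rh ^ i * hist x 0 i)" using p0 by (simp add: rh_def)
    have Qs0: "0 \<le> Qs" unfolding Qs_def using rh by (intro suminf_nonneg sq) (simp add: hist_nonneg)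
    have S0pos: "0 < S0" using p c00 by (auto simp: S0_def)
    have S0eq: "sigma2 p q \<theta> x (int t) = S0" unfolding S0_def using p by (intro sigma2_hist) blast
    have gl: "grad_log_sigma2 p q \<theta> x (int t) l = (\<Sum>i. grad_c p q \<theta> i l * ?h i) / S0" if "l < p + q + 1" for l
      unfolding S0_def using p that by (intro grad_log_sigma2_hist) blast+
    have geq: "(\<Sum>l<p + q + 1. (\<Sum>i. grad_c p q \<theta> i l * ?h i) / (\<Sum>i. c_coeff p q \<theta> i * ?h i) * (u l - \<theta> l)) = g"
      unfolding g_def S0_def[symmetric] by (intro sum.cong) (simp_all add: gl)
    have su: "summable (\<lambda>i. c_coeff p q u i * ?h i)" using r by blast
    have cnn: "0 \<le> c_coeff p q u i" and cle: "c_coeff p q u i \<le> C * rh ^ i" for i using cu by (auto simp: rh_def)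
    have Hlow: "1 / C \<le> H"
    proof -
      have "1 / C \<le> c_coeff p q u 0 * ?h 0" using cu by (simp add: hist_0 del: c_coeff.simps)
      also have "\<dots> \<le> H" unfolding H_def sigma2_hat_hist
        by (intro member_le_sum) (auto intro!: mult_nonneg_nonneg cnn hist_nonneg)
      finally show ?thesis .
    qed
    have "0 < 1 / C" using c0 by simp
    then have Hpos: "0 < H" using Hlow by linarith
    \<comment> \<open>The omitted terms involve only observations before time \<open>0\<close>, shifted by \<open>t\<close> places.\<close>
    have tail: "Su \<le> H + C * rh ^ t * Qs"
    proof -
      have split: "Su = (\<Sum>i. c_coeff p q u (i + Suc t) * ?h (i + Suc t)) + H"
        unfolding Su_def H_def sigma2_hat_hist using suminf_split_initial_segment[OF su, of "Suc t"] by (simp only: lessThan_Suc_atMost)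
      have le: "c_coeff p q u (i + Suc t) * ?h (i + Suc t) \<le> C * rh ^ t * (rh ^ Suc i * hist x 0 (Suc i))" for i
      proof -
        have he: "?h (i + Suc t) = hist x 0 (Suc i)" by (simp add: hist_def algebra_simps)
        have "c_coeff p q u (i + Suc t) * ?h (i + Suc t) \<le> (C * rh ^ (i + Suc t)) * hist x 0 (Suc i)"
          unfolding he by (intro mult_right_mono cle hist_nonneg)
        then show ?thesis by (simp add: power_add mult_ac)
      qed
      have ss: "summable (\<lambda>i. rh ^ Suc i * hist x 0 (Suc i))" using sq by (subst summable_Suc_iff[of "\<lambda>i. rh ^ i * hist x 0 i"])
      have "(\<Sum>i. c_coeff p q u (i + Suc t) * ?h (i + Suc t)) \<le> (\<Sum>i. C * rh ^ t * (rh ^ Suc i * hist x 0 (Suc i)))"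
        by (intro suminf_le le summable_mult ss summable_ignore_initial_segment[OF su])
      also have "\<dots> = C * rh ^ t * (\<Sum>i. rh ^ Suc i * hist x 0 (Suc i))" by (rule suminf_mult[OF ss])
      also have "\<dots> \<le> C * rh ^ t * Qs"
      proof (intro mult_left_mono)
        show "(\<Sum>i. rh ^ Suc i * hist x 0 (Suc i)) \<le> Qs"
          unfolding Qs_def using suminf_split_head[OF sq] by (simp add: hist_0)
      qed (use c0 rh in simp)
      finally show ?thesis unfolding split by simp
    qed
    have HSu: "H \<le> Su" unfolding H_def Su_def sigma2_hat_hist
      using su by (intro sum_le_suminf) (auto intro!: mult_nonneg_nonneg cnn hist_nonneg)
    have Supos: "0 < Su" using HSu Hpos by linarith
    define y where "y = Su / H - 1"
    have y0: "0 \<le> y" using HSu Hpos by (simp add: y_def)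
    have yle: "y \<le> C' * Qs * rh ^ t"
    proof -
      have "y \<le> C * rh ^ t * Qs / H" 
      proof -
        have "Su / H \<le> (H + C * rh ^ t * Qs) / H" using tail Hpos by (intro divide_right_mono) simp_all
        then show ?thesis using Hpos by (simp add: y_def add_divide_distrib)
      qed
      also have "\<dots> \<le> C * rh ^ t * Qs / (1 / C)"
        using c0 rh Qs0 Hlow Hpos by (intro divide_left_mono) simp_all
      also have "\<dots> = C\<^sup>2 * (Qs * rh ^ t)" by (simp add: power2_eq_square)
      also have "\<dots> \<le> C' * (Qs * rh ^ t)" using Qs0 rh by (intro mult_right_mono C') simp
      finally show ?thesis by (simp add: mult.assoc)
    qed
    have yQ: "y \<le> C' * Qs"
    proof -
      have "C' * Qs * rh ^ t \<le> C' * Qs * 1" using C' Qs0 rh by (intro mult_left_mono power_le_one) simp_all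
      then show ?thesis using yle by simp
    qed
    define a where "a = (S0 / Su) powr \<kappa>"
    define b where "b = (S0 / H) powr \<kappa>"
    have aV: "a \<le> C * V" and aexp: "\<bar>a - 1 + \<kappa> * g\<bar> \<le> C * \<eta>\<^sup>2 * V"
      using r unfolding a_def S0_def Su_def V_def geq by blast+
    have ba: "b = a * (1 + y) powr \<kappa>"
    proof -
      have "S0 / H = (S0 / Su) * (1 + y)" using Supos by (simp add: y_def)
      then show ?thesis unfolding b_def a_def by (simp only: powr_mult)
    qed
    have a0: "0 \<le> a" by (simp add: a_def)
    have one: "1 powr \<kappa> \<le> (1 + y) powr \<kappa>" using y0 \<kappa> by (intro powr_mono2) simp_all
    then have "a * 1 \<le> b" unfolding ba using a0 by (intro mult_left_mono) simp_all
    then have "\<bar>b - a\<bar> = a * ((1 + y) powr \<kappa> - 1)" unfolding ba by (simp add: algebra_simps)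
    also have "\<dots> \<le> (C * V) * (\<kappa> * y * (1 + C' * Qs) powr \<kappa>)"
      using one_plus_powr_le[OF \<kappa> y0 yQ] aV a0 V0 c0 \<kappa> y0 one by (intro mult_mono) simp_all
    also have "\<dots> = V * (C * \<kappa>) * (y * (1 + C' * Qs) powr \<kappa>)" by simp
    also have "\<dots> \<le> V * C' * (C' * Qs * rh ^ t * (1 + C' * Qs) powr \<kappa>)"
      using V0 C' y0 yle c0 \<kappa> by (intro mult_mono mult_left_mono) simp_all
    finally have bma: "\<bar>b - a\<bar> \<le> V * (C' * (C' * Qs * (1 + C' * Qs) powr \<kappa>) * rh ^ t)" by (simp add: mult_ac)
    have res: "residual p q u x t ^ k = e ^ k * b"
    proof -
      have "residual p q u x t = e * sqrt (S0 / H)"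
        unfolding residual_def xt S0eq H_def[symmetric] by (simp add: real_sqrt_divide)
      moreover have "sqrt (S0 / H) ^ k = b"
      proof -
        have "sqrt (S0 / H) ^ k = (sqrt (S0 / H)) powr real k" using S0pos Hpos by (subst powr_realpow) simp_all
        also have "\<dots> = ((S0 / H) powr (1 / 2)) powr real k" using S0pos Hpos by (simp add: powr_half_sqrt)
        finally show ?thesis by (simp add: powr_powr b_def \<kappa>_def)
      qed
      ultimately show ?thesis by (simp add: power_mult_distrib)
    qed
    have abs: "\<bar>residual p q u x t ^ k - e ^ k\<bar> = \<bar>e\<bar> ^ k * \<bar>b - 1\<bar>"
      unfolding res power_abs[symmetric] abs_mult[symmetric] by (simp add: algebra_simps)
    have main: "\<bar>\<bar>b - 1\<bar> - \<kappa> * \<bar>g\<bar>\<bar> \<le> V * (C' * \<eta>\<^sup>2 + C' * (C' * Qs * (1 + C' * Qs) powr \<kappa>) * rh ^ t)"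
    proof -
      have kg: "\<kappa> * \<bar>g\<bar> = \<bar>\<kappa> * g\<bar>" using \<kappa> by (simp add: abs_mult)
      have "C * (\<eta>\<^sup>2 * V) \<le> C' * (\<eta>\<^sup>2 * V)" using V0 by (intro mult_right_mono C') simp
      then have "\<bar>a - 1 + \<kappa> * g\<bar> \<le> V * (C' * \<eta>\<^sup>2)" using aexp by (simp add: mult_ac)
      then show ?thesis using bma unfolding kg distrib_left by linarith
    qed
    have "\<bar>\<bar>e\<bar> ^ k * \<bar>b - 1\<bar> - \<kappa> * (\<bar>e\<bar> ^ k * \<bar>g\<bar>)\<bar> = \<bar>e\<bar> ^ k * \<bar>\<bar>b - 1\<bar> - \<kappa> * \<bar>g\<bar>\<bar>"
    proof -
      have "\<bar>e\<bar> ^ k * \<bar>b - 1\<bar> - \<kappa> * (\<bar>e\<bar> ^ k * \<bar>g\<bar>) = \<bar>e\<bar> ^ k * (\<bar>b - 1\<bar> - \<kappa> * \<bar>g\<bar>)" by (simp add: algebra_simps)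
      then show ?thesis by (simp add: abs_mult)
    qed
    also have "\<dots> \<le> \<bar>e\<bar> ^ k * (V * (C' * \<eta>\<^sup>2 + C' * (C' * Qs * (1 + C' * Qs) powr \<kappa>) * rh ^ t))"
      by (intro mult_left_mono main) simp
    finally show "\<bar>\<bar>residual p q u x t ^ k - e ^ k\<bar>
          - real k / 2 * (\<bar>e\<bar> ^ k * \<bar>\<Sum>l<p + q + 1. grad_log_sigma2 p q \<theta> x (int t) l * (u l - \<theta> l)\<bar>)\<bar>
       \<le> \<bar>e\<bar> ^ k * (\<Sum>i. B ^ i * hist x (int t) i powr \<delta>)
           * (C' * \<eta>\<^sup>2 + C' * (C' * (\<Sum>i. (B powr (1 / \<delta>)) ^ i * hist x 0 i)
                * (1 + C' * (\<Sum>i. (B powr (1 / \<delta>)) ^ i * hist x 0 i)) powr (real k / 2)) * (B powr (1 / \<delta>)) ^ t)"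
      unfolding abs g_def[symmetric] V_def[symmetric] rh_def[symmetric] Qs_def[symmetric] \<kappa>_def[symmetric]
      by (simp add: mult.assoc)
  qed
qed

section \<open>Convergence to zero in probability\<close>

context prob_space
begin

lemma null_in_prob_of_truncated_mean:
  fixes Z :: "nat \<Rightarrow> 'a \<Rightarrow> real"
  assumes Z: "\<And>n. Z n \<in> borel_measurable M" and lim: "(\<lambda>n. \<integral>\<omega>. min 1 \<bar>Z n \<omega>\<bar> \<partial>M) \<longlonglongrightarrow> 0"
  shows "null_in_prob M Z"
  unfolding null_in_prob_def
proof (intro allI impI)
  fix d :: real assume d: "0 < d"
  have I: "integrable M (\<lambda>\<omega>. min 1 \<bar>Z n \<omega>\<bar>)" for n
    by (rule integrable_const_bound[of _ 1]) (use Z in auto)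
  have le: "measure M {\<omega> \<in> space M. \<bar>Z n \<omega>\<bar> > d} \<le> (\<integral>\<omega>. min 1 \<bar>Z n \<omega>\<bar> \<partial>M) / min 1 d" for n
  proof -
    have "measure M {\<omega> \<in> space M. \<bar>Z n \<omega>\<bar> > d} \<le> measure M {\<omega> \<in> space M. min 1 d \<le> min 1 \<bar>Z n \<omega>\<bar>}"
      using Z[of n] by (intro finite_measure_mono) auto
    also have "\<dots> \<le> (\<integral>\<omega>. min 1 \<bar>Z n \<omega>\<bar> \<partial>M) / min 1 d"
      using I d by (intro integral_Markov_inequality_measure[where A="{}"]) auto
    finally show ?thesis .
  qed
  have "(\<lambda>n. (\<integral>\<omega>. min 1 \<bar>Z n \<omega>\<bar> \<partial>M) / min 1 d) \<longlonglongrightarrow> 0 / min 1 d" using d by (intro tendsto_divide lim tendsto_const) simp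
  then have up: "(\<lambda>n. (\<integral>\<omega>. min 1 \<bar>Z n \<omega>\<bar> \<partial>M) / min 1 d) \<longlonglongrightarrow> 0" by simp
  show "(\<lambda>n. measure M {\<omega> \<in> space M. \<bar>Z n \<omega>\<bar> > d}) \<longlonglongrightarrow> 0"
    by (rule tendsto_sandwich[OF _ _ tendsto_const up]) (auto intro!: always_eventually le)
qed

text \<open>The set in the definition of convergence to zero in probability has measure \<open>0\<close> by default if
  it is not measurable, so only the dominating variables have to be measurable.\<close>

lemma null_in_prob_criterion:
  fixes Y :: "nat \<Rightarrow> 'a \<Rightarrow> real"
  assumes crit: "\<And>d e. 0 < d \<Longrightarrow> 0 < e \<Longrightarrow> \<exists>E Z. (\<forall>n. E n \<in> events) \<and> (\<forall>n. Z n \<in> borel_measurable M) \<and>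
      (\<forall>\<^sub>F n in sequentially. prob (E n) \<le> e) \<and> null_in_prob M Z \<and>
      (\<forall>\<^sub>F n in sequentially. AE \<omega> in M. \<omega> \<notin> E n \<longrightarrow> \<bar>Y n \<omega>\<bar> \<le> d + Z n \<omega>)"
  shows "null_in_prob M Y"
  unfolding null_in_prob_def
proof (intro allI impI)
  fix d :: real assume d: "0 < d"
  show "(\<lambda>n. measure M {\<omega> \<in> space M. \<bar>Y n \<omega>\<bar> > d}) \<longlonglongrightarrow> 0"
  proof (rule LIMSEQ_I)
    fix r :: real assume r: "0 < r"
    then have r2: "0 < r / 2" by simp
    have d2: "0 < d / 2" using d by simp
    from crit[OF d2 r2] obtain E Z where E: "\<forall>n. E n \<in> events" and Z: "\<forall>n. Z n \<in> borel_measurable M"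
      and pE: "\<forall>\<^sub>F n in sequentially. prob (E n) \<le> r / 2" and nZ: "null_in_prob M Z"
      and le: "\<forall>\<^sub>F n in sequentially. AE \<omega> in M. \<omega> \<notin> E n \<longrightarrow> \<bar>Y n \<omega>\<bar> \<le> d / 2 + Z n \<omega>"
      by (elim exE conjE)
    have "(\<lambda>n. measure M {\<omega> \<in> space M. \<bar>Z n \<omega>\<bar> > d / 2}) \<longlonglongrightarrow> 0"
      by (rule nZ[unfolded null_in_prob_def, rule_format, OF d2])
    from order_tendstoD(2)[OF this r2]
    have "\<forall>\<^sub>F n in sequentially. measure M {\<omega> \<in> space M. \<bar>Z n \<omega>\<bar> > d / 2} < r / 2" .
    with pE le have "\<forall>\<^sub>F n in sequentially. norm (measure M {\<omega> \<in> space M. \<bar>Y n \<omega>\<bar> > d} - 0) < r"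
    proof eventually_elim
      case (elim n)
      let ?Z = "{\<omega> \<in> space M. \<bar>Z n \<omega>\<bar> > d / 2}"
      have Zm: "?Z \<in> events" using Z[rule_format, of n] by measurable
      have "measure M {\<omega> \<in> space M. \<bar>Y n \<omega>\<bar> > d} \<le> measure M (E n \<union> ?Z)"
      proof (rule finite_measure_mono_AE)
        show "AE \<omega> in M. \<omega> \<in> {\<omega> \<in> space M. \<bar>Y n \<omega>\<bar> > d} \<longrightarrow> \<omega> \<in> E n \<union> ?Z"
          using elim(2) by eventually_elim auto
      qed (use E Zm in auto)
      also have "\<dots> \<le> prob (E n) + prob ?Z" using E Zm by (intro measure_Un_le) auto
      finally show ?case using elim(1,3) by simp
    qed
    then show "\<exists>no. \<forall>n\<ge>no. norm (measure M {\<omega> \<in> space M. \<bar>Y n \<omega>\<bar> > d} - 0) < r"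
      by (simp add: eventually_sequentially)
  qed
qed

end

section \<open>The limit of the averages\<close>

lemma finite_grid:
  fixes K m :: real and d :: nat
  assumes "0 < m"
  obtains G where "finite G"
    "\<And>v. (\<And>l. l < d \<Longrightarrow> \<bar>v l\<bar> \<le> K) \<Longrightarrow> \<exists>w\<in>G. \<forall>l<d. \<bar>v l - w l\<bar> \<le> m"
proof -
  define N where "N = \<lceil>K / m\<rceil> + 1"
  define G where "G = Pi\<^sub>E {..<d} (\<lambda>_. (\<lambda>i. m * real_of_int i) ` {-N..N})"
  have "finite G" unfolding G_def by (intro finite_PiE) simp_all
  moreover have "\<exists>w\<in>G. \<forall>l<d. \<bar>v l - w l\<bar> \<le> m" if v: "\<And>l. l < d \<Longrightarrow> \<bar>v l\<bar> \<le> K" for v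
  proof
    let ?w = "\<lambda>l\<in>{..<d}. m * real_of_int \<lfloor>v l / m\<rfloor>"
    show "?w \<in> G" unfolding G_def
    proof (rule restrict_PiE_iff[THEN iffD2], intro ballI imageI)
      fix l assume "l \<in> {..<d}"
      then have "\<bar>v l\<bar> \<le> K" using v by simp
      then have "(- K) / m \<le> v l / m" "v l / m \<le> K / m"
        using assms by (intro divide_right_mono; simp)+
      then have "- (K / m) \<le> v l / m" "v l / m \<le> K / m" by simp_all
      then show "\<lfloor>v l / m\<rfloor> \<in> {-N..N}" unfolding N_def by (simp, linarith)
    qed
    show "\<forall>l<d. \<bar>v l - ?w l\<bar> \<le> m"
    proof (intro allI impI)
      fix l assume l: "l < d"
      have "real_of_int \<lfloor>v l / m\<rfloor> \<le> v l / m" "v l / m \<le> real_of_int \<lfloor>v l / m\<rfloor> + 1" by linarith+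
      then have "m * real_of_int \<lfloor>v l / m\<rfloor> \<le> m * (v l / m)" "m * (v l / m) \<le> m * (real_of_int \<lfloor>v l / m\<rfloor> + 1)"
        using assms by (simp_all only: mult_left_mono less_imp_le)
      then have "m * real_of_int \<lfloor>v l / m\<rfloor> \<le> v l" "v l \<le> m * real_of_int \<lfloor>v l / m\<rfloor> + m"
        using assms by (simp_all add: distrib_left)
      then show "\<bar>v l - ?w l\<bar> \<le> m" using l by simp
    qed
  qed
  ultimately show ?thesis using that by blast
qed

context positive_garch
begin

definition hist_fun :: "(nat \<Rightarrow> real) \<Rightarrow> nat \<Rightarrow> real" where
  "hist_fun x i = (if i = 0 then 1 else (obs (shift i x))\<^sup>2)"

lemma hist_fun_measurable: "(\<lambda>x. hist_fun x i) \<in> borel_measurable paths"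
proof -
  have "(\<lambda>x. (obs (shift i x))\<^sup>2) \<in> borel_measurable paths" by (intro borel_measurable_power measurable_shift obs_measurable)
  then show ?thesis unfolding hist_fun_def by (cases "i = 0") simp_all
qed

lemma AE_hist: "AE \<omega> in M. \<forall>t. hist (\<lambda>s. X s \<omega>) t = hist_fun (past t \<omega>)"
  using AE_model
proof eventually_elim
  case (elim \<omega>)
  have "X (t - int i) \<omega> = obs (shift i (past t \<omega>))" for t i
  proof -
    have "X (t - int i) \<omega> = obs (past (t - int i) \<omega>)" using elim by blast
    then show ?thesis by (simp only: past_shift)
  qed
  then show ?case by (simp add: hist_def hist_fun_def fun_eq_iff)
qed

definition grad_fun :: "nat \<Rightarrow> (nat \<Rightarrow> real) \<Rightarrow> real" where
  "grad_fun l x = (grad_c p q \<theta> 0 l * hist_fun x 0 + (\<Sum>m. grad_c p q \<theta> (Suc m) l * hist_fun x (Suc m)))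
     / (c_coeff p q \<theta> 0 * hist_fun x 0 + (\<Sum>m. c_coeff p q \<theta> (Suc m) * hist_fun x (Suc m)))"

lemma grad_fun_measurable: "grad_fun l \<in> borel_measurable paths"
  unfolding grad_fun_def[abs_def]
  by (intro borel_measurable_divide borel_measurable_add borel_measurable_times borel_measurable_suminf
      borel_measurable_const hist_fun_measurable)

lemma AE_grad: "AE \<omega> in M. \<forall>t l. grad_log_sigma2 p q \<theta> (\<lambda>s. X s \<omega>) t l = grad_fun l (past t \<omega>)"
  using AE_hist
proof eventually_elim
  case (elim \<omega>)
  have "hist_fun (past t \<omega>) 0 = 1" for t by (simp add: hist_fun_def)
  moreover have "(X (t - int (Suc m)) \<omega>)\<^sup>2 = hist_fun (past t \<omega>) (Suc m)" for t m
    using elim hist_Suc[of "\<lambda>s. X s \<omega>" t m] by simp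
  ultimately show ?case unfolding grad_log_sigma2_def sigma2_def grad_fun_def by simp
qed

text \<open>The innovation at time \<open>t\<close> is independent of the earlier observations, so a moment of order
  \<open>k\<close> of the one and a fractional moment of the others are enough for the products.\<close>

lemma weighted_history_integrable:
  assumes moment: "integrable M (\<lambda>\<omega>. \<bar>\<epsilon> 0 \<omega>\<bar> ^ k)"
    and \<delta>: "integrable M (\<lambda>\<omega>. ((obs (past 0 \<omega>))\<^sup>2) powr \<delta>)" and B: "0 < B" "B < 1"
  shows "AE \<omega> in M. summable (\<lambda>i. B ^ i * (\<bar>\<epsilon> t \<omega>\<bar> ^ k * hist_fun (past t \<omega>) i powr \<delta>))"
    "integrable M (\<lambda>\<omega>. \<Sum>i. B ^ i * (\<bar>\<epsilon> t \<omega>\<bar> ^ k * hist_fun (past t \<omega>) i powr \<delta>))"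
proof -
  have x0_m: "(\<lambda>x. \<bar>x 0\<bar> ^ k) \<in> borel_measurable (paths :: (nat \<Rightarrow> real) measure)"
    using coordinate_measurable[of 0] by measurable
  have mt: "integrable M (\<lambda>\<omega>. \<bar>\<epsilon> t \<omega>\<bar> ^ k)"
    using integrable_past[OF x0_m, of t 0] moment by (simp add: past_def)
  define a where "a = (\<integral>\<omega>. \<bar>\<epsilon> t \<omega>\<bar> ^ k \<partial>M)"
  define b where "b = (\<integral>\<omega>. ((obs (past 0 \<omega>))\<^sup>2) powr \<delta> \<partial>M)"
  have om: "(\<lambda>x. ((obs x)\<^sup>2) powr \<delta>) \<in> borel_measurable paths" using obs_measurable by measurable
  have "0 \<le> a" "0 \<le> b" by (simp_all add: a_def b_def)
  have *: "integrable M (\<lambda>\<omega>. \<bar>\<epsilon> t \<omega>\<bar> ^ k * hist_fun (past t \<omega>) i powr \<delta>)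
      \<and> (\<integral>\<omega>. \<bar>\<epsilon> t \<omega>\<bar> ^ k * hist_fun (past t \<omega>) i powr \<delta> \<partial>M) \<le> a * max 1 b" for i
  proof (cases "i = 0")
    case True
    then show ?thesis using mt \<open>0 \<le> a\<close> by (simp add: hist_fun_def a_def[symmetric] mult_le_cancel_left1)
  next
    case False
    have e: "hist_fun (past t \<omega>) i = (obs (past (t - int i) \<omega>))\<^sup>2" for \<omega>
      using False past_shift[of t i \<omega>] by (simp add: hist_fun_def)
    have Ib: "integrable M (\<lambda>\<omega>. ((obs (past (t - int i) \<omega>))\<^sup>2) powr \<delta>)"
      using \<delta> integrable_past[OF om, of "t - int i" 0] by simp
    have Eb: "(\<integral>\<omega>. ((obs (past (t - int i) \<omega>))\<^sup>2) powr \<delta> \<partial>M) = b"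
      unfolding b_def by (rule integral_past[OF om])
    have "(\<lambda>e. e t) \<in> borel_measurable (Pi\<^sub>M {t} (\<lambda>_. borel :: real measure))"
      by (rule measurable_component_singleton) simp
    then have "(\<lambda>e. \<bar>e t\<bar> ^ k) \<in> borel_measurable (Pi\<^sub>M {t} (\<lambda>_. borel :: real measure))"
      by measurable
    then have "indep_var borel (\<lambda>\<omega>. \<bar>(\<lambda>s\<in>{t}. \<epsilon> s \<omega>) t\<bar> ^ k) borel (\<lambda>\<omega>. ((obs (past (t - int i) \<omega>))\<^sup>2) powr \<delta>)"
      using False by (intro indep_var_past om) auto
    then have ind: "indep_var borel (\<lambda>\<omega>. \<bar>\<epsilon> t \<omega>\<bar> ^ k) borel (\<lambda>\<omega>. ((obs (past (t - int i) \<omega>))\<^sup>2) powr \<delta>)" by simp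
    have "a * b \<le> a * max 1 b" using \<open>0 \<le> a\<close> by (intro mult_left_mono) simp_all
    then show ?thesis
      unfolding e using indep_var_integrable[OF ind mt Ib] indep_var_lebesgue_integral[OF ind mt Ib]
      by (simp add: a_def[symmetric] Eb)
  qed
  show "AE \<omega> in M. summable (\<lambda>i. B ^ i * (\<bar>\<epsilon> t \<omega>\<bar> ^ k * hist_fun (past t \<omega>) i powr \<delta>))"
    using * B by (intro geometric_series_integrable(1)[where m="a * max 1 b"]) simp_all
  show "integrable M (\<lambda>\<omega>. \<Sum>i. B ^ i * (\<bar>\<epsilon> t \<omega>\<bar> ^ k * hist_fun (past t \<omega>) i powr \<delta>))"
    using * B by (intro geometric_series_integrable(2)[where m="a * max 1 b"]) simp_all
qed

text \<open>Uniformly over bounded directions the residual deviations are, up to terms that vanish in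
  probability, the averages of a stationary functional. Both the average and its limit are
  Lipschitz in the direction, so finitely many directions suffice.\<close>

theorem residual_power_deviation:
  fixes \<theta>hat :: "nat \<Rightarrow> 'a \<Rightarrow> nat \<Rightarrow> real" and k :: nat
  assumes hatm: "\<And>n l. l < p + q + 1 \<Longrightarrow> (\<lambda>\<omega>. \<theta>hat n \<omega> l) \<in> borel_measurable M"
    and rate: "bounded_in_prob M
                 (\<lambda>n \<omega>. sqrt (real n) * max_norm (p + q + 1) (\<lambda>l. \<theta>hat n \<omega> l - \<theta> l))"
    and moment: "integrable M (\<lambda>\<omega>. \<bar>\<epsilon> 0 \<omega>\<bar> ^ k)"
  shows "null_in_prob M (\<lambda>n \<omega>.
           \<bar>1 / sqrt (real n)
              * (\<Sum>t=1..n. \<bar>residual p q (\<theta>hat n \<omega>) (\<lambda>s. X s \<omega>) t ^ k - \<epsilon> (int t) \<omega> ^ k\<bar>)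
            - real k / 2 * psi M p q \<theta> \<epsilon> X k (\<lambda>l. sqrt (real n) * (\<theta>hat n \<omega> l - \<theta> l))\<bar>)"
proof -
  let ?d = "p + q + 1"
  define \<kappa> where "\<kappa> = real k / 2"
  have \<kappa>: "0 \<le> \<kappa>" by (simp add: \<kappa>_def)
  obtain \<delta> where \<delta>: "0 < \<delta>" "\<delta> \<le> 1" and Io: "integrable M (\<lambda>\<omega>. ((obs (past 0 \<omega>))\<^sup>2) powr \<delta>)"
    by (rule fractional_moments)
  obtain \<eta>0 B C where c0: "0 < \<eta>0" "0 < B" "B < 1" "0 < C"
    and gradb: "\<And>x t l. summable (\<lambda>i. B ^ i * hist x t i powr \<delta>) \<Longrightarrow> l < p + q + 1 \<Longrightarrow>
       \<bar>grad_log_sigma2 p q \<theta> x t l\<bar> \<le> C * (\<Sum>i. B ^ i * hist x t i powr \<delta>)"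
    and expand: "\<And>x t u \<eta> e. summable (\<lambda>i. B ^ i * hist x 0 i powr \<delta>) \<Longrightarrow> summable (\<lambda>i. B ^ i * hist x (int t) i powr \<delta>) \<Longrightarrow>
       0 \<le> \<eta> \<Longrightarrow> \<eta> \<le> \<eta>0 \<Longrightarrow> (\<And>l. l < p + q + 1 \<Longrightarrow> \<bar>u l - \<theta> l\<bar> \<le> \<eta> * \<theta> l) \<Longrightarrow>
       x (int t) = sqrt (sigma2 p q \<theta> x (int t)) * e \<Longrightarrow>
       \<bar>\<bar>residual p q u x t ^ k - e ^ k\<bar>
          - real k / 2 * (\<bar>e\<bar> ^ k * \<bar>\<Sum>l<p + q + 1. grad_log_sigma2 p q \<theta> x (int t) l * (u l - \<theta> l)\<bar>)\<bar>
       \<le> \<bar>e\<bar> ^ k * (\<Sum>i. B ^ i * hist x (int t) i powr \<delta>)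
           * (C * \<eta>\<^sup>2 + C * (C * (\<Sum>i. (B powr (1 / \<delta>)) ^ i * hist x 0 i)
                * (1 + C * (\<Sum>i. (B powr (1 / \<delta>)) ^ i * hist x 0 i)) powr (real k / 2)) * (B powr (1 / \<delta>)) ^ t)"
    by (rule residual_expansion[where p=p and q=q and \<theta>=\<theta> and \<delta>=\<delta> and k=k, OF orders theta_pos beta_sum \<delta>]) blast+
  define rh where "rh = B powr (1 / \<delta>)"
  have rh: "0 < rh" "rh < 1" using c0 \<delta> powr_less_mono2[of "1 / \<delta>" B 1] by (simp_all add: rh_def)
  define V where "V x = (\<Sum>i. B ^ i * hist_fun x i powr \<delta>)" for x
  \<comment> \<open>The absolute value only matters where the series diverges.\<close>
  define z where "z x = \<bar>\<Sum>i. B ^ i * (\<bar>x 0\<bar> ^ k * hist_fun x i powr \<delta>)\<bar>" for x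
  \<comment> \<open>The stationary functional in the direction \<open>v\<close>, and its Lipschitz constant in \<open>v\<close>.\<close>
  define f where "f v x = \<bar>x 0\<bar> ^ k * \<bar>\<Sum>l<?d. grad_fun l x * v l\<bar>" for v x
  define Lam where "Lam x = \<bar>x 0\<bar> ^ k * (\<Sum>l<?d. \<bar>grad_fun l x\<bar>)" for x
  have pow_m: "(\<lambda>x. hist_fun x i powr \<delta>) \<in> borel_measurable paths" for i using hist_fun_measurable[of i] by measurable
  have x0_m: "(\<lambda>x. \<bar>x 0\<bar> ^ k) \<in> borel_measurable (paths :: (nat \<Rightarrow> real) measure)" using coordinate_measurable[of 0] by measurable
  have z_m: "z \<in> borel_measurable paths" unfolding z_def[abs_def]
    by (intro borel_measurable_abs borel_measurable_suminf borel_measurable_times borel_measurable_const pow_m x0_m)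
  have f_m: "f v \<in> borel_measurable paths" for v unfolding f_def[abs_def]
    by (intro borel_measurable_times x0_m borel_measurable_abs borel_measurable_sum grad_fun_measurable borel_measurable_const)
  have Lam_m: "Lam \<in> borel_measurable paths" unfolding Lam_def[abs_def]
    by (intro borel_measurable_times x0_m borel_measurable_abs borel_measurable_sum grad_fun_measurable)
  have p0: "past t \<omega> 0 = \<epsilon> t \<omega>" for t \<omega> by (simp add: past_def)
  have z0: "0 \<le> z x" for x by (simp add: z_def)
  have Iz: "integrable M (\<lambda>\<omega>. z (past 0 \<omega>))"
    using integrable_abs[OF weighted_history_integrable(2)[OF moment Io c0(2,3), of 0]] by (simp add: z_def p0)
  have sV: "AE \<omega> in M. \<forall>t. summable (\<lambda>i. B ^ i * hist_fun (past t \<omega>) i powr \<delta>)"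
    using weighted_history_integrable(1)[OF _ Io c0(2,3), where k=0] by (simp add: AE_all_countable)
  have zV: "z x = \<bar>x 0\<bar> ^ k * V x" if "summable (\<lambda>i. B ^ i * hist_fun x i powr \<delta>)" for x
  proof -
    have "0 \<le> V x" unfolding V_def using c0 by (intro suminf_nonneg that) simp
    moreover have "(\<Sum>i. B ^ i * (\<bar>x 0\<bar> ^ k * hist_fun x i powr \<delta>)) = \<bar>x 0\<bar> ^ k * V x"
      unfolding V_def suminf_mult[OF that, symmetric] by (simp add: mult_ac)
    ultimately show ?thesis by (simp add: z_def)
  qed
  have LamV: "AE \<omega> in M. Lam (past 0 \<omega>) \<le> (real ?d * C) * z (past 0 \<omega>)"
    using sV AE_grad AE_hist
  proof eventually_elim
    case (elim \<omega>)
    have "(\<Sum>l<?d. \<bar>grad_fun l (past 0 \<omega>)\<bar>) \<le> (\<Sum>l<?d. C * V (past 0 \<omega>))"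
    proof (rule sum_mono)
      fix l assume "l \<in> {..<?d}"
      then show "\<bar>grad_fun l (past 0 \<omega>)\<bar> \<le> C * V (past 0 \<omega>)"
        using gradb[of "\<lambda>s. X s \<omega>" 0 l] elim by (simp add: V_def)
    qed
    then have "Lam (past 0 \<omega>) \<le> \<bar>past 0 \<omega> 0\<bar> ^ k * (real ?d * (C * V (past 0 \<omega>)))"
      unfolding Lam_def by (intro mult_left_mono) simp_all
    then show ?case using zV[of "past 0 \<omega>"] elim(1) by (simp add: mult_ac)
  qed
  have Lam0: "0 \<le> Lam x" for x unfolding Lam_def by (intro mult_nonneg_nonneg sum_nonneg) simp_all
  have ILam: "integrable M (\<lambda>\<omega>. Lam (past 0 \<omega>))"
  proof (rule Bochner_Integration.integrable_bound)
    show "integrable M (\<lambda>\<omega>. (real ?d * C) * z (past 0 \<omega>))" by (intro integrable_mult_right Iz)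
    show "AE \<omega> in M. norm (Lam (past 0 \<omega>)) \<le> norm ((real ?d * C) * z (past 0 \<omega>))"
      using LamV by eventually_elim (use Lam0 z0 c0 in \<open>simp add: abs_mult\<close>)
  qed (rule measurable_past[OF Lam_m])
  have flip: "\<bar>f v x - f w x\<bar> \<le> m * Lam x" if m: "\<And>l. l < ?d \<Longrightarrow> \<bar>v l - w l\<bar> \<le> m" for v w x m
  proof -
    have "f v x - f w x = \<bar>x 0\<bar> ^ k * (\<bar>\<Sum>l<?d. grad_fun l x * v l\<bar> - \<bar>\<Sum>l<?d. grad_fun l x * w l\<bar>)"
      by (simp only: f_def right_diff_distrib)
    then have "\<bar>f v x - f w x\<bar> = \<bar>x 0\<bar> ^ k * \<bar>\<bar>\<Sum>l<?d. grad_fun l x * v l\<bar> - \<bar>\<Sum>l<?d. grad_fun l x * w l\<bar>\<bar>"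
      by (simp only: abs_mult power_abs abs_idempotent)
    also have "\<dots> \<le> \<bar>x 0\<bar> ^ k * \<bar>(\<Sum>l<?d. grad_fun l x * v l) - (\<Sum>l<?d. grad_fun l x * w l)\<bar>"
      by (intro mult_left_mono abs_triangle_ineq3) simp
    also have "(\<Sum>l<?d. grad_fun l x * v l) - (\<Sum>l<?d. grad_fun l x * w l) = (\<Sum>l<?d. grad_fun l x * (v l - w l))"
      by (simp only: sum_subtractf right_diff_distrib)
    also have "\<bar>x 0\<bar> ^ k * \<bar>\<Sum>l<?d. grad_fun l x * (v l - w l)\<bar> \<le> \<bar>x 0\<bar> ^ k * (\<Sum>l<?d. \<bar>grad_fun l x\<bar> * m)"
    proof (intro mult_left_mono order_trans[OF sum_abs] sum_mono)
      fix l assume "l \<in> {..<?d}"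
      then show "\<bar>grad_fun l x * (v l - w l)\<bar> \<le> \<bar>grad_fun l x\<bar> * m"
        unfolding abs_mult by (intro mult_left_mono m) simp_all
    qed simp
    also have "\<dots> = m * Lam x" unfolding Lam_def sum_distrib_right[symmetric] by (simp only: mult_ac)
    finally show ?thesis .
  qed
  have If: "integrable M (\<lambda>\<omega>. f v (past 0 \<omega>))" for v
  proof (rule Bochner_Integration.integrable_bound)
    define m where "m = Max ((\<lambda>l. \<bar>v l\<bar>) ` {..<?d})"
    have m: "\<bar>v l - 0\<bar> \<le> m" if "l < ?d" for l
    proof -
      have "\<bar>v l\<bar> \<in> (\<lambda>l. \<bar>v l\<bar>) ` {..<?d}" using that by simp
      then show ?thesis unfolding m_def diff_0_right by (intro Max_ge) simp_all
    qed
    show "integrable M (\<lambda>\<omega>. m * Lam (past 0 \<omega>))" by (intro integrable_mult_right ILam)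
    show "AE \<omega> in M. norm (f v (past 0 \<omega>)) \<le> norm (m * Lam (past 0 \<omega>))"
    proof (rule AE_I2)
      fix \<omega>
      have "f (\<lambda>_. 0) (past 0 \<omega>) = 0" by (simp add: f_def)
      then show "norm (f v (past 0 \<omega>)) \<le> norm (m * Lam (past 0 \<omega>))"
        using flip[of v "\<lambda>_. 0" m "past 0 \<omega>"] m by (simp add: order_trans[OF _ abs_ge_self])
    qed
  qed (rule measurable_past[OF f_m])
  have psi: "psi M p q \<theta> \<epsilon> X k v = (\<integral>\<omega>. f v (past 0 \<omega>) \<partial>M)" for v
    unfolding psi_def
  proof (rule integral_cong_AE)
    have Xm: "(\<lambda>\<omega>. (X t \<omega>)\<^sup>2) \<in> borel_measurable M" for t by (intro borel_measurable_power X_rv)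
    have gm: "(\<lambda>\<omega>. grad_log_sigma2 p q \<theta> (\<lambda>s. X s \<omega>) 0 l) \<in> borel_measurable M" for l
      unfolding grad_log_sigma2_def sigma2_def
      by (intro borel_measurable_divide borel_measurable_add borel_measurable_times borel_measurable_suminf borel_measurable_const Xm)
    show "(\<lambda>\<omega>. \<bar>inner_prod ?d (\<lambda>l. \<epsilon> 0 \<omega> ^ k * grad_log_sigma2 p q \<theta> (\<lambda>s. X s \<omega>) 0 l) v\<bar>) \<in> borel_measurable M"
      unfolding inner_prod_def
      by (intro borel_measurable_abs borel_measurable_sum borel_measurable_times borel_measurable_power eps_measurable gm borel_measurable_const)
    show "(\<lambda>\<omega>. f v (past 0 \<omega>)) \<in> borel_measurable M" by (rule measurable_past[OF f_m])
    show "AE \<omega> in M. \<bar>inner_prod ?d (\<lambda>l. \<epsilon> 0 \<omega> ^ k * grad_log_sigma2 p q \<theta> (\<lambda>s. X s \<omega>) 0 l) v\<bar> = f v (past 0 \<omega>)"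
      using AE_grad
    proof eventually_elim
      case (elim \<omega>)
      have "inner_prod ?d (\<lambda>l. \<epsilon> 0 \<omega> ^ k * grad_log_sigma2 p q \<theta> (\<lambda>s. X s \<omega>) 0 l) v
          = \<epsilon> 0 \<omega> ^ k * (\<Sum>l<?d. grad_fun l (past 0 \<omega>) * v l)"
        unfolding inner_prod_def sum_distrib_left using elim by (intro sum.cong refl) (simp only: mult.assoc)
      then show ?case by (simp only: f_def p0 abs_mult power_abs)
    qed
  qed
  let ?A = "\<lambda>g n \<omega>. (\<Sum>t=1..n. g (past (int t) \<omega>)) / real n"
  define Qs where "Qs \<omega> = (\<Sum>i. rh ^ i * hist (\<lambda>s. X s \<omega>) 0 i)" for \<omega>
  define W where "W \<omega> = C * (C * Qs \<omega> * (1 + C * Qs \<omega>) powr \<kappa>)" for \<omega>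
  define T where "T \<omega> = (\<Sum>t. rh ^ t * z (past (int t) \<omega>))" for \<omega>
  have Izt: "integrable M (\<lambda>\<omega>. z (past t \<omega>))" for t using Iz integrable_past[OF z_m, of t 0] by simp
  have sT: "AE \<omega> in M. summable (\<lambda>t. rh ^ t * z (past (int t) \<omega>))"
    using rh Izt z0 integral_past[OF z_m, of _ 0]
    by (intro geometric_series_integrable(1)[where m="\<integral>\<omega>. z (past 0 \<omega>) \<partial>M"]) (simp_all add: order_eq_refl)
  have Q_m: "Qs \<in> borel_measurable M"
  proof -
    have "(\<lambda>\<omega>. hist (\<lambda>s. X s \<omega>) 0 i) \<in> borel_measurable M" for i
      using X_rv[of "0 - int i"] by (cases "i = 0") (simp_all add: hist_def)
    then show ?thesis unfolding Qs_def[abs_def]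
      by (intro borel_measurable_suminf borel_measurable_times borel_measurable_const)
  qed
  have T_m: "T \<in> borel_measurable M" unfolding T_def[abs_def]
    by (intro borel_measurable_suminf borel_measurable_times borel_measurable_const measurable_past[OF z_m])
  have WT_m: "(\<lambda>\<omega>. W \<omega> * T \<omega>) \<in> borel_measurable M" unfolding W_def using Q_m T_m by measurable
  define tmin where "tmin = Min (\<theta> ` {..<?d})"
  have tmin: "0 < tmin" "\<And>l. l < ?d \<Longrightarrow> tmin \<le> \<theta> l"
    unfolding tmin_def by (subst Min_gr_iff) (auto intro: theta_pos)
  show ?thesis
  proof (rule null_in_prob_criterion)
    fix d e :: real assume d: "0 < d" and e: "0 < e"
    obtain K0 where K0: "\<forall>\<^sub>F n in sequentially. measure M {\<omega> \<in> space M.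
        \<bar>sqrt (real n) * max_norm ?d (\<lambda>l. \<theta>hat n \<omega> l - \<theta> l)\<bar> > K0} \<le> e"
      using rate e unfolding bounded_in_prob_def by blast
    define K where "K = max K0 0"
    define E where "E n = {\<omega> \<in> space M. \<bar>sqrt (real n) * max_norm ?d (\<lambda>l. \<theta>hat n \<omega> l - \<theta> l)\<bar> > K}" for n
    have nm: "(\<lambda>\<omega>. max_norm ?d (\<lambda>l. \<theta>hat n \<omega> l - \<theta> l)) \<in> borel_measurable M" for n
      unfolding max_norm_def
      by (intro borel_measurable_Max borel_measurable_abs borel_measurable_diff borel_measurable_const hatm) auto
    have Em: "\<bar>sqrt (real n) * max_norm ?d (\<lambda>l. \<theta>hat n \<omega> l - \<theta> l)\<bar> > K0" if "\<omega> \<in> E n" for n \<omega>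
      using that by (simp add: E_def K_def)
    have E_m: "E n \<in> events" for n unfolding E_def using nm[of n] by measurable
    have K0m: "{\<omega> \<in> space M. \<bar>sqrt (real n) * max_norm ?d (\<lambda>l. \<theta>hat n \<omega> l - \<theta> l)\<bar> > K0} \<in> events" for n
      using nm[of n] by measurable
    have pE: "\<forall>\<^sub>F n in sequentially. prob (E n) \<le> e"
      using K0
    proof eventually_elim
      case (elim n)
      have "prob (E n) \<le> measure M {\<omega> \<in> space M. \<bar>sqrt (real n) * max_norm ?d (\<lambda>l. \<theta>hat n \<omega> l - \<theta> l)\<bar> > K0}"
        using Em K0m by (intro finite_measure_mono) (auto simp: E_def)
      then show ?case using elim by linarith
    qed
    define EL where "EL = (\<integral>\<omega>. Lam (past 0 \<omega>) \<partial>M)"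
    have EL: "0 \<le> EL" using Lam0 by (simp add: EL_def)
    \<comment> \<open>Mesh of the grid, small enough that the Lipschitz error costs at most \<open>d\<close>.\<close>
    define m where "m = d / (\<kappa> * 2 * EL + 1)"
    have den: "0 < \<kappa> * 2 * EL + 1" using \<kappa> EL by (intro add_nonneg_pos) simp_all
    have m: "0 < m" using d den by (simp add: m_def)
    have md: "\<kappa> * (2 * m * EL) \<le> d"
    proof -
      have "m * (\<kappa> * 2 * EL + 1) = d" using den by (simp add: m_def)
      then show ?thesis using m by (simp add: algebra_simps)
    qed
    obtain G where G: "finite G" "\<And>v. (\<And>l. l < ?d \<Longrightarrow> \<bar>v l\<bar> \<le> K) \<Longrightarrow> \<exists>w\<in>G. \<forall>l<?d. \<bar>v l - w l\<bar> \<le> m"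
      using finite_grid[OF m, where K=K and d="?d"] by metis
    define a where "a = C * (K / tmin)\<^sup>2"
    have a: "0 \<le> a" using c0 by (simp add: a_def)
    \<comment> \<open>\<open>R1\<close> converges to zero in mean; the remaining term does so almost surely, without a
      claim about its mean, as \<open>W\<close> need not be integrable.\<close>
    define R1 where "R1 n \<omega> = \<kappa> * ((\<Sum>w\<in>G. \<bar>?A (f w) n \<omega> - (\<integral>\<omega>. f w (past 0 \<omega>) \<partial>M)\<bar>) + m * \<bar>?A Lam n \<omega> - EL\<bar>)
        + a / sqrt (real n) * ?A z n \<omega>" for n \<omega>
    define Z where "Z n \<omega> = R1 n \<omega> + W \<omega> * T \<omega> / sqrt (real n)" for n \<omega>
    have R1_m: "R1 n \<in> borel_measurable M" for n
      unfolding R1_def[abs_def]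
      by (intro borel_measurable_add borel_measurable_times borel_measurable_const borel_measurable_sum
          borel_measurable_abs borel_measurable_diff borel_measurable_divide
          measurable_past[OF f_m] measurable_past[OF Lam_m] measurable_past[OF z_m])
    have Z_m: "Z n \<in> borel_measurable M" for n
      unfolding Z_def[abs_def] by (intro borel_measurable_add borel_measurable_divide R1_m WT_m borel_measurable_const)
    have R1nn: "0 \<le> R1 n \<omega>" for n \<omega>
      unfolding R1_def using \<kappa> m a z0
      by (intro add_nonneg_nonneg mult_nonneg_nonneg sum_nonneg divide_nonneg_nonneg) simp_all
    have nZ: "null_in_prob M Z"
    proof (rule null_in_prob_of_truncated_mean[OF Z_m])
      define Ez where "Ez = (\<integral>\<omega>. z (past 0 \<omega>) \<partial>M)"
      define up where "up n = \<kappa> * ((\<Sum>w\<in>G. avg_error (f w) n) + m * avg_error Lam n) + a / sqrt (real n) * Ez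
          + (\<integral>\<omega>. min 1 \<bar>W \<omega> * T \<omega> / sqrt (real n)\<bar> \<partial>M)" for n
      have sq0: "(\<lambda>n. c / sqrt (real n)) \<longlonglongrightarrow> 0" for c :: real
        by (intro tendsto_divide_0[OF tendsto_const] filterlim_at_top_imp_at_infinity
            filterlim_compose[OF sqrt_at_top filterlim_real_sequentially])
      have "(\<lambda>n. \<integral>\<omega>. min 1 \<bar>W \<omega> * T \<omega> / sqrt (real n)\<bar> \<partial>M) \<longlonglongrightarrow> (\<integral>\<omega>. min 1 \<bar>0\<bar> \<partial>M)"
      proof (rule integral_dominated_convergence[where w="\<lambda>_. 1"])
        show "AE \<omega> in M. (\<lambda>n. min 1 \<bar>W \<omega> * T \<omega> / sqrt (real n)\<bar>) \<longlonglongrightarrow> min 1 \<bar>0\<bar>"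
          by (intro AE_I2 tendsto_min tendsto_const tendsto_rabs sq0)
        show "(\<lambda>\<omega>. min 1 \<bar>W \<omega> * T \<omega> / sqrt (real n)\<bar>) \<in> borel_measurable M" for n
          by (intro borel_measurable_min borel_measurable_const borel_measurable_abs borel_measurable_divide WT_m)
        show "AE \<omega> in M. norm (min 1 \<bar>W \<omega> * T \<omega> / sqrt (real n)\<bar>) \<le> 1" for n
          by (intro AE_I2) (simp add: abs_of_nonneg)
      qed simp_all
      then have lim3: "(\<lambda>n. \<integral>\<omega>. min 1 \<bar>W \<omega> * T \<omega> / sqrt (real n)\<bar> \<partial>M) \<longlonglongrightarrow> 0" by simp
      have "up \<longlonglongrightarrow> \<kappa> * ((\<Sum>w\<in>G. 0) + m * 0) + 0 * Ez + 0"
        unfolding up_def[abs_def]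
        by (intro tendsto_add tendsto_mult tendsto_sum tendsto_const lim3 sq0 mean_ergodic f_m If Lam_m ILam)
      then have up0: "up \<longlonglongrightarrow> 0" by simp
      have Ag: "integrable M (\<lambda>\<omega>. ?A g n \<omega>)" if "g \<in> borel_measurable paths" "integrable M (\<lambda>\<omega>. g (past 0 \<omega>))" for g n
        using that integrable_past[OF that(1)]
        by (intro Bochner_Integration.integrable_divide Bochner_Integration.integrable_sum) blast
      have le: "(\<integral>\<omega>. min 1 \<bar>Z n \<omega>\<bar> \<partial>M) \<le> up n" if n: "1 \<le> n" for n
      proof -
        let ?d1 = "\<lambda>w \<omega>. \<bar>?A (f w) n \<omega> - (\<integral>\<omega>. f w (past 0 \<omega>) \<partial>M)\<bar>"
        have I1: "integrable M (?d1 w)" for w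
          by (intro integrable_abs Bochner_Integration.integrable_diff integrable_const Ag f_m If)
        have I2: "integrable M (\<lambda>\<omega>. \<bar>?A Lam n \<omega> - EL\<bar>)"
          by (intro integrable_abs Bochner_Integration.integrable_diff integrable_const Ag Lam_m ILam)
        have I3: "integrable M (\<lambda>\<omega>. ?A z n \<omega>)" by (intro Ag z_m Iz)
        have IR: "integrable M (R1 n)" unfolding R1_def[abs_def]
          by (intro Bochner_Integration.integrable_add integrable_mult_right Bochner_Integration.integrable_sum I1 I2 I3)
        have IW: "integrable M (\<lambda>\<omega>. min 1 \<bar>W \<omega> * T \<omega> / sqrt (real n)\<bar>)"
          by (rule integrable_const_bound[of _ 1]) (use WT_m in auto)
        have IZ: "integrable M (\<lambda>\<omega>. min 1 \<bar>Z n \<omega>\<bar>)"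
          by (rule integrable_const_bound[of _ 1]) (use Z_m in auto)
        have "(\<integral>\<omega>. min 1 \<bar>Z n \<omega>\<bar> \<partial>M) \<le> (\<integral>\<omega>. R1 n \<omega> + min 1 \<bar>W \<omega> * T \<omega> / sqrt (real n)\<bar> \<partial>M)"
        proof (intro integral_mono IZ Bochner_Integration.integrable_add IR IW)
          fix \<omega>
          show "min 1 \<bar>Z n \<omega>\<bar> \<le> R1 n \<omega> + min 1 \<bar>W \<omega> * T \<omega> / sqrt (real n)\<bar>"
            using R1nn[of n \<omega>] unfolding Z_def by linarith
        qed
        also have "\<dots> = (\<integral>\<omega>. R1 n \<omega> \<partial>M) + (\<integral>\<omega>. min 1 \<bar>W \<omega> * T \<omega> / sqrt (real n)\<bar> \<partial>M)"
          by (intro Bochner_Integration.integral_add IR IW)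
        finally have 1: "(\<integral>\<omega>. min 1 \<bar>Z n \<omega>\<bar> \<partial>M)
            \<le> (\<integral>\<omega>. R1 n \<omega> \<partial>M) + (\<integral>\<omega>. min 1 \<bar>W \<omega> * T \<omega> / sqrt (real n)\<bar> \<partial>M)" .
        have Az: "(\<integral>\<omega>. ?A z n \<omega> \<partial>M) = Ez"
        proof -
          have "(\<integral>\<omega>. ?A z n \<omega> \<partial>M) = (\<Sum>t=1..n. (\<integral>\<omega>. z (past (int t) \<omega>) \<partial>M)) / real n" using Izt by simp
          also have "(\<Sum>t=1..n. (\<integral>\<omega>. z (past (int t) \<omega>) \<partial>M)) = (\<Sum>t=1..n. Ez)"
            unfolding Ez_def by (intro sum.cong refl integral_past[OF z_m])
          finally show ?thesis using n by simp
        qed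
        have "(\<integral>\<omega>. R1 n \<omega> \<partial>M) = (\<integral>\<omega>. \<kappa> * ((\<Sum>w\<in>G. ?d1 w \<omega>) + m * \<bar>?A Lam n \<omega> - EL\<bar>) \<partial>M) + (\<integral>\<omega>. a / sqrt (real n) * ?A z n \<omega> \<partial>M)"
          unfolding R1_def
          by (intro Bochner_Integration.integral_add integrable_mult_right Bochner_Integration.integrable_add
              Bochner_Integration.integrable_sum I1 I2 I3)
        also have "(\<integral>\<omega>. a / sqrt (real n) * ?A z n \<omega> \<partial>M) = a / sqrt (real n) * Ez"
          unfolding Az[symmetric] by (rule integral_mult_right_zero)
        also have "(\<integral>\<omega>. \<kappa> * ((\<Sum>w\<in>G. ?d1 w \<omega>) + m * \<bar>?A Lam n \<omega> - EL\<bar>) \<partial>M)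
            = \<kappa> * (\<integral>\<omega>. (\<Sum>w\<in>G. ?d1 w \<omega>) + m * \<bar>?A Lam n \<omega> - EL\<bar> \<partial>M)"
          by (rule integral_mult_right_zero)
        also have "(\<integral>\<omega>. (\<Sum>w\<in>G. ?d1 w \<omega>) + m * \<bar>?A Lam n \<omega> - EL\<bar> \<partial>M)
            = (\<integral>\<omega>. (\<Sum>w\<in>G. ?d1 w \<omega>) \<partial>M) + (\<integral>\<omega>. m * \<bar>?A Lam n \<omega> - EL\<bar> \<partial>M)"
          by (intro Bochner_Integration.integral_add integrable_mult_right Bochner_Integration.integrable_sum I1 I2)
        also have "(\<integral>\<omega>. m * \<bar>?A Lam n \<omega> - EL\<bar> \<partial>M) = m * avg_error Lam n"
          unfolding avg_error_def EL_def by (rule integral_mult_right_zero)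
        also have "(\<integral>\<omega>. (\<Sum>w\<in>G. ?d1 w \<omega>) \<partial>M) = (\<Sum>w\<in>G. avg_error (f w) n)"
          unfolding avg_error_def by (intro Bochner_Integration.integral_sum I1)
        finally show ?thesis using 1 unfolding up_def by linarith
      qed
      show "(\<lambda>n. \<integral>\<omega>. min 1 \<bar>Z n \<omega>\<bar> \<partial>M) \<longlonglongrightarrow> 0"
      proof (rule tendsto_sandwich[OF _ _ tendsto_const up0])
        show "\<forall>\<^sub>F n in sequentially. 0 \<le> (\<integral>\<omega>. min 1 \<bar>Z n \<omega>\<bar> \<partial>M)" by (intro always_eventually allI) simp
        show "\<forall>\<^sub>F n in sequentially. (\<integral>\<omega>. min 1 \<bar>Z n \<omega>\<bar> \<partial>M) \<le> up n"
          using le by (rule eventually_sequentiallyI)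
      qed
    qed
    have dom: "\<forall>\<^sub>F n in sequentially. AE \<omega> in M. \<omega> \<notin> E n \<longrightarrow>
        \<bar>\<bar>1 / sqrt (real n) * (\<Sum>t=1..n. \<bar>residual p q (\<theta>hat n \<omega>) (\<lambda>s. X s \<omega>) t ^ k - \<epsilon> (int t) \<omega> ^ k\<bar>)
            - real k / 2 * psi M p q \<theta> \<epsilon> X k (\<lambda>l. sqrt (real n) * (\<theta>hat n \<omega> l - \<theta> l))\<bar>\<bar> \<le> d + Z n \<omega>"
    proof -
      have "(\<lambda>n. (K / tmin) / sqrt (real n)) \<longlonglongrightarrow> 0"
        by (intro tendsto_divide_0[OF tendsto_const] filterlim_at_top_imp_at_infinity
            filterlim_compose[OF sqrt_at_top filterlim_real_sequentially])
      then have "\<forall>\<^sub>F n in sequentially. (K / tmin) / sqrt (real n) < \<eta>0"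
        using c0(1) by (rule order_tendstoD(2))
      then show ?thesis
        using eventually_ge_at_top[of 1]
      proof eventually_elim
        case (elim n)
        then have n: "1 \<le> n" and small: "(K / tmin) / sqrt (real n) \<le> \<eta>0" by simp_all
        define \<eta> where "\<eta> = (K / tmin) / sqrt (real n)"
        have sn: "0 < sqrt (real n)" using n by simp
        have eta: "0 \<le> \<eta>" "\<eta> \<le> \<eta>0" using tmin small by (simp_all add: \<eta>_def K_def)
        show ?case
          using AE_space sV AE_grad AE_hist AE_model sigma_eq_sigma2 sT
        proof eventually_elim
          case (elim \<omega>)
          have \<omega>: "\<omega> \<in> space M" using elim(1) .
          have sV': "summable (\<lambda>i. B ^ i * hist_fun (past t \<omega>) i powr \<delta>)" for t using elim(2) by blast
          have gr: "grad_log_sigma2 p q \<theta> (\<lambda>s. X s \<omega>) t l = grad_fun l (past t \<omega>)" for t l using elim(3) by blast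
          have hi: "hist (\<lambda>s. X s \<omega>) t = hist_fun (past t \<omega>)" for t using elim(4) by blast
          have sg: "0 \<le> \<sigma> t \<omega>" "X t \<omega> = \<sigma> t \<omega> * \<epsilon> t \<omega>" for t using elim(5) by blast+
          have s2: "(\<sigma> t \<omega>)\<^sup>2 = sigma2 p q \<theta> (\<lambda>s. X s \<omega>) t" for t using elim(6) by blast
          note sT' = elim(7)
          let ?x = "\<lambda>s. X s \<omega>" and ?u = "\<theta>hat n \<omega>"
          have "\<bar>\<bar>1 / sqrt (real n) * (\<Sum>t=1..n. \<bar>residual p q ?u ?x t ^ k - \<epsilon> (int t) \<omega> ^ k\<bar>)
            - real k / 2 * psi M p q \<theta> \<epsilon> X k (\<lambda>l. sqrt (real n) * (?u l - \<theta> l))\<bar>\<bar> \<le> d + Z n \<omega>"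
            if nE: "\<omega> \<notin> E n"
          proof -
          define h where "h l = ?u l - \<theta> l" for l
          define v where "v l = sqrt (real n) * h l" for l
          have vK: "\<bar>v l\<bar> \<le> K" if "l < ?d" for l
          proof -
            have "\<bar>v l\<bar> \<le> sqrt (real n) * max_norm ?d h"
              unfolding v_def abs_mult using max_norm_ge[OF that, of h] sn by (simp add: mult_left_mono)
            also have "\<dots> \<le> K" using nE \<omega> by (simp add: E_def h_def[abs_def] not_less abs_le_iff)
            finally show ?thesis .
          qed
          have hb: "\<bar>?u l - \<theta> l\<bar> \<le> \<eta> * \<theta> l" if l: "l < ?d" for l
          proof -
            have "\<bar>h l\<bar> = \<bar>v l\<bar> / sqrt (real n)" using sn by (simp add: v_def abs_mult)
            also have "\<dots> \<le> K / sqrt (real n)" using vK[OF l] sn by (simp add: divide_right_mono)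
            also have "\<dots> = \<eta> * tmin" using tmin(1) by (simp add: \<eta>_def)
            also have "\<dots> \<le> \<eta> * \<theta> l" by (intro mult_left_mono tmin l eta)
            finally show ?thesis by (simp add: h_def)
          qed
          define rt where "rt t = \<bar>residual p q ?u ?x t ^ k - \<epsilon> (int t) \<omega> ^ k\<bar>" for t
          have one: "\<bar>rt t - \<kappa> * (f v (past (int t) \<omega>) / sqrt (real n))\<bar>
              \<le> C * \<eta>\<^sup>2 * z (past (int t) \<omega>) + W \<omega> * (rh ^ t * z (past (int t) \<omega>))" for t
          proof -
            have xt: "?x (int t) = sqrt (sigma2 p q \<theta> ?x (int t)) * \<epsilon> (int t) \<omega>"
              using sg[of "int t"] s2[of "int t"] by (metis real_sqrt_unique)
            have fv: "f v (past (int t) \<omega>) = sqrt (real n) * (\<bar>\<epsilon> (int t) \<omega>\<bar> ^ k * \<bar>\<Sum>l<?d. grad_fun l (past (int t) \<omega>) * (?u l - \<theta> l)\<bar>)"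
            proof -
              have "(\<Sum>l<?d. grad_fun l (past (int t) \<omega>) * v l) = sqrt (real n) * (\<Sum>l<?d. grad_fun l (past (int t) \<omega>) * (?u l - \<theta> l))"
                unfolding v_def h_def sum_distrib_left by (intro sum.cong refl) (simp only: mult_ac)
              then show ?thesis using sn by (simp only: f_def p0 abs_mult) simp
            qed
            have sx: "summable (\<lambda>i. B ^ i * hist ?x s i powr \<delta>)" for s unfolding hi by (rule sV')
            have zt: "z (past (int t) \<omega>) = \<bar>\<epsilon> (int t) \<omega>\<bar> ^ k * (\<Sum>i. B ^ i * hist ?x (int t) i powr \<delta>)"
              unfolding hi using zV[OF sV'] by (simp only: V_def p0)
            have "\<bar>rt t - \<kappa> * (\<bar>\<epsilon> (int t) \<omega>\<bar> ^ k * \<bar>\<Sum>l<?d. grad_fun l (past (int t) \<omega>) * (?u l - \<theta> l)\<bar>)\<bar>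
                \<le> z (past (int t) \<omega>) * (C * \<eta>\<^sup>2 + W \<omega> * rh ^ t)"
              using expand[OF sx sx eta hb xt]
              unfolding rt_def zt W_def Qs_def \<kappa>_def rh_def gr .
            then show ?thesis unfolding fv using sn by (simp add: algebra_simps)
          qed
          have "\<bar>(\<Sum>t=1..n. rt t) - (\<Sum>t=1..n. \<kappa> * (f v (past (int t) \<omega>) / sqrt (real n)))\<bar>
              \<le> (\<Sum>t=1..n. C * \<eta>\<^sup>2 * z (past (int t) \<omega>) + W \<omega> * (rh ^ t * z (past (int t) \<omega>)))"
            unfolding sum_subtractf[symmetric] by (intro order_trans[OF sum_abs sum_mono] one)
          also have "\<dots> = C * \<eta>\<^sup>2 * (\<Sum>t=1..n. z (past (int t) \<omega>)) + W \<omega> * (\<Sum>t=1..n. rh ^ t * z (past (int t) \<omega>))"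
            by (simp only: sum.distrib sum_distrib_left)
          also have "\<dots> \<le> C * \<eta>\<^sup>2 * (\<Sum>t=1..n. z (past (int t) \<omega>)) + W \<omega> * T \<omega>"
          proof (intro add_left_mono mult_left_mono)
            show "(\<Sum>t=1..n. rh ^ t * z (past (int t) \<omega>)) \<le> T \<omega>"
              unfolding T_def using rh z0 by (intro sum_le_suminf sT') simp_all
            have "0 \<le> Qs \<omega>"
            proof -
              have "summable (\<lambda>i. B ^ i * hist ?x 0 i powr \<delta>)" unfolding hi by (rule sV')
              then have "summable (\<lambda>i. (rh ^ i * hist ?x 0 i) powr \<delta>)"
                unfolding powr_mult power_powr_swap[OF rh(1)] using c0 \<delta> by (simp add: rh_def powr_powr)
              then have "summable (\<lambda>i. rh ^ i * hist ?x 0 i)"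
                by (rule summable_of_summable_powr[OF _ \<delta>, rotated]) (use rh in \<open>simp add: hist_nonneg\<close>)
              then show ?thesis unfolding Qs_def using rh by (intro suminf_nonneg) (simp_all add: hist_nonneg)
            qed
            then show "0 \<le> W \<omega>" using c0 by (simp add: W_def)
          qed
          finally have "\<bar>(\<Sum>t=1..n. rt t) - (\<Sum>t=1..n. \<kappa> * (f v (past (int t) \<omega>) / sqrt (real n)))\<bar> / sqrt (real n)
              \<le> (C * \<eta>\<^sup>2 * (\<Sum>t=1..n. z (past (int t) \<omega>)) + W \<omega> * T \<omega>) / sqrt (real n)"
            using sn by (intro divide_right_mono) simp_all
          moreover have "\<bar>(\<Sum>t=1..n. rt t) - (\<Sum>t=1..n. \<kappa> * (f v (past (int t) \<omega>) / sqrt (real n)))\<bar> / sqrt (real n)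
              = \<bar>1 / sqrt (real n) * (\<Sum>t=1..n. rt t) - \<kappa> * ?A (f v) n \<omega>\<bar>"
          proof -
            have "(\<Sum>t=1..n. \<kappa> * (f v (past (int t) \<omega>) / sqrt (real n))) = \<kappa> * ((\<Sum>t=1..n. f v (past (int t) \<omega>)) / sqrt (real n))"
              by (simp only: sum_distrib_left sum_divide_distrib)
            then have "(\<Sum>t=1..n. \<kappa> * (f v (past (int t) \<omega>) / sqrt (real n))) / sqrt (real n) = \<kappa> * ?A (f v) n \<omega>"
              by simp
            then have "1 / sqrt (real n) * (\<Sum>t=1..n. rt t) - \<kappa> * ?A (f v) n \<omega>
                = ((\<Sum>t=1..n. rt t) - (\<Sum>t=1..n. \<kappa> * (f v (past (int t) \<omega>) / sqrt (real n)))) / sqrt (real n)"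
              by (simp only: diff_divide_distrib times_divide_eq_left mult_1_left)
            then show ?thesis by (simp only: abs_divide abs_of_pos[OF sn])
          qed
          moreover have "(C * \<eta>\<^sup>2 * (\<Sum>t=1..n. z (past (int t) \<omega>)) + W \<omega> * T \<omega>) / sqrt (real n)
              = a / sqrt (real n) * ?A z n \<omega> + W \<omega> * T \<omega> / sqrt (real n)"
          proof -
            have "\<eta>\<^sup>2 = (K / tmin)\<^sup>2 / real n" 
              unfolding \<eta>_def power_divide[of _ "sqrt (real n)"] by simp
            then show ?thesis by (simp add: a_def add_divide_distrib)
          qed
          ultimately have part1: "\<bar>1 / sqrt (real n) * (\<Sum>t=1..n. rt t) - \<kappa> * ?A (f v) n \<omega>\<bar>
              \<le> a / sqrt (real n) * ?A z n \<omega> + W \<omega> * T \<omega> / sqrt (real n)" by linarith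
          obtain w where w: "w \<in> G" "\<And>l. l < ?d \<Longrightarrow> \<bar>v l - w l\<bar> \<le> m" using G(2)[of v] vK by blast
          let ?F = "\<lambda>v. \<integral>\<omega>. f v (past 0 \<omega>) \<partial>M"
          have dA: "\<bar>?A (f v) n \<omega> - ?A (f w) n \<omega>\<bar> \<le> m * ?A Lam n \<omega>"
          proof -
            have "\<bar>(\<Sum>t=1..n. f v (past (int t) \<omega>)) - (\<Sum>t=1..n. f w (past (int t) \<omega>))\<bar> \<le> (\<Sum>t=1..n. m * Lam (past (int t) \<omega>))"
              unfolding sum_subtractf[symmetric] by (intro order_trans[OF sum_abs sum_mono] flip w(2))
            then have "\<bar>(\<Sum>t=1..n. f v (past (int t) \<omega>)) - (\<Sum>t=1..n. f w (past (int t) \<omega>))\<bar> / real n \<le> (\<Sum>t=1..n. m * Lam (past (int t) \<omega>)) / real n"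
              by (intro divide_right_mono) simp_all
            then show ?thesis by (simp flip: diff_divide_distrib sum_distrib_left)
          qed
          have dF: "\<bar>?F v - ?F w\<bar> \<le> m * EL"
          proof -
            have "?F v - ?F w = (\<integral>\<omega>. f v (past 0 \<omega>) - f w (past 0 \<omega>) \<partial>M)" using If by simp
            also have "\<bar>\<dots>\<bar> \<le> (\<integral>\<omega>. \<bar>f v (past 0 \<omega>) - f w (past 0 \<omega>)\<bar> \<partial>M)" by (rule integral_abs_bound)
            also have "\<dots> \<le> (\<integral>\<omega>. m * Lam (past 0 \<omega>) \<partial>M)"
              by (intro integral_mono integrable_abs Bochner_Integration.integrable_diff If integrable_mult_right ILam flip w(2))
            finally show ?thesis by (simp add: EL_def)
          qed
          have dw: "\<bar>?A (f w) n \<omega> - ?F w\<bar> \<le> (\<Sum>w\<in>G. \<bar>?A (f w) n \<omega> - ?F w\<bar>)"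
            using w(1) G(1) by (intro member_le_sum) simp_all
          have mA: "m * ?A Lam n \<omega> \<le> m * \<bar>?A Lam n \<omega> - EL\<bar> + m * EL"
            unfolding distrib_left[symmetric] using m by (intro mult_left_mono) simp_all
          have "\<bar>?A (f v) n \<omega> - ?F v\<bar> \<le> ((\<Sum>w\<in>G. \<bar>?A (f w) n \<omega> - ?F w\<bar>) + m * \<bar>?A Lam n \<omega> - EL\<bar>) + 2 * m * EL"
            using dA dF dw mA by linarith
          then have "\<kappa> * \<bar>?A (f v) n \<omega> - ?F v\<bar> \<le> \<kappa> * (((\<Sum>w\<in>G. \<bar>?A (f w) n \<omega> - ?F w\<bar>) + m * \<bar>?A Lam n \<omega> - EL\<bar>) + 2 * m * EL)"
            using \<kappa> by (intro mult_left_mono)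
          then have part2: "\<bar>\<kappa> * ?A (f v) n \<omega> - \<kappa> * ?F v\<bar> \<le> \<kappa> * ((\<Sum>w\<in>G. \<bar>?A (f w) n \<omega> - ?F w\<bar>) + m * \<bar>?A Lam n \<omega> - EL\<bar>) + d"
            using \<kappa> md unfolding right_diff_distrib[symmetric] abs_mult distrib_left[of \<kappa> _ "2 * m * EL"] by simp
          have "\<bar>1 / sqrt (real n) * (\<Sum>t=1..n. rt t) - \<kappa> * ?F v\<bar> \<le> d + Z n \<omega>"
            using part1 part2 unfolding Z_def R1_def by linarith
          then show ?thesis
            unfolding psi \<kappa>_def[symmetric] rt_def v_def h_def by simp
          qed
          then show ?case by blast
        qed
      qed
    qed
    show "\<exists>E Z. (\<forall>n. E n \<in> events) \<and> (\<forall>n. Z n \<in> borel_measurable M) \<and>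
      (\<forall>\<^sub>F n in sequentially. prob (E n) \<le> e) \<and> null_in_prob M Z \<and>
      (\<forall>\<^sub>F n in sequentially. AE \<omega> in M. \<omega> \<notin> E n \<longrightarrow>
        \<bar>\<bar>1 / sqrt (real n) * (\<Sum>t=1..n. \<bar>residual p q (\<theta>hat n \<omega>) (\<lambda>s. X s \<omega>) t ^ k - \<epsilon> (int t) \<omega> ^ k\<bar>)
            - real k / 2 * psi M p q \<theta> \<epsilon> X k (\<lambda>l. sqrt (real n) * (\<theta>hat n \<omega> l - \<theta> l))\<bar>\<bar> \<le> d + Z n \<omega>)"
      using E_m Z_m pE nZ dom by (intro exI[of _ E] exI[of _ Z]) blast
  qed
qed

end

theorem theorem1p3:
  fixes M :: "'a measure" and p q k :: nat and \<theta> :: "nat \<Rightarrow> real"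
    and \<epsilon> X \<sigma> :: "int \<Rightarrow> 'a \<Rightarrow> real" and \<theta>hat :: "nat \<Rightarrow> 'a \<Rightarrow> nat \<Rightarrow> real"
    and ulo uhi \<rho>0 \<zeta> :: real
  assumes model: "garch M p q \<theta> \<epsilon> X \<sigma>"
    and bounds: "0 < ulo" "ulo < uhi" "0 < \<rho>0" "\<rho>0 < 1" "real q * ulo < \<rho>0"
    and theta_int: "\<theta> \<in> (Euclidean_space (p + q + 1)) interior_of (param_space p q ulo uhi \<rho>0)"
    and estimator: "estimator_seq M X (p + q + 1) \<theta>hat"
    and rate: "bounded_in_prob M
                 (\<lambda>n \<omega>. sqrt (real n) * max_norm (p + q + 1) (\<lambda>l. \<theta>hat n \<omega> l - \<theta> l))"
    and zeta: "\<zeta> > 0"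
    and small_ball: "((\<lambda>x. x powr (- \<zeta>) * measure M {\<omega> \<in> space M. \<bar>\<epsilon> 0 \<omega>\<bar> \<le> x}) \<longlongrightarrow> 0) (at_right 0)"
    and k: "k \<ge> 1"
    and moment: "integrable M (\<lambda>\<omega>. \<bar>\<epsilon> 0 \<omega>\<bar> ^ k)"
  shows "null_in_prob M (\<lambda>n \<omega>.
           \<bar>1 / sqrt (real n)
              * (\<Sum>t=1..n. \<bar>residual p q (\<theta>hat n \<omega>) (\<lambda>s. X s \<omega>) t ^ k - \<epsilon> (int t) \<omega> ^ k\<bar>)
            - real k / 2 * psi M p q \<theta> \<epsilon> X k (\<lambda>l. sqrt (real n) * (\<theta>hat n \<omega> l - \<theta> l))\<bar>)"
proof -
  interpret garch M p q \<theta> \<epsilon> X \<sigma> by (rule model)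
  have theta: "\<theta> \<in> param_space p q ulo uhi \<rho>0"
    by (rule subsetD[OF interior_of_subset theta_int])
  interpret positive_garch M p q \<theta> \<epsilon> X \<sigma>
  proof unfold_locales
    fix l assume "l < p + q + 1"
    with theta have "ulo \<le> \<theta> l" by (auto simp: param_space_def)
    then show "0 < \<theta> l" using bounds(1) by linarith
  next
    show "(\<Sum>j=1..q. \<theta> (p + j)) < 1"
      using theta bounds(4) by (auto simp: param_space_def)
  qed
  have "(\<lambda>\<omega>. \<theta>hat n \<omega> l) \<in> borel_measurable M" if "l < p + q + 1" for n l
  proof -
    have "\<exists>h \<in> borel_measurable (Pi\<^sub>M {..n} (\<lambda>_. borel)). \<forall>\<omega>\<in>space M. \<theta>hat n \<omega> l = h (\<lambda>i\<in>{..n}. X (int i) \<omega>)"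
      using estimator that unfolding estimator_seq_def by blast
    then obtain h where h: "h \<in> borel_measurable (Pi\<^sub>M {..n} (\<lambda>_. borel))"
      and eq: "\<And>\<omega>. \<omega> \<in> space M \<Longrightarrow> \<theta>hat n \<omega> l = h (\<lambda>i\<in>{..n}. X (int i) \<omega>)"
      by blast
    have "(\<lambda>\<omega>. \<lambda>i\<in>{..n}. X (int i) \<omega>) \<in> measurable M (Pi\<^sub>M {..n} (\<lambda>_. borel))"
      by (intro measurable_restrict X_rv)
    from measurable_compose[OF this h] show ?thesis
      using eq by (subst measurable_cong[where g="\<lambda>\<omega>. h (\<lambda>i\<in>{..n}. X (int i) \<omega>)"]) simp_all
  qed
  from residual_power_deviation[OF this rate moment] show ?thesis .
qed


end
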